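(* Let $K$ be an algebraically closed field of characteristic $0$, let $d\ge 2$, and let $R=K[x_1,\ldots,x_{d+1}]/(x_1^2+\cdots+x_{d+1}^2)$. Then the differential signature of $R$ is $\mathrm{s}^{\mathrm{diff}}_K(R)=\left(\tfrac12\right)^{d-1}$.
   Context: $R$ is standard graded with homogeneous maximal ideal $\mathfrak m$ and $\dim R=d$. Differential operators: $D^0_{R|K}=\operatorname{Hom}_R(R,R)$ and $D^n_{R|K}=\{\delta\in\operatorname{Hom}_K(R,R) : [\delta,r]\in D^{n-1}_{R|K}\ \forall r\in R\}$. Differential powers: $\mathfrak m^{\langle n\rangle_K}=\{f\in R : \delta(f)\in\mathfrak m \text{ for all }\delta\in D^{n-1}_{R|K}\}$. Differential signature: $\mathrm{s}^{\mathrm{diff}}_K(R)=\limsup_{n\to\infty}\dfrac{\lambda_R(R/\mathfrak m^{\langle n\rangle_K})}{n^d/d!}$, where $\lambda_R$ is length. *)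

theory Defs
  imports
    "HOL-Algebra.Algebra"
    "HOL-Algebra.Algebraic_Closure_Type"
    "HOL-Library.Poly_Mapping"
    "HOL-Library.Extended_Real"
begin

text \<open>
  Modules and algebras over a base ring are records as in the locales \<^locale>\<open>module\<close> and
  \<^locale>\<open>algebra\<close>.  An algebra record carries the action of its base ring, so \<open>R\<close> and \<open>R/I\<close>
  as modules over \<open>R\<close> need records of their own.
\<close>

definition with_smult :: "('r, 'x) ring_scheme \<Rightarrow> ('a \<Rightarrow> 'r \<Rightarrow> 'r) \<Rightarrow> ('a, 'r) module" where
  "with_smult R f =
     \<lparr>carrier = carrier R, monoid.mult = monoid.mult R, one = one R,
      ring.zero = ring.zero R, add = add R, module.smult = f\<rparr>"

definition regular_module :: "('r, 'x) ring_scheme \<Rightarrow> ('r, 'r) module" where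
  "regular_module R = with_smult R (monoid.mult R)"

definition quotient_module :: "('r, 'x) ring_scheme \<Rightarrow> 'r set \<Rightarrow> ('r, 'r set) module" where
  "quotient_module R I =
     with_smult (R Quot I) (\<lambda>r u. (I +>\<^bsub>R\<^esub> r) \<otimes>\<^bsub>R Quot I\<^esub> u)"

text \<open>Elements of \<^term>\<open>module_Hom A M N\<close> are unconstrained outside the carrier of \<^term>\<open>M\<close>.\<close>

definition module_Hom ::
    "('a, 'x) ring_scheme \<Rightarrow> ('a, 'm, 'y) module_scheme \<Rightarrow> ('a, 'n, 'z) module_scheme
      \<Rightarrow> ('m \<Rightarrow> 'n) set" where
  "module_Hom A M N =
     {f \<in> carrier M \<rightarrow> carrier N.
        (\<forall>x\<in>carrier M. \<forall>y\<in>carrier M. f (x \<oplus>\<^bsub>M\<^esub> y) = f x \<oplus>\<^bsub>N\<^esub> f y) \<and>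
        (\<forall>a\<in>carrier A. \<forall>x\<in>carrier M. f (a \<odot>\<^bsub>M\<^esub> x) = a \<odot>\<^bsub>N\<^esub> f x)}"

definition module_length :: "('a, 'x) ring_scheme \<Rightarrow> ('a, 'm, 'y) module_scheme \<Rightarrow> enat" where
  "module_length A M =
     Sup {enat n | n. \<exists>N :: nat \<Rightarrow> 'm set.
       (\<forall>i\<le>n. submodule (N i) A M) \<and> (\<forall>i<n. N i \<subset> N (Suc i))}"

definition krull_dim :: "('r, 'x) ring_scheme \<Rightarrow> enat" where
  "krull_dim R =
     Sup {enat n | n. \<exists>P :: nat \<Rightarrow> 'r set.
       (\<forall>i\<le>n. primeideal (P i) R) \<and> (\<forall>i<n. P i \<subset> P (Suc i))}"

primrec diff_ops ::
    "('k, 'x) ring_scheme \<Rightarrow> ('k, 'r, 'y) module_scheme \<Rightarrow> nat \<Rightarrow> ('r \<Rightarrow> 'r) set" where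
  "diff_ops K R 0 = module_Hom R (regular_module R) (regular_module R)"
| "diff_ops K R (Suc n) =
     {\<delta> \<in> module_Hom K R R.
        \<forall>r\<in>carrier R. (\<lambda>x. \<delta> (r \<otimes>\<^bsub>R\<^esub> x) \<ominus>\<^bsub>R\<^esub> r \<otimes>\<^bsub>R\<^esub> \<delta> x) \<in> diff_ops K R n}"

text \<open>Meant for \<open>n \<ge> 1\<close>; truncated subtraction makes the power for \<open>n = 0\<close> equal that for \<open>n = 1\<close>.\<close>

definition diff_power ::
    "('k, 'x) ring_scheme \<Rightarrow> ('k, 'r, 'y) module_scheme \<Rightarrow> 'r set \<Rightarrow> nat \<Rightarrow> 'r set" where
  "diff_power K R I n = {f \<in> carrier R. \<forall>\<delta>\<in>diff_ops K R (n - 1). \<delta> f \<in> I}"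

definition diff_signature ::
    "('k, 'x) ring_scheme \<Rightarrow> ('k, 'r, 'y) module_scheme \<Rightarrow> 'r set \<Rightarrow> ereal" where
  "diff_signature K R \<mm> =
     (let d = the_enat (krull_dim R) in
      limsup (\<lambda>n. ereal_of_enat (module_length R (quotient_module R (diff_power K R \<mm> n)))
                    / ereal (real n ^ d / fact d)))"

text \<open>
  Polynomials in \<open>x\<^sub>1, \<dots>, x\<^sub>N\<close> are finitely supported functions on exponent vectors; these in
  turn are finitely supported functions on the indices \<open>1, \<dots>, N\<close>.
\<close>

definition mpoly_ring :: "nat \<Rightarrow> ((nat \<Rightarrow>\<^sub>0 nat) \<Rightarrow>\<^sub>0 'k::comm_ring_1) ring" where
  "mpoly_ring N =
     ring_of_type_algebra\<lparr>carrier := {p. \<forall>m \<in> Poly_Mapping.keys p. Poly_Mapping.keys m \<subseteq> {1..N}}\<rparr>"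

definition mpoly_const :: "'k::comm_ring_1 \<Rightarrow> ((nat \<Rightarrow>\<^sub>0 nat) \<Rightarrow>\<^sub>0 'k)" where
  "mpoly_const c = Poly_Mapping.single 0 c"

definition mpoly_var :: "nat \<Rightarrow> ((nat \<Rightarrow>\<^sub>0 nat) \<Rightarrow>\<^sub>0 'k::comm_ring_1)" where
  "mpoly_var i = Poly_Mapping.single (Poly_Mapping.single i 1) 1"

definition mpoly_quotient ::
    "nat \<Rightarrow> ((nat \<Rightarrow>\<^sub>0 nat) \<Rightarrow>\<^sub>0 'k::comm_ring_1) set
      \<Rightarrow> ('k, ((nat \<Rightarrow>\<^sub>0 nat) \<Rightarrow>\<^sub>0 'k) set) module" where
  "mpoly_quotient N I =
     with_smult (mpoly_ring N Quot I)
       (\<lambda>c u. (I +>\<^bsub>mpoly_ring N\<^esub> mpoly_const c) \<otimes>\<^bsub>mpoly_ring N Quot I\<^esub> u)"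

text \<open>For a homogeneous proper ideal \<open>I\<close> this is the homogeneous maximal ideal of the quotient by \<open>I\<close>.\<close>

definition irrelevant_ideal ::
    "nat \<Rightarrow> ((nat \<Rightarrow>\<^sub>0 nat) \<Rightarrow>\<^sub>0 'k::comm_ring_1) set \<Rightarrow> ((nat \<Rightarrow>\<^sub>0 nat) \<Rightarrow>\<^sub>0 'k) set set" where
  "irrelevant_ideal N I =
     Idl\<^bsub>mpoly_quotient N I\<^esub> ((\<lambda>i. I +>\<^bsub>mpoly_ring N\<^esub> mpoly_var i) ` {1..N})"

definition quadric_ideal :: "nat \<Rightarrow> ((nat \<Rightarrow>\<^sub>0 nat) \<Rightarrow>\<^sub>0 'k::comm_ring_1) set" where
  "quadric_ideal N = PIdl\<^bsub>mpoly_ring N\<^esub> (\<Sum>i=1..N. mpoly_var i ^ 2)"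

end

theory Submission
  imports Defs "HOL-Real_Asymp.Real_Asymp"
begin

text \<open>
  Write \<open>q = x\<^sub>1\<^sup>2 + \<dots> + x\<^sub>N\<^sup>2\<close> with \<open>N = d + 1\<close> and \<open>E\<close> for the Euler operator.  The key point is
  that \<open>\<mm>\<^bsup>\<langle>n\<rangle>\<^esup> = \<mm>\<^bsup>c\<^esup>\<close> with \<open>c = \<lceil>n/2\<rceil>\<close>.

  The second-order operators \<open>K\<^sub>j = x\<^sub>j \<Delta> - (2 E + N - 2) \<partial>\<^sub>j\<close> preserve \<open>(q)\<close>, lower the degree by
  one and satisfy \<open>\<Sum> x\<^sub>j K\<^sub>j \<equiv> - (2 E + N - 4) E\<close> modulo \<open>q\<close>.  Hence a form of degree \<open>e\<close> that is
  nonzero in \<open>R\<close> is sent to a nonzero constant by some product of \<open>e\<close> of them, which has order \<open>2 e\<close>.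

  Conversely let \<open>\<delta>\<close> have order less than \<open>2 e\<close>.  Since \<open>q = 0\<close> in \<open>R\<close>, the operator \<open>\<Sum> x\<^sub>i \<delta> x\<^sub>i\<close>
  equals \<open>- 1/2 \<Sum> [[\<delta>, x\<^sub>i], x\<^sub>i]\<close>, so its order is lower by two.  Iterating \<open>e\<close> times and taking
  the component of degree \<open>e\<close>, we get \<open>\<Sum> \<phi>(x\<^sub>I) x\<^sub>I = 0\<close> in \<open>R\<close>, where \<open>x\<^sub>I\<close> runs over the products
  of \<open>e\<close> variables and \<open>\<phi>\<close> is \<open>\<delta>\<close> followed by the constant term.  Applying the \<open>K\<^sub>j\<close> to this
  relation yields \<open>\<phi>(x\<^sub>I) = 0\<close> for all \<open>I\<close>, so \<open>\<delta>(\<mm>\<^bsup>e\<^esup>) \<subseteq> \<mm>\<close>.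

  Finally, \<open>R/\<mm>\<^bsup>c\<^esup>\<close> has as a basis the monomials of degree less than \<open>c\<close> whose exponent of \<open>x\<^sub>1\<close> is
  at most one.
\<close>

section \<open>Polynomials and degrees\<close>

text \<open>Operators of order at most one map the maximal ideal into itself, so derivations cannot
  lower degrees and operators of order two have to do it; this is the origin of n/2. In the limit, c
  ~ n/2 contributes (1/2)^d. The multiplicity 2 of the quadric, visible as the two possible
  exponents of x_1 in the basis, contributes the remaining factor 2. The assumption d >= 2 enters as
  N >= 3: both directions divide by (e + 1)(2 e + N - 2), which must be nonzero already for e = 0.
  Elements of R are cosets and carry no degrees, so the arguments take place among polynomials
  modulo (q). An operator on R is represented there by choosing its values one by one, which leaves
  it linear only modulo (q). \<open>diff_signature\<close> reads its exponent off
  \<open>krull_dim\<close>, so dim R = d has to be proved too: from below by an explicit chain of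
  primes, from above by comparing the growth of algebraically independent elements with the same
  count of basis monomials that gives the length.\<close>

type_synonym 'k mpoly = "(nat \<Rightarrow>\<^sub>0 nat) \<Rightarrow>\<^sub>0 'k"

abbreviation "keys \<equiv> Poly_Mapping.keys"
abbreviation "lookup \<equiv> Poly_Mapping.lookup"
abbreviation "single \<equiv> Poly_Mapping.single"

definition polys :: "nat \<Rightarrow> 'k::comm_ring_1 mpoly set" where
  "polys N = {p. \<forall>m\<in>keys p. keys m \<subseteq> {1..N}}"

definition mdeg :: "(nat \<Rightarrow>\<^sub>0 nat) \<Rightarrow> nat" where
  "mdeg m = (\<Sum>i\<in>keys m. lookup m i)"

definition order_ge :: "nat \<Rightarrow> 'k::comm_ring_1 mpoly set" where
  "order_ge e = {p. \<forall>m\<in>keys p. e \<le> mdeg m}"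

definition homog :: "nat \<Rightarrow> 'k::comm_ring_1 mpoly set" where
  "homog e = {p. \<forall>m\<in>keys p. mdeg m = e}"

definition quad :: "nat \<Rightarrow> 'k::comm_ring_1 mpoly" where
  "quad N = (\<Sum>i=1..N. mpoly_var i ^ 2)"

definition linext :: "((nat \<Rightarrow>\<^sub>0 nat) \<Rightarrow> 'k::comm_ring_1 mpoly) \<Rightarrow> 'k mpoly \<Rightarrow> 'k mpoly" where
  "linext g p = (\<Sum>m\<in>keys p. mpoly_const (lookup p m) * g m)"

lemma mpoly_const_add: "mpoly_const (a + b) = mpoly_const a + mpoly_const b"
  by (simp add: mpoly_const_def single_add)

lemma mpoly_const_mult: "mpoly_const (a * b) = mpoly_const a * mpoly_const b"
  by (simp add: mpoly_const_def mult_single)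

lemma mpoly_const_simps [simp]: "mpoly_const 0 = 0" "mpoly_const 1 = 1"
  by (simp_all add: mpoly_const_def)

lemma mpoly_const_of_nat: "mpoly_const (of_nat n) = of_nat n"
  by (simp add: mpoly_const_def)

lemma const_mult_single: "mpoly_const c * single m a = single m (c * a)"
  by (simp add: mpoly_const_def mult_single)

lemma lookup_const_mult: "lookup (mpoly_const c * p) m = c * lookup p m"
proof -
  have "mpoly_const c * p = Poly_Mapping.map ((*) c) p"
    by (simp add: mpoly_const_def mult_map_scale_conv_mult)
  then show ?thesis by (simp add: Poly_Mapping.map.rep_eq when_def)
qed

lemma mpoly_eq_sum: "p = (\<Sum>m\<in>keys p. single m (lookup p m))"
proof (rule poly_mapping_eqI)
  fix m
  show "lookup p m = lookup (\<Sum>m\<in>keys p. single m (lookup p m)) m"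
    by (simp add: lookup_sum lookup_single when_def in_keys_iff)
qed

lemma linext_0 [simp]: "linext g 0 = 0"
  by (simp add: linext_def)

lemma linext_add: "linext g (p + p') = linext g p + linext g p'"
  unfolding linext_def
  by (rule setsum_keys_plus_distrib) (simp_all add: mpoly_const_add distrib_right)

lemma linext_single: "linext g (single m c) = mpoly_const c * g m"
  by (cases "c = 0") (simp_all add: linext_def)

lemma sum_of_additive:
  fixes L :: "'k::comm_ring_1 mpoly \<Rightarrow> 'b::ab_group_add"
  assumes "\<And>p p'. L (p + p') = L p + L p'"
  shows "L (\<Sum>a\<in>A. f a) = (\<Sum>a\<in>A. L (f a))"
proof -
  have "L 0 = 0" using assms[of 0 0] by simp
  then show ?thesis by (induction A rule: infinite_finite_induct) (auto simp: assms)
qed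

lemma mpoly_induct [case_names single add]:
  assumes "\<And>m c. P (single m c)" and "\<And>p p'. P p \<Longrightarrow> P p' \<Longrightarrow> P (p + p')"
  shows "P (p :: 'k::comm_ring_1 mpoly)"
proof -
  have "P (\<Sum>m\<in>A. single m (lookup p m))" if "finite A" for A
    using that assms(1)[of 0 0] by (induction A rule: finite_induct) (auto intro: assms)
  from this[of "keys p"] mpoly_eq_sum[of p] show ?thesis by simp
qed

text \<open>Keeps a condition on the monomials available in the single-term case. Zero is a case of
  its own because no monomial need satisfy \<open>Q\<close>.\<close>

lemma mpoly_induct_keys [consumes 1, case_names single zero add]:
  assumes p: "\<forall>m\<in>keys p. Q m"
    and "\<And>m c. Q m \<Longrightarrow> P (single m c)" and "P 0" and "\<And>p p'. P p \<Longrightarrow> P p' \<Longrightarrow> P (p + p')"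
  shows "P (p :: 'k::comm_ring_1 mpoly)"
proof -
  have "P (\<Sum>m\<in>A. single m (lookup p m))" if "finite A" "A \<subseteq> keys p" for A
    using that p assms by (induction A rule: finite_induct) auto
  from this[of "keys p"] mpoly_eq_sum[of p] show ?thesis by simp
qed

lemma keys_add': "keys (m + m' :: nat \<Rightarrow>\<^sub>0 nat) = keys m \<union> keys m'"
  by (auto simp: in_keys_iff lookup_add)

lemma mdeg_add: "mdeg (m + m') = mdeg m + mdeg m'"
  unfolding mdeg_def by (rule setsum_keys_plus_distrib) auto

lemma mdeg_single [simp]: "mdeg (single i k) = k"
  by (simp add: mdeg_def)

lemma mdeg_0 [simp]: "mdeg 0 = 0"
  by (simp add: mdeg_def)

lemma mdeg_eq_0: "mdeg m = 0 \<longleftrightarrow> m = 0"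
proof
  assume "mdeg m = 0"
  then have "\<forall>i\<in>keys m. lookup m i = 0" by (simp add: mdeg_def)
  then show "m = 0" by (intro poly_mapping_eqI) (auto simp: in_keys_iff)
qed simp

lemma mdeg_bounded: "keys m \<subseteq> {1..N} \<Longrightarrow> mdeg m = (\<Sum>i=1..N. lookup m i)"
  unfolding mdeg_def by (rule sum.mono_neutral_left) (auto simp: in_keys_iff)

lemma keys_mult_cases:
  assumes "m \<in> keys (p * p' :: 'k::comm_ring_1 mpoly)"
  obtains a b where "a \<in> keys p" "b \<in> keys p'" "m = a + b"
  using keys_mult[of p p'] assms by auto

lemma keys_sub_mono: "keys (p - p') \<subseteq> keys p \<union> keys (p' :: 'k::comm_ring_1 mpoly)"
  by (auto simp: in_keys_iff lookup_minus)

lemma polys_0 [simp]: "0 \<in> polys N" and polys_1 [simp]: "1 \<in> polys N"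
  by (auto simp: polys_def)

lemma polys_add [intro, simp]: "p \<in> polys N \<Longrightarrow> p' \<in> polys N \<Longrightarrow> p + p' \<in> polys N"
  using Poly_Mapping.keys_add[of p p'] by (fastforce simp: polys_def)

lemma polys_uminus [simp]: "- p \<in> polys N \<longleftrightarrow> p \<in> polys N"
proof -
  have "keys (-p) = keys p" by (auto simp: in_keys_iff)
  then show ?thesis by (simp add: polys_def)
qed

lemma polys_diff [intro, simp]: "p \<in> polys N \<Longrightarrow> p' \<in> polys N \<Longrightarrow> p - p' \<in> polys N"
  using polys_add[of p N "- p'"] by simp

lemma polys_mult [intro, simp]: "p \<in> polys N \<Longrightarrow> p' \<in> polys N \<Longrightarrow> p * p' \<in> polys N"
  unfolding polys_def by (fastforce elim!: keys_mult_cases simp: keys_add')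

lemma polys_sum [intro, simp]: "(\<And>a. a \<in> A \<Longrightarrow> f a \<in> polys N) \<Longrightarrow> (\<Sum>a\<in>A. f a) \<in> polys N"
  by (induction A rule: infinite_finite_induct) auto

lemma polys_prod [intro, simp]: "(\<And>a. a \<in> A \<Longrightarrow> f a \<in> polys N) \<Longrightarrow> (\<Prod>a\<in>A. f a) \<in> polys N"
  by (induction A rule: infinite_finite_induct) auto

lemma polys_power [intro, simp]: "p \<in> polys N \<Longrightarrow> p ^ k \<in> polys N"
  by (induction k) auto

lemma polys_single: "keys m \<subseteq> {1..N} \<Longrightarrow> single m c \<in> polys N"
  by (auto simp: polys_def)

lemma polys_const [simp]: "mpoly_const c \<in> polys N"
  by (simp add: mpoly_const_def polys_single)

lemma polys_of_nat [simp]: "of_nat k \<in> polys N"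
  using polys_const[of "of_nat k"] by (simp add: mpoly_const_of_nat)

lemma polys_numeral [simp]: "numeral k \<in> polys N"
  using polys_of_nat[of "numeral k"] by simp

lemma polys_var [simp]: "i \<in> {1..N} \<Longrightarrow> mpoly_var i \<in> polys N"
  unfolding mpoly_var_def by (rule polys_single) auto

lemma polys_quad [simp]: "quad N \<in> polys N"
  by (auto simp: quad_def)

lemma order_ge_0 [simp]: "0 \<in> order_ge e"
  by (simp add: order_ge_def)

lemma order_ge_zero [simp]: "p \<in> order_ge 0"
  by (simp add: order_ge_def)

lemma order_ge_add [intro, simp]: "p \<in> order_ge e \<Longrightarrow> p' \<in> order_ge e \<Longrightarrow> p + p' \<in> order_ge e"
  using Poly_Mapping.keys_add[of p p'] by (fastforce simp: order_ge_def)

lemma order_ge_uminus [simp]: "- p \<in> order_ge e \<longleftrightarrow> p \<in> order_ge e"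
proof -
  have "keys (-p) = keys p" by (auto simp: in_keys_iff)
  then show ?thesis by (simp add: order_ge_def)
qed

lemma order_ge_diff [intro, simp]: "p \<in> order_ge e \<Longrightarrow> p' \<in> order_ge e \<Longrightarrow> p - p' \<in> order_ge e"
  using order_ge_add[of p e "- p'"] by simp

lemma order_ge_mult: "p \<in> order_ge e \<Longrightarrow> p' \<in> order_ge e' \<Longrightarrow> p * p' \<in> order_ge (e + e')"
  unfolding order_ge_def by (fastforce elim!: keys_mult_cases simp: mdeg_add intro: add_mono)

lemma order_ge_sum [intro, simp]: "(\<And>a. a \<in> A \<Longrightarrow> f a \<in> order_ge e) \<Longrightarrow> (\<Sum>a\<in>A. f a) \<in> order_ge e"
  by (induction A rule: infinite_finite_induct) auto

lemma order_ge_anti: "e' \<le> e \<Longrightarrow> p \<in> order_ge e \<Longrightarrow> p \<in> order_ge e'"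
  by (auto simp: order_ge_def)

lemma order_ge_mult_left [intro]: "p' \<in> order_ge e \<Longrightarrow> p * p' \<in> order_ge e"
  using order_ge_mult[of p 0 p' e] by simp

lemma order_ge_single: "e \<le> mdeg m \<Longrightarrow> single m c \<in> order_ge e"
  by (auto simp: order_ge_def)

lemma order_ge_var [simp]: "mpoly_var i \<in> order_ge (Suc 0)"
  unfolding mpoly_var_def by (rule order_ge_single) simp

lemma order_ge_Suc_0: "p \<in> order_ge (Suc 0) \<longleftrightarrow> lookup p 0 = 0"
  by (auto simp: order_ge_def Suc_le_eq in_keys_iff mdeg_eq_0 zero_less_iff_neq_zero)

lemma quad_order_ge: "quad N \<in> order_ge 2"
  unfolding quad_def power2_eq_square
  using order_ge_mult[OF order_ge_var order_ge_var] by (auto simp: numeral_2_eq_2)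

lemma homog_0 [simp]: "0 \<in> homog e"
  by (simp add: homog_def)

lemma homog_add [intro, simp]: "p \<in> homog e \<Longrightarrow> p' \<in> homog e \<Longrightarrow> p + p' \<in> homog e"
  using Poly_Mapping.keys_add[of p p'] by (fastforce simp: homog_def)

lemma homog_mult: "p \<in> homog e \<Longrightarrow> p' \<in> homog e' \<Longrightarrow> p * p' \<in> homog (e + e')"
  unfolding homog_def by (fastforce elim!: keys_mult_cases simp: mdeg_add)

lemma homog_sum [intro, simp]: "(\<And>a. a \<in> A \<Longrightarrow> f a \<in> homog e) \<Longrightarrow> (\<Sum>a\<in>A. f a) \<in> homog e"
  by (induction A rule: infinite_finite_induct) auto

lemma homog_const [simp]: "mpoly_const c \<in> homog 0"
  by (auto simp: homog_def mpoly_const_def)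

lemma homog_var [simp]: "mpoly_var i \<in> homog (Suc 0)"
  by (auto simp: homog_def mpoly_var_def)

lemma homog_quad: "quad N \<in> homog 2"
  unfolding quad_def power2_eq_square
  using homog_mult[OF homog_var homog_var] by (auto simp: numeral_2_eq_2)

lemma single_factor:
  assumes "i \<in> keys m"
  shows "single m c = mpoly_var i * single (m - single i 1) c"
    "mdeg m = Suc (mdeg (m - single i 1))" "keys (m - single i 1) \<subseteq> keys m"
proof -
  have *: "m = single i 1 + (m - single i 1)"
    using assms by (intro poly_mapping_eqI) (auto simp: lookup_add lookup_minus lookup_single when_def in_keys_iff)
  show "single m c = mpoly_var i * single (m - single i 1) c"
    by (subst *) (simp add: mpoly_var_def mult_single)
  show "mdeg m = Suc (mdeg (m - single i 1))"
    by (subst *) (simp add: mdeg_add)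
  show "keys (m - single i 1) \<subseteq> keys m"
    by (auto simp: in_keys_iff lookup_minus)
qed

section \<open>Derivations and Kelvin operators\<close>

text \<open>If x_i does not occur in m, truncated subtraction leaves \<open>m - single i 1\<close>
  equal to m, and the coefficient 0 removes the term.\<close>

definition pd :: "nat \<Rightarrow> 'k::comm_ring_1 mpoly \<Rightarrow> 'k mpoly" where
  "pd i = linext (\<lambda>m. single (m - single i 1) (of_nat (lookup m i)))"

lemma pd_single: "pd i (single m c) = single (m - single i 1) (c * of_nat (lookup m i))"
  by (simp add: pd_def linext_single const_mult_single)

lemma pd_add: "pd i (p + p') = pd i p + pd i p'"
  by (simp add: pd_def linext_add)

lemma pd_0 [simp]: "pd i 0 = 0"
  by (simp add: pd_def)

lemma pd_sum: "pd i (\<Sum>a\<in>A. f a) = (\<Sum>a\<in>A. pd i (f a))"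
  by (rule sum_of_additive) (rule pd_add)

lemma pd_mult: "pd i (p * p') = pd i p * p' + p * pd i p'"
proof (induction p rule: mpoly_induct)
  case (single m c)
  show ?case
  proof (induction p' rule: mpoly_induct)
    case (single m' c')
    \<comment> \<open>Truncated subtraction need not commute with adding m' when x_i is absent from
      m, but then the coefficient is 0.\<close>
    have 1: "single (m + m' - single i 1) (a * of_nat (lookup m i)) =
          single (m - single i 1 + m') (a * of_nat (lookup m i))" for a :: 'a
    proof (cases "lookup m i = 0")
      case False
      then have "m + m' - single i 1 = m - single i 1 + m'"
        by (intro poly_mapping_eqI) (auto simp: lookup_add lookup_minus lookup_single when_def)
      then show ?thesis by simp
    qed simp
    have 2: "single (m + m' - single i 1) (a * of_nat (lookup m' i)) =
          single (m + (m' - single i 1)) (a * of_nat (lookup m' i))" for a :: 'a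
    proof (cases "lookup m' i = 0")
      case False
      then have "m + m' - single i 1 = m + (m' - single i 1)"
        by (intro poly_mapping_eqI) (auto simp: lookup_add lookup_minus lookup_single when_def)
      then show ?thesis by simp
    qed simp
    have "pd i (single m c * single m' c') = single (m + m' - single i 1) (c * c' * of_nat (lookup m i))
       + single (m + m' - single i 1) (c * c' * of_nat (lookup m' i))"
      by (simp add: mult_single pd_single lookup_add distrib_left single_add[symmetric])
    then show ?case unfolding 1 2
      by (simp only: mult_single pd_single ac_simps)
  next
    case (add p p')
    then show ?case by (simp add: distrib_left pd_add)
  qed
next
  case (add p1 p2)
  then show ?case by (simp add: distrib_right pd_add)
qed

lemma pd_const [simp]: "pd i (mpoly_const c) = 0"
  by (simp add: mpoly_const_def pd_single)

lemma pd_const_mult: "pd i (mpoly_const c * p) = mpoly_const c * pd i p"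
  by (simp add: pd_mult)

lemma pd_of_nat [simp]: "pd i (of_nat k) = 0"
  using pd_const[of i "of_nat k"] by (simp add: mpoly_const_of_nat)

lemma pd_of_nat_mult: "pd i (of_nat k * p) = of_nat k * pd i p"
  by (simp add: pd_mult)

lemma pd_var: "pd i (mpoly_var j) = (if i = j then 1 else 0)"
  by (auto simp: mpoly_var_def pd_single lookup_single)

lemma polys_pd [simp, intro]: "p \<in> polys N \<Longrightarrow> pd i p \<in> polys N"
  unfolding pd_def linext_def
proof (intro polys_sum polys_mult polys_const polys_single)
  fix m assume "p \<in> polys N" "m \<in> keys p"
  then have "keys m \<subseteq> {1..N}" by (auto simp: polys_def)
  then show "keys (m - single i 1) \<subseteq> {1..N}" by (auto simp: in_keys_iff lookup_minus)
qed

lemma order_ge_pd: "p \<in> order_ge (Suc e) \<Longrightarrow> pd i p \<in> order_ge e"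
  unfolding pd_def linext_def
proof (intro order_ge_sum order_ge_mult_left)
  fix m assume "p \<in> order_ge (Suc e)" "m \<in> keys p"
  then have *: "Suc e \<le> mdeg m" by (auto simp: order_ge_def)
  show "single (m - single i 1) (of_nat (lookup m i)) \<in> (order_ge e :: 'a mpoly set)"
  proof (cases "i \<in> keys m")
    case True
    with single_factor(2)[OF True] * show ?thesis by (intro order_ge_single) simp
  next
    case False
    then show ?thesis by (simp add: in_keys_iff)
  qed
qed

definition euler :: "nat \<Rightarrow> 'k::comm_ring_1 mpoly \<Rightarrow> 'k mpoly" where
  "euler N p = (\<Sum>i=1..N. mpoly_var i * pd i p)"

definition laplacian :: "nat \<Rightarrow> 'k::comm_ring_1 mpoly \<Rightarrow> 'k mpoly" where
  "laplacian N p = (\<Sum>i=1..N. pd i (pd i p))"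

text \<open>Up to sign and scaling, the conjugate of multiplication by \<open>x\<^sub>j\<close> under the Kelvin transform.\<close>

definition kelvin :: "nat \<Rightarrow> nat \<Rightarrow> 'k::comm_ring_1 mpoly \<Rightarrow> 'k mpoly" where
  "kelvin N j p = mpoly_var j * laplacian N p - (2 * euler N (pd j p) + (of_nat N - 2) * pd j p)"

lemma euler_add: "euler N (p + p') = euler N p + euler N p'"
  by (simp add: euler_def pd_add distrib_left sum.distrib)

lemma euler_0 [simp]: "euler N 0 = 0" by (simp add: euler_def)

lemma euler_mult: "euler N (p * p') = euler N p * p' + p * euler N p'"
  by (simp add: euler_def pd_mult distrib_left sum.distrib sum_distrib_left sum_distrib_right mult_ac)

lemma euler_const [simp]: "euler N (mpoly_const c) = 0"
  by (simp add: euler_def)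

lemma euler_const_mult: "euler N (mpoly_const c * p) = mpoly_const c * euler N p"
  by (simp add: euler_mult)

lemma euler_of_nat_mult: "euler N (of_nat k * p) = of_nat k * euler N p"
  using euler_const_mult[of N "of_nat k"] by (simp add: mpoly_const_of_nat)

lemma euler_sum: "euler N (\<Sum>a\<in>A. f a) = (\<Sum>a\<in>A. euler N (f a))"
  by (rule sum_of_additive) (rule euler_add)

lemma euler_var: "i \<in> {1..N} \<Longrightarrow> euler N (mpoly_var i) = mpoly_var i"
  by (simp add: euler_def pd_var if_distrib[of "(*) _"] sum.delta cong: if_cong)

lemma pd_quad: "i \<in> {1..N} \<Longrightarrow> pd i (quad N) = 2 * mpoly_var i"
  by (simp add: quad_def pd_sum power2_eq_square pd_mult pd_var if_distrib[of "(*) _"]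
     if_distrib[of "\<lambda>x. x * _"] sum.distrib sum.delta cong: if_cong)

lemma euler_quad: "euler N (quad N) = 2 * quad N"
proof -
  have "euler N (quad N) = (\<Sum>i=1..N. mpoly_var i * (2 * mpoly_var i))"
    unfolding euler_def by (rule sum.cong) (simp_all only: pd_quad)
  also have "\<dots> = 2 * quad N"
    by (simp add: quad_def sum_distrib_left power2_eq_square mult_ac)
  finally show ?thesis .
qed

lemma euler_single: "keys m \<subseteq> {1..N} \<Longrightarrow> euler N (single m c) = of_nat (mdeg m) * single m c"
proof -
  assume m: "keys m \<subseteq> {1..N}"
  have "mpoly_var i * pd i (single m c) = of_nat (lookup m i) * single m c" for i
  proof (cases "i \<in> keys m")
    case True
    have "of_nat (lookup m i) * single m c = mpoly_var i * (mpoly_const (of_nat (lookup m i)) * single (m - single i 1) c)"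
      unfolding mpoly_const_of_nat by (subst single_factor(1)[OF True]) (simp add: mult_ac)
    then show ?thesis by (simp add: pd_single const_mult_single mult_ac)
  qed (simp add: pd_single in_keys_iff)
  then show ?thesis
    by (simp add: euler_def mdeg_bounded[OF m] sum_distrib_right)
qed

lemma euler_homog:
  assumes "p \<in> polys N" "p \<in> homog e"
  shows "euler N p = of_nat e * p"
proof -
  have "\<forall>m\<in>keys p. keys m \<subseteq> {1..N} \<and> mdeg m = e"
    using assms by (auto simp: polys_def homog_def)
  then show ?thesis
    by (induction rule: mpoly_induct_keys) (auto simp: euler_single euler_add distrib_left)
qed

text \<open>The form of degree e is multiplied by e, and all higher forms have order e + 1
  anyway.\<close>

lemma euler_order_ge:
  assumes "p \<in> polys N" "p \<in> order_ge e"
  shows "euler N p - of_nat e * p \<in> order_ge (Suc e)"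
proof -
  have "\<forall>m\<in>keys p. keys m \<subseteq> {1..N} \<and> e \<le> mdeg m"
    using assms by (auto simp: polys_def order_ge_def)
  then show ?thesis
  proof (induction rule: mpoly_induct_keys)
    case (single m c)
    show ?case
    proof (cases "mdeg m = e")
      case False
      then have "single m c \<in> order_ge (Suc e)" using single by (intro order_ge_single) auto
      then show ?thesis using single by (auto simp: euler_single)
    qed (use single in \<open>auto simp: euler_single\<close>)
  next
    case zero
    show ?case by simp
  next
    case (add p p')
    then show ?case using order_ge_add[OF add] by (simp add: euler_add algebra_simps)
  qed
qed

lemma polys_eu [simp, intro]: "p \<in> polys N \<Longrightarrow> euler N p \<in> polys N"
  by (auto simp: euler_def)

lemma polys_lap [simp, intro]: "p \<in> polys N \<Longrightarrow> laplacian N p \<in> polys N"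
  by (auto simp: laplacian_def)

lemma polys_kelvin [simp, intro]: "j \<in> {1..N} \<Longrightarrow> p \<in> polys N \<Longrightarrow> kelvin N j p \<in> polys N"
  unfolding kelvin_def by (intro polys_diff polys_mult polys_add polys_numeral polys_of_nat) auto

text \<open>The commutator of the Laplacian with q is 4 E + 2 N, one of the sl_2 relations between
  q, the Laplacian and E.\<close>

lemma laplacian_quad_mult: "laplacian N (quad N * g) = quad N * laplacian N g + 4 * euler N g + 2 * of_nat N * g"
proof -
  have "laplacian N (quad N * g) = (\<Sum>i=1..N. quad N * pd i (pd i g) + 4 * (mpoly_var i * pd i g) + 2 * g)"
    unfolding laplacian_def
  proof (rule sum.cong)
    fix i assume i: "i \<in> {1..N}"
    have "pd i (2 * mpoly_var i :: 'a mpoly) = 2"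
      using pd_of_nat_mult[of i 2 "mpoly_var i"] by (simp add: pd_var)
    then show "pd i (pd i (quad N * g)) = quad N * pd i (pd i g) + 4 * (mpoly_var i * pd i g) + 2 * g"
      by (simp add: pd_mult pd_add pd_quad[OF i] algebra_simps)
  qed simp
  then show ?thesis
    by (simp add: sum.distrib laplacian_def euler_def sum_distrib_left mult_ac)
qed

text \<open>The terms in x_j g and x_j E g, which are not multiples of q, cancel. This cancellation
  is what fixes the constant N - 2 in \<open>kelvin\<close>.\<close>

lemma kelvin_quad_mult:
  assumes "j \<in> {1..N}"
  shows "kelvin N j (quad N * g) = quad N * (kelvin N j g - 4 * pd j g)"
proof -
  have "euler N (2 * mpoly_var j * g) = 2 * mpoly_var j * g + 2 * mpoly_var j * euler N g"
    using euler_of_nat_mult[of N 2 "mpoly_var j * g"] by (simp add: euler_mult euler_var[OF assms] algebra_simps)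
  then have euler: "euler N (pd j (quad N * g)) =
      2 * mpoly_var j * g + 2 * mpoly_var j * euler N g + (2 * quad N * pd j g + quad N * euler N (pd j g))"
    by (simp add: pd_mult pd_quad[OF assms] euler_add euler_mult[of N "quad N"] euler_quad)
  show ?thesis
    unfolding kelvin_def euler laplacian_quad_mult
    by (simp add: pd_mult pd_quad[OF assms] algebra_simps)
qed

lemma sum_var_kelvin:
  "(\<Sum>i=1..N. mpoly_var i * kelvin N i p) =
     quad N * laplacian N p - (2 * euler N (euler N p) + (of_nat N - 4) * euler N p)"
proof -
  \<comment> \<open>Moving x_i inside E subtracts x_i times the i-th derivative, doubled by the
    factor 2; this turns N - 2 into N - 4.\<close>
  have *: "mpoly_var i * kelvin N i p =
      mpoly_var i ^ 2 * laplacian N p - (2 * euler N (mpoly_var i * pd i p) + (of_nat N - 4) * (mpoly_var i * pd i p))"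
    if i: "i \<in> {1..N}" for i
    by (simp add: kelvin_def euler_mult euler_var[OF i] power2_eq_square algebra_simps)
  have "(\<Sum>i=1..N. mpoly_var i * kelvin N i p) = (\<Sum>i=1..N. mpoly_var i ^ 2 * laplacian N p
        - (2 * euler N (mpoly_var i * pd i p) + (of_nat N - 4) * (mpoly_var i * pd i p)))"
    using * by (intro sum.cong) auto
  also have "\<dots> = quad N * laplacian N p - (2 * euler N (euler N p) + (of_nat N - 4) * euler N p)"
    unfolding euler_def[of N p] quad_def
    by (simp add: sum_subtractf sum.distrib sum_distrib_left sum_distrib_right euler_sum)
  finally show ?thesis .
qed

lemma kelvin_add: "kelvin N j (p + p') = kelvin N j p + kelvin N j p'"
  by (simp add: kelvin_def laplacian_def pd_add sum.distrib euler_add algebra_simps)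

lemma order_ge_kelvin:
  assumes p: "p \<in> order_ge (Suc e)"
  shows "kelvin N j p \<in> order_ge e"
proof -
  have pdp: "pd i p \<in> order_ge e" for i using p by (rule order_ge_pd)
  have a: "mpoly_var j * laplacian N p \<in> order_ge e"
  proof (cases e)
    case (Suc e')
    have "laplacian N p \<in> order_ge e'" unfolding laplacian_def
      using pdp by (intro order_ge_sum, rule_tac order_ge_pd) (simp add: Suc)
    then show ?thesis using order_ge_mult[OF order_ge_var] Suc by fastforce
  qed simp
  have b: "euler N (pd j p) \<in> order_ge e"
  proof (cases e)
    case (Suc e')
    have "mpoly_var i * pd i (pd j p) \<in> order_ge e" for i
      using order_ge_mult[OF order_ge_var order_ge_pd, of "pd j p" e' i i] pdp[of j] Suc by simp
    then show ?thesis unfolding euler_def by auto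
  qed simp
  show ?thesis unfolding kelvin_def
    by (intro order_ge_diff order_ge_add order_ge_mult_left a b pdp)
qed

section \<open>Differential operators modulo an ideal\<close>

text \<open>Ideals of \<open>polys N\<close> as plain sets, so that type class arithmetic applies.
  Additive inverses come from multiplication by -1.\<close>

locale poly_ideal =
  fixes N :: nat and I :: "'k::field_char_0 mpoly set"
  assumes subset: "I \<subseteq> polys N"
    and zero [simp]: "0 \<in> I"
    and add [intro, simp]: "p \<in> I \<Longrightarrow> p' \<in> I \<Longrightarrow> p + p' \<in> I"
    and mult [intro, simp]: "r \<in> polys N \<Longrightarrow> p \<in> I \<Longrightarrow> r * p \<in> I"
begin

lemma mult_right [intro, simp]: "p \<in> I \<Longrightarrow> r \<in> polys N \<Longrightarrow> p * r \<in> I"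
  using mult[of r p] by (simp add: mult.commute)

lemma uminus [simp, intro]: "p \<in> I \<Longrightarrow> - p \<in> I"
  using mult[of "- 1" p] by simp

lemma diff [simp, intro]: "p \<in> I \<Longrightarrow> p' \<in> I \<Longrightarrow> p - p' \<in> I"
  using add[of p "- p'"] by simp

lemma sum [intro, simp]: "(\<And>a. a \<in> A \<Longrightarrow> f a \<in> I) \<Longrightarrow> (\<Sum>a\<in>A. f a) \<in> I"
  by (induction A rule: infinite_finite_induct) auto

lemma add_cancel: "p \<in> I \<Longrightarrow> p + p' \<in> I \<longleftrightarrow> p' \<in> I"
  using diff[of "p + p'" p] by auto

lemma diff_trans: "p - p' \<in> I \<Longrightarrow> p' - p'' \<in> I \<Longrightarrow> p - p'' \<in> I"
  using add[of "p - p'" "p' - p''"] by simp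

lemma diff_sym: "p - p' \<in> I \<Longrightarrow> p' - p \<in> I"
  using uminus[of "p - p'"] by simp

lemma diff_mem: "p - p' \<in> I \<Longrightarrow> p' \<in> I \<Longrightarrow> p \<in> I"
  using add[of "p - p'" p'] by simp

lemma cancel_nat:
  assumes "of_nat k * p \<in> I" "k > 0"
  shows "p \<in> I"
proof -
  have "mpoly_const (1 / of_nat k) * (of_nat k * p) \<in> I"
    using assms(1) by (rule mult[OF polys_const])
  also have "mpoly_const (1 / of_nat k) * (of_nat k * p) = p"
    using assms(2) by (simp add: mpoly_const_of_nat[symmetric] mpoly_const_mult[symmetric] mult.assoc[symmetric])
  finally show ?thesis .
qed

end

text \<open>Operators on the quotient by \<open>I\<close> are represented by functions on polynomials that are linear
  only modulo \<open>I\<close>.  The index of \<open>dop\<close> exceeds the order by one, so that index 0 means zero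
  modulo \<open>I\<close>.\<close>

definition linear_mod :: "nat \<Rightarrow> 'k::field_char_0 mpoly set \<Rightarrow> ('k mpoly \<Rightarrow> 'k mpoly) \<Rightarrow> bool" where
  "linear_mod N I D \<longleftrightarrow> (\<forall>p\<in>polys N. D p \<in> polys N) \<and>
     (\<forall>p\<in>polys N. \<forall>p'\<in>polys N. D (p + p') - (D p + D p') \<in> I) \<and>
     (\<forall>c. \<forall>p\<in>polys N. D (mpoly_const c * p) - mpoly_const c * D p \<in> I) \<and>
     (\<forall>p\<in>I. D p \<in> I)"

primrec dop :: "nat \<Rightarrow> 'k::field_char_0 mpoly set \<Rightarrow> nat \<Rightarrow> ('k mpoly \<Rightarrow> 'k mpoly) \<Rightarrow> bool" where
  "dop N I 0 D \<longleftrightarrow> linear_mod N I D \<and> (\<forall>p\<in>polys N. D p \<in> I)"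
| "dop N I (Suc n) D \<longleftrightarrow> linear_mod N I D \<and> (\<forall>r\<in>polys N. dop N I n (\<lambda>x. D (r * x) - r * D x))"

lemma dop_linear_mod: "dop N I n D \<Longrightarrow> linear_mod N I D"
  by (cases n) auto

lemma linear_mod_polys: "linear_mod N I D \<Longrightarrow> p \<in> polys N \<Longrightarrow> D p \<in> polys N"
  by (auto simp: linear_mod_def)

lemma linear_mod_addD:
    "linear_mod N I D \<Longrightarrow> p \<in> polys N \<Longrightarrow> p' \<in> polys N \<Longrightarrow> D (p + p') - (D p + D p') \<in> I"
  and linear_mod_constD:
    "linear_mod N I D \<Longrightarrow> p \<in> polys N \<Longrightarrow> D (mpoly_const c * p) - mpoly_const c * D p \<in> I"
  and linear_mod_idealD: "linear_mod N I D \<Longrightarrow> p \<in> I \<Longrightarrow> D p \<in> I"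
  by (simp_all add: linear_mod_def)

context poly_ideal
begin

lemma linear_mod_cong:
  assumes D: "linear_mod N I D" and D': "\<And>p. p \<in> polys N \<Longrightarrow> D' p \<in> polys N"
    and eq: "\<And>p. p \<in> polys N \<Longrightarrow> D' p - D p \<in> I"
  shows "linear_mod N I D'"
  unfolding linear_mod_def
proof (intro conjI ballI allI)
  fix p p' :: "'k mpoly" assume p: "p \<in> polys N" "p' \<in> polys N"
  from diff[OF add[OF eq[OF polys_add[OF p]] linear_mod_addD[OF D p]] add[OF eq[OF p(1)] eq[OF p(2)]]]
  show "D' (p + p') - (D' p + D' p') \<in> I" by (simp add: algebra_simps)
next
  fix c and p :: "'k mpoly" assume p: "p \<in> polys N"
  from diff[OF add[OF eq[OF polys_mult[OF polys_const[of c N] p]] linear_mod_constD[OF D p, of c]] mult[OF polys_const[of c N] eq[OF p]]]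
  show "D' (mpoly_const c * p) - mpoly_const c * D' p \<in> I" by (simp add: algebra_simps)
next
  fix p :: "'k mpoly" assume p: "p \<in> I"
  then have "D' p - D p \<in> I" "D p \<in> I" using eq subset linear_mod_idealD[OF D] by blast+
  then show "D' p \<in> I" by (rule diff_mem)
qed (rule D')

text \<open>Functions representing the same operator agree only modulo the ideal. This makes
  congruences usable where \<open>dop_comp\<close> and \<open>dop_contract_step\<close> rewrite an
  operator.\<close>

lemma dop_cong:
  assumes "dop N I n D" and "\<And>p. p \<in> polys N \<Longrightarrow> D' p \<in> polys N"
    and "\<And>p. p \<in> polys N \<Longrightarrow> D' p - D p \<in> I"
  shows "dop N I n D'"
  using assms
proof (induction n arbitrary: D D')
  case 0
  have "linear_mod N I D'" by (rule linear_mod_cong[OF _ 0(2,3)]) (use 0 in auto)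
  moreover have "D' p \<in> I" if "p \<in> polys N" for p
    by (rule diff_mem[OF 0(3)]) (use 0 that in auto)
  ultimately show ?case by simp
next
  case (Suc n)
  have c: "linear_mod N I D'" by (rule linear_mod_cong[OF _ Suc.prems(2,3)]) (use Suc.prems(1) in auto)
  moreover have "dop N I n (\<lambda>x. D' (r * x) - r * D' x)" if r: "r \<in> polys N" for r
  proof (rule Suc.IH)
    show "dop N I n (\<lambda>x. D (r * x) - r * D x)" using Suc.prems r by auto
    fix p :: "'k mpoly" assume p: "p \<in> polys N"
    show "D' (r * p) - r * D' p \<in> polys N" using Suc.prems r p by auto
    have "(D' (r * p) - D (r * p)) - r * (D' p - D p) \<in> I"
      using Suc.prems r p by auto
    then show "D' (r * p) - r * D' p - (D (r * p) - r * D p) \<in> I" by (simp add: algebra_simps)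
  qed
  ultimately show ?case by simp
qed

lemma linear_mod_add:
  assumes "linear_mod N I D" "linear_mod N I D'"
  shows "linear_mod N I (\<lambda>x. D x + D' x)"
  unfolding linear_mod_def
proof (intro conjI ballI allI)
  fix p p' :: "'k mpoly" assume p: "p \<in> polys N" "p' \<in> polys N"
  have "(D (p + p') - (D p + D p')) + (D' (p + p') - (D' p + D' p')) \<in> I"
    using assms p by (intro add) (auto simp: linear_mod_def)
  then show "D (p + p') + D' (p + p') - (D p + D' p + (D p' + D' p')) \<in> I" by (simp add: algebra_simps)
next
  fix c and p :: "'k mpoly" assume p: "p \<in> polys N"
  have "(D (mpoly_const c * p) - mpoly_const c * D p) + (D' (mpoly_const c * p) - mpoly_const c * D' p) \<in> I"
    using assms p by (intro add) (auto simp: linear_mod_def)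
  then show "D (mpoly_const c * p) + D' (mpoly_const c * p) - mpoly_const c * (D p + D' p) \<in> I"
    by (simp add: algebra_simps)
qed (use assms in \<open>auto simp: linear_mod_def\<close>)

lemma linear_mod_mult:
  assumes "linear_mod N I D" and r: "r \<in> polys N"
  shows "linear_mod N I (\<lambda>x. r * D x)"
  unfolding linear_mod_def
proof (intro conjI ballI allI)
  fix p p' :: "'k mpoly" assume p: "p \<in> polys N" "p' \<in> polys N"
  have "r * (D (p + p') - (D p + D p')) \<in> I"
    using assms p by (intro mult) (auto simp: linear_mod_def)
  then show "r * D (p + p') - (r * D p + r * D p') \<in> I" by (simp add: algebra_simps)
next
  fix c and p :: "'k mpoly" assume p: "p \<in> polys N"
  have "r * (D (mpoly_const c * p) - mpoly_const c * D p) \<in> I"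
    using assms p by (intro mult) (auto simp: linear_mod_def)
  then show "r * D (mpoly_const c * p) - mpoly_const c * (r * D p) \<in> I"
    by (simp add: algebra_simps)
qed (use assms in \<open>auto simp: linear_mod_def\<close>)

lemma linear_mod_comp:
  assumes D: "linear_mod N I D" and D': "linear_mod N I D'"
  shows "linear_mod N I (\<lambda>x. D (D' x))"
proof -
  have cong: "D a - D b \<in> I" if "a \<in> polys N" "b \<in> polys N" "a - b \<in> I" for a b
  proof -
    have "D (b + (a - b)) - (D b + D (a - b)) \<in> I" and "D (a - b) \<in> I"
      using D that polys_diff[OF that(1,2)] unfolding linear_mod_def by blast+
    from add[OF this] show ?thesis by (simp add: algebra_simps)
  qed
  show ?thesis unfolding linear_mod_def
  proof (intro conjI ballI allI)
    fix p p' :: "'k mpoly" assume p: "p \<in> polys N" "p' \<in> polys N"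
    have "D (D' (p + p')) - D (D' p + D' p') \<in> I"
      using p D' by (intro cong) (auto simp: linear_mod_def)
    moreover have "D (D' p + D' p') - (D (D' p) + D (D' p')) \<in> I"
      using p D D' by (auto simp: linear_mod_def)
    ultimately show "D (D' (p + p')) - (D (D' p) + D (D' p')) \<in> I" by (rule diff_trans)
  next
    fix c and p :: "'k mpoly" assume p: "p \<in> polys N"
    have "D (D' (mpoly_const c * p)) - D (mpoly_const c * D' p) \<in> I"
      using p D' by (intro cong) (auto simp: linear_mod_def)
    moreover have "D (mpoly_const c * D' p) - mpoly_const c * D (D' p) \<in> I"
      using p D D' by (auto simp: linear_mod_def)
    ultimately show "D (D' (mpoly_const c * p)) - mpoly_const c * D (D' p) \<in> I" by (rule diff_trans)
  qed (use D D' in \<open>auto simp: linear_mod_def\<close>)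
qed

lemma linear_mod_scale: "r \<in> polys N \<Longrightarrow> linear_mod N I (\<lambda>x. r * x)"
  by (auto simp: linear_mod_def algebra_simps)

lemma linear_mod_comm:
  assumes "linear_mod N I D" "r \<in> polys N"
  shows "linear_mod N I (\<lambda>x. D (r * x) - r * D x)"
  using linear_mod_add[OF linear_mod_comp[OF assms(1) linear_mod_scale[OF assms(2)]]
      linear_mod_mult[OF assms(1), of "- r"]] assms(2) by simp

lemma dop_add:
  "dop N I n D \<Longrightarrow> dop N I n D' \<Longrightarrow> dop N I n (\<lambda>x. D x + D' x)"
proof (induction n arbitrary: D D')
  case (Suc n)
  have "dop N I n (\<lambda>x. D (r * x) + D' (r * x) - r * (D x + D' x))" if "r \<in> polys N" for r
  proof -
    have "dop N I n (\<lambda>x. (D (r * x) - r * D x) + (D' (r * x) - r * D' x))"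
      using Suc.prems that by (intro Suc.IH) auto
    then show ?thesis by (simp add: distrib_left diff_add_eq add_diff_eq diff_diff_eq2 diff_diff_eq add_ac)
  qed
  with Suc.prems show ?case by (simp add: linear_mod_add)
qed (auto simp: linear_mod_add)

lemma dop_mult: "dop N I n D \<Longrightarrow> s \<in> polys N \<Longrightarrow> dop N I n (\<lambda>x. s * D x)"
proof (induction n arbitrary: D)
  case (Suc n)
  have "dop N I n (\<lambda>x. s * D (r * x) - r * (s * D x))" if "r \<in> polys N" for r
  proof -
    have "dop N I n (\<lambda>x. s * (D (r * x) - r * D x))"
      using Suc.prems that by (intro Suc.IH) auto
    then show ?thesis by (simp add: right_diff_distrib mult.left_commute)
  qed
  with Suc.prems show ?case by (simp add: linear_mod_mult)
qed (auto simp: linear_mod_mult)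

lemma dop_diff: "dop N I n D \<Longrightarrow> dop N I n D' \<Longrightarrow> dop N I n (\<lambda>x. D x - D' x)"
  using dop_add[of n D "\<lambda>x. - 1 * D' x"] dop_mult[of n D' "- 1"] by simp

lemma dop_null: "linear_mod N I D \<Longrightarrow> (\<And>p. p \<in> polys N \<Longrightarrow> D p \<in> I) \<Longrightarrow> dop N I n D"
proof (induction n arbitrary: D)
  case (Suc n)
  have "dop N I n (\<lambda>x. D (r * x) - r * D x)" if "r \<in> polys N" for r
    using Suc.prems that by (intro Suc.IH linear_mod_comm) auto
  with Suc.prems show ?case by simp
qed auto

lemma dop_zero: "dop N I n (\<lambda>_. 0)"
  by (rule dop_null) (auto simp: linear_mod_def)

lemma dop_sum: "(\<And>a. a \<in> A \<Longrightarrow> dop N I n (f a)) \<Longrightarrow> dop N I n (\<lambda>x. \<Sum>a\<in>A. f a x)"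
  by (induction A rule: infinite_finite_induct) (auto simp: dop_zero dop_add)

lemma dop_Suc: "dop N I n D \<Longrightarrow> dop N I (Suc n) D"
proof (induction n arbitrary: D)
  case 0
  then show ?case using dop_null[of D "Suc 0"] by auto
next
  case (Suc n)
  then have "dop N I (Suc n) (\<lambda>x. D (r * x) - r * D x)" if "r \<in> polys N" for r
    using that by (intro Suc.IH) auto
  with Suc.prems show ?case by (subst dop.simps) (auto dest: dop_linear_mod)
qed

lemma dop_mono: "n \<le> n' \<Longrightarrow> dop N I n D \<Longrightarrow> dop N I n' D"
  by (induction n' rule: dec_induct) (auto intro: dop_Suc simp del: dop.simps)

lemma dop_scale: "s \<in> polys N \<Longrightarrow> dop N I (Suc 0) (\<lambda>x. s * x)"
proof -
  assume s: "s \<in> polys N"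
  have "dop N I 0 (\<lambda>x. s * (r * x) - r * (s * x))" if "r \<in> polys N" for r
    using dop_zero[of 0] by (simp add: mult.left_commute)
  with s show ?thesis by (simp add: linear_mod_scale)
qed

text \<open>By the Leibniz rule, [D D', r] = D [D', r] + [D, r] D'. With indices one above the
  orders, additivity of orders reads n + m - 1. If an index is 0, the composite is zero modulo the
  ideal, which suits any index.\<close>

lemma dop_comp: "dop N I n D \<Longrightarrow> dop N I m D' \<Longrightarrow> dop N I (n + m - 1) (\<lambda>x. D (D' x))"
proof (induction "n + m" arbitrary: n m D D' rule: less_induct)
  case less
  have c: "linear_mod N I (\<lambda>x. D (D' x))" using less.prems by (auto intro: linear_mod_comp dop_linear_mod)
  show ?case
  proof (cases "n = 0 \<or> m = 0")
    case True
    show ?thesis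
    proof (rule dop_null[OF c])
      fix p :: "'k mpoly" assume "p \<in> polys N"
      with True less.prems dop_linear_mod[OF less.prems(1)] dop_linear_mod[OF less.prems(2)]
      show "D (D' p) \<in> I" by (auto simp: linear_mod_def)
    qed
  next
    case False
    then obtain n' m' where nm: "n = Suc n'" "m = Suc m'" by (metis not0_implies_Suc)
    have "dop N I (n' + m') (\<lambda>x. D (D' (r * x)) - r * D (D' x))" if r: "r \<in> polys N" for r
    proof -
      have "dop N I (n + m' - 1) (\<lambda>x. D (D' (r * x) - r * D' x))"
        using less.prems r nm by (intro less.hyps) auto
      moreover have "dop N I (n' + m - 1) (\<lambda>x. D (r * D' x) - r * D (D' x))"
        using less.prems r nm less.hyps[of n' m "\<lambda>x. D (r * x) - r * D x" D'] by auto
      ultimately have *: "dop N I (n' + m') (\<lambda>x. D (D' (r * x) - r * D' x) + (D (r * D' x) - r * D (D' x)))"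
        using nm by (simp add: dop_add)
      show ?thesis
      proof (rule dop_cong[OF *])
        fix p :: "'k mpoly" assume p: "p \<in> polys N"
        have D: "D' p \<in> polys N" if "p \<in> polys N" for p using less.prems(2) that
          by (auto dest!: dop_linear_mod simp: linear_mod_def)
        have D2: "D p \<in> polys N" if "p \<in> polys N" for p using less.prems(1) that
          by (auto dest!: dop_linear_mod simp: linear_mod_def)
        show "D (D' (r * p)) - r * D (D' p) \<in> polys N" using D D2 p r by auto
        \<comment> \<open>D is additive only modulo the ideal, so the Leibniz rule is a congruence
          rather than an equation.\<close>
        have "D ((D' (r * p) - r * D' p) + r * D' p) - (D (D' (r * p) - r * D' p) + D (r * D' p)) \<in> I"
          using dop_linear_mod[OF less.prems(1)] D p r unfolding linear_mod_def by (metis polys_diff polys_mult)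
        then show "D (D' (r * p)) - r * D (D' p) -
            (D (D' (r * p) - r * D' p) + (D (r * D' p) - r * D (D' p))) \<in> I"
          by (simp add: algebra_simps)
      qed
    qed
    with c nm show ?thesis by simp
  qed
qed

end

section \<open>Operators on polynomials that descend to the quadric\<close>

lemma poly_ideal_null: "poly_ideal N {0}"
  by unfold_locales auto

lemma (in poly_ideal) linear_mod_change:
  assumes "linear_mod N {0} D" "\<And>p. p \<in> I \<Longrightarrow> D p \<in> I"
  shows "linear_mod N I D"
  using assms by (auto simp: linear_mod_def)

text \<open>Commutators with polynomials again preserve the ideal, so the bound on the order passes
  to the quotient.\<close>

lemma (in poly_ideal) dop_change:
  "dop N {0} n D \<Longrightarrow> (\<And>p. p \<in> I \<Longrightarrow> D p \<in> I) \<Longrightarrow> dop N I n D"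
proof (induction n arbitrary: D)
  case 0
  then show ?case by (auto intro: linear_mod_change)
next
  case (Suc n)
  have "dop N I n (\<lambda>x. D (r * x) - r * D x)" if "r \<in> polys N" for r
    using Suc.prems that by (intro Suc.IH) auto
  with Suc.prems show ?case by (auto intro: linear_mod_change)
qed

interpretation null: poly_ideal N "{0}" for N by (rule poly_ideal_null)

lemma dop_pd: "dop N {0} (Suc (Suc 0)) (pd i)"
proof -
  have "dop N {0} (Suc 0) (\<lambda>x. pd i (r * x) - r * pd i x)" if "r \<in> polys N" for r :: "'a mpoly"
    using null.dop_scale[of "pd i r" N] that by (simp add: pd_mult)
  moreover have "linear_mod N {0} (pd i :: 'a mpoly \<Rightarrow> _)"
    by (auto simp: linear_mod_def pd_add pd_const_mult)
  ultimately show ?thesis by (subst dop.simps) blast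
qed

lemma dop_kelvin_null: "j \<in> {1..N} \<Longrightarrow> dop N {0} 3 (kelvin N j :: 'k::field_char_0 mpoly \<Rightarrow> _)"
proof -
  assume j: "j \<in> {1..N}"
  have pp: "dop N {0} 3 (\<lambda>x. pd i (pd k x) :: 'k mpoly)" for i k
    using null.dop_comp[OF dop_pd[of N i] dop_pd[of N k]] by (simp add: numeral_3_eq_3 del: dop.simps)
  have p: "dop N {0} 3 (pd i :: 'k mpoly \<Rightarrow> _)" for i
    using null.dop_mono[OF _ dop_pd, of 3 N i] by simp
  have N: "of_nat N - 2 \<in> (polys N :: 'k mpoly set)" by (intro polys_diff) auto
  show ?thesis
    unfolding kelvin_def laplacian_def euler_def
    by (intro null.dop_diff null.dop_add null.dop_mult null.dop_sum pp p polys_var j N) auto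
qed

definition qid :: "nat \<Rightarrow> 'k::field_char_0 mpoly set" where
  "qid N = {h * quad N | h. h \<in> polys N}"

interpretation q: poly_ideal N "qid N" for N
proof
  show "qid N \<subseteq> polys N" by (auto simp: qid_def)
  show "0 \<in> (qid N :: 'a mpoly set)" unfolding qid_def by (intro CollectI exI[of _ 0]) auto
  show "p + p' \<in> qid N" if pp: "p \<in> qid N" "p' \<in> qid N" for p p' :: "'a mpoly"
  proof -
    from pp obtain h h' where "p = h * quad N" "p' = h' * quad N" "h \<in> polys N" "h' \<in> polys N"
      by (auto simp: qid_def)
    then show ?thesis unfolding qid_def by (intro CollectI exI[of _ "h + h'"]) (auto simp: distrib_right)
  qed
  show "r * p \<in> qid N" if pp: "r \<in> polys N" "p \<in> qid N" for r p :: "'a mpoly"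
  proof -
    from pp obtain h where "p = h * quad N" "h \<in> polys N" by (auto simp: qid_def)
    with pp show ?thesis unfolding qid_def by (intro CollectI exI[of _ "r * h"]) (auto simp: mult.assoc)
  qed
qed

lemma quad_mult_qid [simp, intro]: "h \<in> polys N \<Longrightarrow> quad N * h \<in> qid N"
  unfolding qid_def by (auto simp: mult.commute)

lemma kelvin_qid: "j \<in> {1..N} \<Longrightarrow> p \<in> qid N \<Longrightarrow> kelvin N j p \<in> qid N"
  unfolding qid_def[of N]
  by (clarify, subst mult.commute, subst kelvin_quad_mult)
     (auto simp: mult.commute intro!: exI polys_diff polys_mult)

lemma dop_kelvin: "j \<in> {1..N} \<Longrightarrow> dop N (qid N) 3 (kelvin N j)"
  by (intro q.dop_change dop_kelvin_null kelvin_qid)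

text \<open>The preimage in \<open>polys N\<close> of the e-th power of the homogeneous maximal
  ideal of R.\<close>

definition filt :: "nat \<Rightarrow> nat \<Rightarrow> 'k::field_char_0 mpoly set" where
  "filt N e = {p \<in> polys N. \<exists>u \<in> order_ge e. p - u \<in> qid N}"

interpretation f: poly_ideal N "filt N e" for N e
proof
  show "filt N e \<subseteq> polys N" by (auto simp: filt_def)
  show "0 \<in> (filt N e :: 'a mpoly set)" unfolding filt_def by (auto intro!: bexI[of _ 0])
  show "p + p' \<in> filt N e" if pp: "p \<in> filt N e" "p' \<in> filt N e" for p p' :: "'a mpoly"
  proof -
    from pp obtain u u' where u: "u \<in> order_ge e" "u' \<in> order_ge e" and "p - u \<in> qid N" "p' - u' \<in> qid N"
      by (auto simp: filt_def)
    then have "(p - u) + (p' - u') \<in> qid N" by blast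
    then have "p + p' - (u + u') \<in> qid N" by (simp add: algebra_simps)
    then show ?thesis using pp u unfolding filt_def by blast
  qed
  show "r * p \<in> filt N e" if pp: "r \<in> polys N" "p \<in> filt N e" for r p :: "'a mpoly"
  proof -
    from pp obtain u where u: "u \<in> order_ge e" and "p - u \<in> qid N"
      by (auto simp: filt_def)
    then have "r * (p - u) \<in> qid N" using pp by blast
    then have "r * p - r * u \<in> qid N" by (simp add: algebra_simps)
    then show ?thesis using pp u unfolding filt_def by blast
  qed
qed

lemma order_ge_filt [intro]: "p \<in> polys N \<Longrightarrow> p \<in> order_ge e \<Longrightarrow> p \<in> filt N e"
  unfolding filt_def by (auto intro!: bexI[of _ p])

lemma qid_filt [intro]: "p \<in> qid N \<Longrightarrow> p \<in> filt N e"
  unfolding filt_def using q.subset by (auto intro!: bexI[of _ 0])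

lemma filtE:
  assumes "p \<in> filt N e"
  obtains u where "u \<in> order_ge e" "u \<in> polys N" "p - u \<in> qid N"
proof -
  from assms obtain u where u: "u \<in> order_ge e" "p - u \<in> qid N" and p: "p \<in> polys N" by (auto simp: filt_def)
  have "u = p - (p - u)" by simp
  then have "u \<in> polys N" using u(2) p q.subset by (metis polys_diff subsetD)
  with u that show ?thesis by blast
qed

lemma filt_0: "filt N 0 = polys N"
  using order_ge_filt[of _ N 0] f.subset by auto

lemma kelvin_filt:
  assumes "j \<in> {1..N}" "p \<in> filt N (Suc e)"
  shows "kelvin N j p \<in> filt N e"
proof -
  from assms(2) obtain u where u: "u \<in> order_ge (Suc e)" "u \<in> polys N" "p - u \<in> qid N" by (rule filtE)
  have "kelvin N j (p - u) + kelvin N j u \<in> filt N e"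
    using u assms(1) kelvin_qid[OF assms(1) u(3)] order_ge_kelvin[OF u(1)]
    by (intro f.add) auto
  then show ?thesis by (simp add: kelvin_add[symmetric])
qed

lemma euler_order_ge': "p \<in> polys N \<Longrightarrow> p \<in> order_ge e \<Longrightarrow> euler N p \<in> order_ge e"
  using order_ge_add[OF order_ge_anti[OF _ euler_order_ge] order_ge_mult_left, of e e p N p "of_nat e"] by simp

text \<open>By \<open>sum_var_kelvin\<close>, the lowest form \<open>f\<close> of \<open>p\<close>, of degree \<open>e + 1\<close>, satisfies
  \<open>\<Sum> x\<^sub>i K\<^sub>i f \<equiv> - (e + 1) (2 e + N - 2) f\<close>.\<close>

lemma kelvin_detects:
  assumes N: "N \<ge> 3" and p: "p \<in> filt N (Suc e)"
    and k: "\<And>i. i \<in> {1..N} \<Longrightarrow> kelvin N i p \<in> filt N (Suc e)"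
  shows "p \<in> filt N (Suc (Suc e))"
proof -
  from p obtain u where u: "u \<in> order_ge (Suc e)" "u \<in> polys N" "p - u \<in> qid N" by (rule filtE)
  let ?F = "filt N (Suc (Suc e))"
  have xF: "mpoly_var i * g \<in> ?F" if "g \<in> filt N (Suc e)" "i \<in> {1..N}" for g i
  proof -
    from that(1) obtain v where v: "v \<in> order_ge (Suc e)" "v \<in> polys N" "g - v \<in> qid N" by (rule filtE)
    have "mpoly_var i * v + mpoly_var i * (g - v) \<in> ?F"
      using v that order_ge_mult[OF order_ge_var v(1), of i]
      by (intro f.add order_ge_filt qid_filt q.mult polys_mult polys_var) (simp_all del: One_nat_def)
    then show ?thesis by (simp add: algebra_simps)
  qed
  have ku: "kelvin N i u \<in> filt N (Suc e)" if i: "i \<in> {1..N}" for i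
  proof -
    have "kelvin N i p - kelvin N i (p - u) \<in> filt N (Suc e)"
      using k[OF i] kelvin_qid[OF i u(3)] by blast
    moreover have "kelvin N i p - kelvin N i (p - u) = kelvin N i u"
      using kelvin_add[of N i "p - u" u] by (simp add: algebra_simps)
    ultimately show ?thesis by simp
  qed
  have "(\<Sum>i=1..N. mpoly_var i * kelvin N i u) \<in> ?F"
    using ku xF by blast
  moreover have "quad N * laplacian N u \<in> ?F" using u by blast
  ultimately have "quad N * laplacian N u - (\<Sum>i=1..N. mpoly_var i * kelvin N i u) \<in> ?F" by blast
  then have A: "2 * euler N (euler N u) + (of_nat N - 4) * euler N u \<in> ?F"
    unfolding sum_var_kelvin by simp
  \<comment> \<open>\<open>u\<close> need not be a form, so E multiplies it by e + 1 only up to this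
    error of order e + 2.\<close>
  define v where "v = euler N u - of_nat (Suc e) * u"
  have vpol: "v \<in> polys N" using u by (auto simp: v_def simp del: of_nat_Suc)
  have v: "v \<in> order_ge (Suc (Suc e))" unfolding v_def by (rule euler_order_ge) (use u in auto)
  have euler: "euler N u = of_nat (Suc e) * u + v" by (simp add: v_def)
  have euv: "euler N v \<in> ?F" using vpol v by (auto intro!: order_ge_filt euler_order_ge')
  have vF: "v \<in> ?F" using vpol v by auto
  have "2 * euler N (euler N u) + (of_nat N - 4) * euler N u =
      (2 * of_nat (Suc e) + (of_nat N - 4)) * (of_nat (Suc e) * u + v) + 2 * euler N v"
    unfolding euler euler_add euler_of_nat_mult by (simp add: algebra_simps del: of_nat_Suc)
  also have "\<dots> = of_nat (Suc e * (2 * e + N - 2)) * u + ((2 * of_nat (Suc e) + (of_nat N - 4)) * v + 2 * euler N v)"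
  proof -
    have "of_nat (2 * e + N - 2) = (2 * of_nat (Suc e) + (of_nat N - 4) :: 'a mpoly)"
      using N by (simp add: of_nat_diff algebra_simps)
    then show ?thesis unfolding of_nat_mult by (simp only: ring_distribs mult_ac add_ac)
  qed
  finally have "of_nat (Suc e * (2 * e + N - 2)) * u + ((2 * of_nat (Suc e) + (of_nat N - 4)) * v + 2 * euler N v) \<in> ?F"
    using A by simp
  moreover have "(2 * of_nat (Suc e) + (of_nat N - 4)) * v + 2 * euler N v \<in> ?F"
    using vF euv by (intro f.add f.mult polys_add polys_diff polys_mult polys_numeral polys_of_nat) auto
  ultimately have "of_nat (Suc e * (2 * e + N - 2)) * u \<in> ?F"
    using f.add_cancel by (metis add.commute)
  \<comment> \<open>The factor 2 e + N - 2 is positive because N >= 3.\<close>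
  then have "u \<in> ?F" by (rule f.cancel_nat) (use N u in simp_all)
  moreover have "p = (p - u) + u" by simp
  ultimately show ?thesis using u by (metis f.add qid_filt)
qed

text \<open>Induction on e: by \<open>kelvin_detects\<close> some \<open>kelvin N i\<close> moves p
  down exactly one level of the filtration, at the cost of order two. Index 2 e + 1 stands for order
  2 e.\<close>

lemma exists_dop_nonzero:
  assumes N: "N \<ge> 3"
  shows "p \<in> filt N e \<Longrightarrow> p \<notin> filt N (Suc e) \<Longrightarrow>
    \<exists>D. dop N (qid N) (2 * e + 1) D \<and> lookup (D p) 0 \<noteq> 0"
proof (induction e arbitrary: p)
  case 0
  then have "p \<in> polys N" "p \<notin> order_ge (Suc 0)" by (auto simp: filt_0)
  moreover have "dop N (qid N) 1 (\<lambda>x. x)" using q.dop_scale[of 1 N] by simp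
  ultimately show ?case by (intro exI[of _ "\<lambda>x. x"]) (auto simp: order_ge_Suc_0)
next
  case (Suc e)
  from kelvin_detects[OF N Suc.prems(1)] Suc.prems(2) obtain i where i: "i \<in> {1..N}"
    and "kelvin N i p \<notin> filt N (Suc e)" by blast
  moreover from Suc.prems(1) i have "kelvin N i p \<in> filt N e" by (intro kelvin_filt) auto
  ultimately obtain D where D: "dop N (qid N) (2 * e + 1) D" "lookup (D (kelvin N i p)) 0 \<noteq> 0"
    using Suc.IH by blast
  from q.dop_comp[OF D(1) dop_kelvin[OF i]] D(2) show ?case
    by (intro exI[of _ "\<lambda>x. D (kelvin N i x)"]) (simp add: numeral_3_eq_3 del: dop.simps)
qed

section \<open>Operators of small order\<close>

text \<open>\<open>contract N e D\<close> is the sum of \<open>x\<^sub>I D(x\<^sub>I)\<close> over all \<open>I \<in> {1..N}\<^sup>e\<close>.\<close>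

primrec contract :: "nat \<Rightarrow> nat \<Rightarrow> ('k::field_char_0 mpoly \<Rightarrow> 'k mpoly) \<Rightarrow> 'k mpoly" where
  "contract N 0 D = D 1"
| "contract N (Suc e) D = (\<Sum>i=1..N. mpoly_var i * contract N e (\<lambda>f. D (mpoly_var i * f)))"

text \<open>Moves the outermost sum of \<open>contract N (Suc e) D\<close> into the operator, giving
  the e-fold contraction of the map that sends f to the sum of the x_i D(x_i f).\<close>

lemma contract_sum:
  "contract N e (\<lambda>f. \<Sum>a\<in>A. r a * D a f) = (\<Sum>a\<in>A. r a * contract N e (D a))"
proof (induction e arbitrary: D)
  case (Suc e)
  show ?case
    by (simp add: Suc.IH[of "\<lambda>a f. D a (mpoly_var i * f)" for i] sum_distrib_left mult.left_commute)
       (rule sum.swap)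
qed simp

lemma (in poly_ideal) linear_mod_sum:
  assumes "linear_mod N I D" and "\<And>a. a \<in> A \<Longrightarrow> f a \<in> polys N"
  shows "D (\<Sum>a\<in>A. f a) - (\<Sum>a\<in>A. D (f a)) \<in> I"
  using assms(2)
proof (induction A rule: infinite_finite_induct)
  case (insert a A)
  then have "D (f a + sum f A) - (D (f a) + D (sum f A)) \<in> I"
    by (intro linear_mod_addD[OF assms(1)]) auto
  moreover have "D (sum f A) - (\<Sum>a\<in>A. D (f a)) \<in> I" using insert by auto
  ultimately have "(D (f a + sum f A) - (D (f a) + D (sum f A))) + (D (sum f A) - (\<Sum>a\<in>A. D (f a))) \<in> I"
    by (rule add)
  then show ?case using insert by (simp add: algebra_simps)
qed (use linear_mod_idealD[OF assms(1), of 0] in auto)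

lemma dop_contract_step:
  fixes D :: "'k::field_char_0 mpoly \<Rightarrow> 'k mpoly"
  assumes "dop N (qid N) (Suc (Suc n)) D"
  shows "dop N (qid N) n (\<lambda>f. \<Sum>i=1..N. mpoly_var i * D (mpoly_var i * f))"
proof -
  let ?x = "mpoly_var :: nat \<Rightarrow> 'k mpoly"
  define B where "B i f = (D (?x i * (?x i * f)) - ?x i * D (?x i * f)) - ?x i * (D (?x i * f) - ?x i * D f)" for i f
  have D: "D f \<in> polys N" if "f \<in> polys N" for f
    using linear_mod_polys[OF dop_linear_mod[OF assms] that] .
  have "dop N (qid N) n (B i)" if i: "i \<in> {1..N}" for i
  proof -
    have "dop N (qid N) (Suc n) (\<lambda>f. D (?x i * f) - ?x i * D f)"
      using assms polys_var[OF i] by (subst (asm) dop.simps) blast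
    then show ?thesis unfolding B_def using polys_var[OF i] by (subst (asm) dop.simps) blast
  qed
  then have "dop N (qid N) n (\<lambda>f. mpoly_const (- 1 / 2) * (\<Sum>i=1..N. B i f))"
    by (intro q.dop_mult q.dop_sum) auto
  then show ?thesis
  proof (rule q.dop_cong)
    fix f :: "'k mpoly" assume f: "f \<in> polys N"
    show "(\<Sum>i=1..N. ?x i * D (?x i * f)) \<in> polys N" using D f by (intro polys_sum polys_mult) auto
    have "D (\<Sum>i=1..N. ?x i * (?x i * f)) - (\<Sum>i=1..N. D (?x i * (?x i * f))) \<in> qid N"
      using f by (intro q.linear_mod_sum dop_linear_mod[OF assms]) auto
    moreover have "D (quad N * f) \<in> qid N"
      using f by (intro linear_mod_idealD[OF dop_linear_mod[OF assms]]) auto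
    moreover have "(\<Sum>i=1..N. ?x i * (?x i * f)) = quad N * f"
      by (simp add: quad_def power2_eq_square sum_distrib_right mult.assoc)
    ultimately have S: "(\<Sum>i=1..N. D (?x i * (?x i * f))) \<in> qid N"
      by (metis (no_types, lifting) q.diff_mem q.diff_sym)
    have h: "mpoly_const (1/2) * (2 * g) = (g :: 'k mpoly)" for g
    proof -
      have "mpoly_const (1/2) * mpoly_const 2 * g = g" by (simp add: mpoly_const_mult[symmetric])
      then show ?thesis using mpoly_const_of_nat[of 2, where 'a='k] by (simp add: mult.assoc)
    qed
    \<comment> \<open>As an operator, each double commutator is D x_i^2 - 2 x_i D x_i + x_i^2 D.
      Summed over i, the two outer terms vanish modulo q.\<close>
    have "(\<Sum>i=1..N. B i f) = (\<Sum>i=1..N. D (?x i * (?x i * f))) + quad N * D f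
        - 2 * (\<Sum>i=1..N. ?x i * D (?x i * f))"
      by (simp add: B_def quad_def power2_eq_square sum_distrib_right sum_distrib_left sum.distrib[symmetric]
          sum_subtractf[symmetric] algebra_simps)
    then have "(\<Sum>i=1..N. ?x i * D (?x i * f)) - mpoly_const (- 1 / 2) * (\<Sum>i=1..N. B i f)
      = mpoly_const (1/2) * ((\<Sum>i=1..N. D (?x i * (?x i * f))) + quad N * D f)"
    proof -
      have "mpoly_const (- 1 / 2) = - mpoly_const (1/2 :: 'k)"
        by (simp add: mpoly_const_def single_uminus)
      then show ?thesis
        using \<open>sum _ _ = _ + quad N * D f - _\<close> by (simp add: right_diff_distrib h)
    qed
    also have "\<dots> \<in> qid N" using S D[OF f] by (intro q.mult q.add polys_const quad_mult_qid)
    finally show "(\<Sum>i=1..N. ?x i * D (?x i * f)) - mpoly_const (- 1 / 2) * (\<Sum>i=1..N. B i f) \<in> qid N" .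
  qed
qed

text \<open>Each contraction lowers the index by two. After e of them, index 0 says that the
  operator, and with it the value at 1, is zero modulo q.\<close>

lemma contract_qid: "dop N (qid N) (2 * e) D \<Longrightarrow> contract N e D \<in> qid N"
proof (induction e arbitrary: D)
  case 0
  then show ?case by simp
next
  case (Suc e)
  then have "contract N e (\<lambda>f. \<Sum>i=1..N. mpoly_var i * D (mpoly_var i * f)) \<in> qid N"
    by (intro Suc.IH dop_contract_step) (simp del: dop.simps)
  then show ?case by (simp add: contract_sum)
qed

text \<open>The products of variables in front already have degree e, so only the constant terms of
  the values of D contribute in degree e.\<close>

lemma contract_diff_order_ge:
  "(\<And>f. D f - D' f \<in> order_ge (Suc 0)) \<Longrightarrow> contract N e D - contract N e D' \<in> order_ge (Suc e)"
proof (induction e arbitrary: D D')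
  case (Suc e)
  have "mpoly_var i * (contract N e (\<lambda>f. D (mpoly_var i * f)) - contract N e (\<lambda>f. D' (mpoly_var i * f)))
      \<in> order_ge (Suc 0 + Suc e)" for i
    by (intro order_ge_mult order_ge_var Suc.IH Suc.prems)
  then show ?case by (simp add: sum_subtractf[symmetric] right_diff_distrib[symmetric] order_ge_sum)
qed simp

lemma contract_homog: "contract N e (\<lambda>f. mpoly_const (\<phi> f)) \<in> homog e"
proof (induction e arbitrary: \<phi>)
  case (Suc e)
  have "mpoly_var i * contract N e (\<lambda>f. mpoly_const (\<phi> (mpoly_var i * f))) \<in> homog (Suc 0 + e)" for i
    by (intro homog_mult homog_var Suc.IH)
  then show ?case by (simp add: homog_sum)
qed simp

lemma contract_polys: "(\<And>f. f \<in> polys N \<Longrightarrow> D f \<in> polys N) \<Longrightarrow> contract N e D \<in> polys N"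
  by (induction e arbitrary: D) auto

lemma contract_zero: "(\<And>f. f \<in> polys N \<Longrightarrow> D f = 0) \<Longrightarrow> contract N e D = 0"
  by (induction e arbitrary: D) auto

text \<open>Since q is homogeneous, the degree e part of p - u = h q involves only the part h1 of h
  of degree e - 2. Then p - h1 q is a form of degree e and equals u + h2 q, which has no monomial of
  that degree.\<close>

lemma homog_filt_qid:
  assumes p: "p \<in> homog e" "p \<in> filt N (Suc e)"
  shows "p \<in> qid N"
proof -
  from p(2) obtain u where u: "u \<in> order_ge (Suc e)" "p - u \<in> qid N" by (rule filtE)
  then obtain h where h: "h \<in> polys N" "p - u = h * quad N" by (auto simp: qid_def)
  \<comment> \<open>Stated additively, so that no monomial qualifies when e < 2.\<close>
  define A where "A = {m \<in> keys h. mdeg m + 2 = e}"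
  define h1 where "h1 = (\<Sum>m\<in>A. single m (lookup h m))"
  define h2 where "h2 = (\<Sum>m\<in>keys h - A. single m (lookup h m))"
  have A: "finite A" "A \<subseteq> keys h" by (auto simp: A_def)
  have h12: "h = h1 + h2"
    unfolding h1_def h2_def by (subst mpoly_eq_sum) (simp add: sum.subset_diff[OF A(2)] add.commute)
  have lk: "lookup h1 m = (if m \<in> A then lookup h m else 0)" for m
    using A by (simp add: h1_def lookup_sum lookup_single when_def)
  have lk2: "lookup h2 m = (if m \<in> keys h - A then lookup h m else 0)" for m
    by (simp add: h2_def lookup_sum lookup_single when_def)
  have k1: "keys h1 \<subseteq> A" and k2: "keys h2 \<subseteq> keys h - A"
    using lk lk2 by (auto simp: in_keys_iff split: if_splits)
  have q: "mdeg m = 2" if "m \<in> keys (quad N :: 'a mpoly)" for m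
    using homog_quad[of N] that by (auto simp: homog_def)
  have "p - h1 * quad N = u + h2 * quad N"
    using h(2) by (simp add: h12 algebra_simps)
  moreover have "mdeg m = e" if "m \<in> keys (p - h1 * quad N)" for m
  proof -
    have "m \<in> keys p \<or> m \<in> keys (h1 * quad N)" using keys_sub_mono that by blast
    then show ?thesis
    proof
      assume "m \<in> keys (h1 * quad N)"
      then obtain a b where "a \<in> keys h1" "b \<in> keys (quad N :: 'a mpoly)" "m = a + b" by (rule keys_mult_cases)
      then show ?thesis using k1 q by (auto simp: A_def mdeg_add)
    qed (use p in \<open>auto simp: homog_def\<close>)
  qed
  moreover have "mdeg m \<noteq> e" if "m \<in> keys (u + h2 * quad N)" for m
  proof -
    have "m \<in> keys u \<or> m \<in> keys (h2 * quad N)" using Poly_Mapping.keys_add[of u "h2 * quad N"] that by blast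
    then show ?thesis
    proof
      assume "m \<in> keys (h2 * quad N)"
      then obtain a b where "a \<in> keys h2" "b \<in> keys (quad N :: 'a mpoly)" "m = a + b" by (rule keys_mult_cases)
      then show ?thesis using k2 q[of b] by (auto simp: A_def mdeg_add)
    qed (use u in \<open>auto simp: order_ge_def\<close>)
  qed
  ultimately have "keys (p - h1 * quad N) = {}" by (metis all_not_in_conv)
  then have "p = h1 * quad N" by (metis keys_eq_empty right_minus_eq)
  moreover have "h1 \<in> polys N" using k1 A h(1) by (auto simp: polys_def)
  ultimately show ?thesis by (auto simp: qid_def)
qed

text \<open>In a second set of variables y_i, the contraction is a power of the pairing sum x_i y_i
  with \<phi> acting on the y_i. Differentiating by x_j brings down the exponent and a factor
  y_j.\<close>

lemma pd_contract:
  assumes "j \<in> {1..N}"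
  shows "pd j (contract N (Suc e) (\<lambda>f. mpoly_const (\<phi> f))) =
    of_nat (Suc e) * contract N e (\<lambda>f. mpoly_const (\<phi> (mpoly_var j * f)))"
proof (induction e arbitrary: \<phi>)
  case 0
  have "pd j (mpoly_var i * mpoly_const c) = (if i = j then mpoly_const c else 0)" for i and c :: 'a
    by (simp add: pd_mult pd_var)
  then show ?case using assms by (simp add: pd_sum sum.delta)
next
  case (Suc e)
  let ?c = "\<lambda>e \<phi>. contract N e (\<lambda>f. mpoly_const (\<phi> f))"
  let ?s = "\<lambda>i \<phi>. (\<lambda>f. \<phi> (mpoly_var i * f))"
  have "pd j (?c (Suc (Suc e)) \<phi>) = (\<Sum>i=1..N. pd j (mpoly_var i * ?c (Suc e) (?s i \<phi>)))"
    by (simp only: contract.simps(2)[of N "Suc e"] pd_sum)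
  also have "\<dots> = (\<Sum>i=1..N. (if j = i then ?c (Suc e) (?s i \<phi>) else 0)
       + of_nat (Suc e) * (mpoly_var i * ?c e (?s i (?s j \<phi>))))"
  proof (rule sum.cong)
    fix i
    have sw: "?s j (?s i \<phi>) = ?s i (?s j \<phi>)"
      by (simp add: fun_eq_iff mult.left_commute)
    have "pd j (mpoly_var i * ?c (Suc e) (?s i \<phi>)) =
      pd j (mpoly_var i) * ?c (Suc e) (?s i \<phi>) + mpoly_var i * (of_nat (Suc e) * ?c e (?s j (?s i \<phi>)))"
      by (simp only: pd_mult Suc.IH)
    then show "pd j (mpoly_var i * ?c (Suc e) (?s i \<phi>)) = (if j = i then ?c (Suc e) (?s i \<phi>) else 0)
       + of_nat (Suc e) * (mpoly_var i * ?c e (?s i (?s j \<phi>)))"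
      unfolding sw by (simp add: pd_var mult.left_commute del: contract.simps of_nat_Suc)
  qed simp
  also have "\<dots> = ?c (Suc e) (?s j \<phi>) + of_nat (Suc e) * (\<Sum>i=1..N. mpoly_var i * ?c e (?s i (?s j \<phi>)))"
    using assms by (simp add: sum.distrib sum_distrib_left sum.delta del: contract.simps of_nat_Suc)
  also have "(\<Sum>i=1..N. mpoly_var i * ?c e (?s i (?s j \<phi>))) = ?c (Suc e) (?s j \<phi>)"
    by (simp only: contract.simps)
  also have "?c (Suc e) (?s j \<phi>) + of_nat (Suc e) * ?c (Suc e) (?s j \<phi>) = of_nat (Suc (Suc e)) * ?c (Suc e) (?s j \<phi>)"
    by (simp add: algebra_simps del: contract.simps)
  finally show ?case .
qed

definition functional :: "nat \<Rightarrow> ('k::field_char_0 mpoly \<Rightarrow> 'k) \<Rightarrow> bool" where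
  "functional N \<phi> \<longleftrightarrow> (\<forall>p\<in>polys N. \<forall>p'\<in>polys N. \<phi> (p + p') = \<phi> p + \<phi> p') \<and>
     (\<forall>c. \<forall>p\<in>polys N. \<phi> (mpoly_const c * p) = c * \<phi> p) \<and> (\<forall>p\<in>qid N. \<phi> p = 0)"

lemma functional_sum:
  assumes "functional N \<phi>" "\<And>a. a \<in> A \<Longrightarrow> f a \<in> polys N"
  shows "\<phi> (\<Sum>a\<in>A. f a) = (\<Sum>a\<in>A. \<phi> (f a))"
proof -
  have "\<phi> 0 = 0" using assms(1) by (simp add: functional_def)
  then show ?thesis using assms(2)
  proof (induction A rule: infinite_finite_induct)
    case (insert a A)
    then have "\<phi> (f a + sum f A) = \<phi> (f a) + \<phi> (sum f A)"
      using assms(1) unfolding functional_def by (metis insertCI polys_sum)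
    with insert show ?case by simp
  qed auto
qed

lemma functional_shift:
  assumes "functional N \<phi>" "j \<in> {1..N}"
  shows "functional N (\<lambda>f. \<phi> (mpoly_var j * f))"
  unfolding functional_def
proof (intro conjI ballI allI)
  fix p p' :: "'a mpoly" assume "p \<in> polys N" "p' \<in> polys N"
  then show "\<phi> (mpoly_var j * (p + p')) = \<phi> (mpoly_var j * p) + \<phi> (mpoly_var j * p')"
    using assms unfolding functional_def distrib_left by (metis polys_mult polys_var)
next
  fix c and p :: "'a mpoly" assume "p \<in> polys N"
  then show "\<phi> (mpoly_var j * (mpoly_const c * p)) = c * \<phi> (mpoly_var j * p)"
    using assms unfolding functional_def mult.left_commute[of "mpoly_var j"] by (metis polys_mult polys_var)
next
  fix p :: "'a mpoly" assume "p \<in> qid N"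
  then have "mpoly_var j * p \<in> qid N" using assms(2) by (intro q.mult polys_var)
  then show "\<phi> (mpoly_var j * p) = 0" using assms(1) by (simp add: functional_def)
qed

text \<open>Differentiating the power of the pairing twice and summing puts the factor q inside
  \<phi>, which vanishes on multiples of q.\<close>

lemma laplacian_contract:
  assumes "functional N \<phi>"
  shows "laplacian N (contract N e (\<lambda>f. mpoly_const (\<phi> f))) = 0"
proof (cases e)
  case 0
  then show ?thesis by (simp add: laplacian_def)
next
  case (Suc e1)
  let ?c = "\<lambda>e \<phi>. contract N e (\<lambda>f. mpoly_const (\<phi> f))"
  let ?s = "\<lambda>i \<phi>. (\<lambda>f. \<phi> (mpoly_var i * f))"
  have 1: "laplacian N (?c e \<phi>) = (\<Sum>j=1..N. of_nat e * pd j (?c e1 (?s j \<phi>)))"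
    unfolding laplacian_def Suc
  proof (rule sum.cong)
    fix j assume "j \<in> {1..N}"
    then show "pd j (pd j (?c (Suc e1) \<phi>)) = of_nat (Suc e1) * pd j (?c e1 (?s j \<phi>))"
      by (simp only: pd_contract pd_of_nat_mult)
  qed simp
  show ?thesis
  proof (cases e1)
    case 0
    then show ?thesis by (simp add: 1)
  next
    case e1: (Suc e2)
    have "laplacian N (?c e \<phi>) = (\<Sum>j=1..N. of_nat e * of_nat e1 * ?c e2 (?s j (?s j \<phi>)))"
      unfolding 1
    proof (rule sum.cong)
      fix j assume "j \<in> {1..N}"
      then show "of_nat e * pd j (?c e1 (?s j \<phi>)) = of_nat e * of_nat e1 * ?c e2 (?s j (?s j \<phi>))"
        unfolding e1 by (simp only: pd_contract mult.assoc)
    qed simp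
    also have "\<dots> = contract N e2 (\<lambda>f. \<Sum>j=1..N. of_nat e * of_nat e1 * mpoly_const (\<phi> (mpoly_var j * (mpoly_var j * f))))"
      by (rule contract_sum[symmetric])
    also have "\<dots> = 0"
    proof (rule contract_zero)
      fix f :: "'a mpoly" assume f: "f \<in> polys N"
      have "(\<Sum>j=1..N. mpoly_const (\<phi> (mpoly_var j * (mpoly_var j * f)))) =
          mpoly_const (\<Sum>j=1..N. \<phi> (mpoly_var j * (mpoly_var j * f)))"
        by (induction N) (auto simp: mpoly_const_add)
      also have "(\<Sum>j=1..N. \<phi> (mpoly_var j * (mpoly_var j * f))) = \<phi> (\<Sum>j=1..N. mpoly_var j * (mpoly_var j * f))"
        using f by (intro functional_sum[OF assms, symmetric]) auto
      also have "(\<Sum>j=1..N. mpoly_var j * (mpoly_var j * f)) = quad N * f"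
        by (simp add: quad_def power2_eq_square sum_distrib_right mult.assoc)
      also have "\<phi> (quad N * f) = 0" using assms f by (simp add: functional_def)
      finally show "(\<Sum>j=1..N. of_nat e * of_nat e1 * mpoly_const (\<phi> (mpoly_var j * (mpoly_var j * f)))) = 0"
        by (simp add: sum_distrib_left[symmetric])
    qed
    finally show ?thesis .
  qed
qed

text \<open>The \<open>K\<^sub>j\<close> turn the contraction of \<open>\<phi>\<close> into a nonzero multiple of that of \<open>\<phi> \<circ> x\<^sub>j\<close>, because the
  contraction is harmonic when \<open>\<phi>\<close> vanishes on \<open>(q)\<close>.\<close>

lemma contract_shift_qid:
  fixes \<phi> :: "'k::field_char_0 mpoly \<Rightarrow> 'k"
  assumes N: "N \<ge> 3" and \<phi>: "functional N \<phi>" and j: "j \<in> {1..N}"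
    and c: "contract N (Suc e) (\<lambda>f. mpoly_const (\<phi> f)) \<in> qid N"
  shows "contract N e (\<lambda>f. mpoly_const (\<phi> (mpoly_var j * f))) \<in> qid N"
proof -
  define g where "g = contract N e (\<lambda>f. mpoly_const (\<phi> (mpoly_var j * f)))"
  have g: "g \<in> homog e" "g \<in> polys N" unfolding g_def by (auto intro: contract_homog contract_polys)
  have "kelvin N j (contract N (Suc e) (\<lambda>f. mpoly_const (\<phi> f))) \<in> qid N"
    by (rule kelvin_qid[OF j c])
  also have "kelvin N j (contract N (Suc e) (\<lambda>f. mpoly_const (\<phi> f))) =
     - (2 * (of_nat (Suc e) * (of_nat e * g)) + (of_nat N - 2) * (of_nat (Suc e) * g))"
    unfolding kelvin_def laplacian_contract[OF \<phi>] pd_contract[OF j] g_def[symmetric] euler_of_nat_mult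
       euler_homog[OF g(2,1)] by simp
  also have "\<dots> = - (of_nat (Suc e * (2 * e + N - 2)) * g)"
  proof -
    have "of_nat (2 * e + N - 2) = (2 * of_nat e + (of_nat N - 2) :: 'k mpoly)"
      using N by (simp add: of_nat_diff algebra_simps)
    then show ?thesis unfolding of_nat_mult by (simp only: ring_distribs mult_ac add_ac)
  qed
  finally have "of_nat (Suc e * (2 * e + N - 2)) * g \<in> qid N"
    using q.uminus by fastforce
  then show ?thesis unfolding g_def[symmetric] by (rule q.cancel_nat) (use N in simp)
qed

lemma qid_lookup_0: "p \<in> qid N \<Longrightarrow> lookup p 0 = 0"
proof -
  assume "p \<in> qid N"
  then obtain h where "p = h * quad N" by (auto simp: qid_def)
  moreover have "h * quad N \<in> order_ge (Suc 0)"
    using quad_order_ge[of N] by (intro order_ge_mult_left) (auto intro: order_ge_anti[rotated])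
  ultimately show ?thesis by (simp add: order_ge_Suc_0)
qed

text \<open>Shifting \<phi> by the variables of m one at a time ends with the constant \<phi>(m),
  and (q) contains no nonzero constant.\<close>

lemma contract_determines:
  assumes N: "N \<ge> 3"
  shows "functional N \<phi> \<Longrightarrow> contract N (mdeg m) (\<lambda>f. mpoly_const (\<phi> f)) \<in> qid N \<Longrightarrow>
    keys m \<subseteq> {1..N} \<Longrightarrow> \<phi> (single m 1) = 0"
proof (induction "mdeg m" arbitrary: \<phi> m)
  case 0
  then have "m = 0" by (simp add: mdeg_eq_0)
  with 0 have "mpoly_const (\<phi> 1) \<in> qid N" by simp
  from qid_lookup_0[OF this] \<open>m = 0\<close> show ?case by (simp add: mpoly_const_def)
next
  case (Suc e)
  then obtain j where j: "j \<in> keys m" by (metis mdeg_0 nat.simps(3) all_not_in_conv keys_eq_empty)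
  with Suc.prems have jN: "j \<in> {1..N}" by auto
  define m' where "m' = m - single j 1"
  have m': "single m 1 = mpoly_var j * single m' (1 :: 'a)" "mdeg m = Suc (mdeg m')" "keys m' \<subseteq> keys m"
    using single_factor[OF j] by (auto simp: m'_def)
  have "contract N (mdeg m') (\<lambda>f. mpoly_const (\<phi> (mpoly_var j * f))) \<in> qid N"
    using Suc.prems m'(2) by (intro contract_shift_qid[OF N _ jN]) simp_all
  with Suc.hyps(1)[OF _ functional_shift[OF Suc.prems(1) jN]] Suc.hyps(2) m' Suc.prems
  show ?case by auto
qed

text \<open>By linearity it suffices to treat monomials of degree at least c. For such m the index
  of D is at most twice the degree, so \<open>contract_qid\<close> applies at the degree of m
  itself.\<close>

lemma dop_kills_filt:
  fixes D :: "'k::field_char_0 mpoly \<Rightarrow> 'k mpoly"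
  assumes N: "N \<ge> 3" and D: "dop N (qid N) n D" and n: "n \<le> 2 * c" and p: "p \<in> filt N c"
  shows "lookup (D p) 0 = 0"
proof -
  define \<phi> where "\<phi> f = lookup (D f) 0" for f
  have \<phi>: "functional N \<phi>"
    unfolding functional_def \<phi>_def
  proof (intro conjI ballI allI)
    fix p p' :: "'k mpoly" assume "p \<in> polys N" "p' \<in> polys N"
    from qid_lookup_0[OF linear_mod_addD[OF dop_linear_mod[OF D] this]]
    show "lookup (D (p + p')) 0 = lookup (D p) 0 + lookup (D p') 0"
      by (simp add: lookup_minus lookup_add)
  next
    fix c and p :: "'k mpoly" assume "p \<in> polys N"
    from qid_lookup_0[OF linear_mod_constD[OF dop_linear_mod[OF D] this]]
    show "lookup (D (mpoly_const c * p)) 0 = c * lookup (D p) 0"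
      by (simp add: lookup_minus lookup_const_mult)
  next
    fix p :: "'k mpoly" assume "p \<in> qid N"
    from qid_lookup_0[OF linear_mod_idealD[OF dop_linear_mod[OF D] this]] show "lookup (D p) 0 = 0" .
  qed
  have mono: "\<phi> (single m 1) = 0" if m: "keys m \<subseteq> {1..N}" "c \<le> mdeg m" for m
  proof (rule contract_determines[OF N \<phi> _ m(1)])
    let ?g = "contract N (mdeg m) (\<lambda>f. mpoly_const (\<phi> f))"
    have "dop N (qid N) (2 * mdeg m) D" using q.dop_mono[OF _ D] n m by simp
    then have cD: "contract N (mdeg m) D \<in> qid N" by (rule contract_qid)
    \<comment> \<open>Replacing the values of D by their constant terms changes the contraction only
      above the degree of m; being a form of that degree, \<open>?g\<close> is then zero modulo
      q.\<close>
    have "?g - contract N (mdeg m) D \<in> order_ge (Suc (mdeg m))"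
      by (rule contract_diff_order_ge) (simp add: order_ge_Suc_0 \<phi>_def lookup_minus mpoly_const_def)
    moreover have "?g \<in> polys N" by (rule contract_polys) auto
    moreover have "?g - (?g - contract N (mdeg m) D) \<in> qid N" using cD by simp
    ultimately have "?g \<in> filt N (Suc (mdeg m))" unfolding filt_def by blast
    then show "?g \<in> qid N" by (rule homog_filt_qid[OF contract_homog])
  qed
  from p obtain u where u: "u \<in> order_ge c" "u \<in> polys N" "p - u \<in> qid N" by (rule filtE)
  have "\<forall>m\<in>keys u. keys m \<subseteq> {1..N} \<and> c \<le> mdeg m" using u by (auto simp: polys_def order_ge_def)
  then have "u \<in> polys N \<and> \<phi> u = 0"
  proof (induction rule: mpoly_induct_keys)
    case (single m a)
    have "\<phi> (mpoly_const a * single m 1) = a * \<phi> (single m 1)"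
      using \<phi> single polys_single[of m N 1] by (auto simp: functional_def)
    with single mono[of m] show ?case by (simp add: const_mult_single polys_single)
  next
    case zero
    show ?case using \<phi> by (simp add: functional_def)
  next
    case (add p p')
    then show ?case using \<phi> by (simp add: functional_def)
  qed
  moreover have "\<phi> (u + (p - u)) = \<phi> u + \<phi> (p - u)" "\<phi> (p - u) = 0"
    using \<phi> u q.subset unfolding functional_def by (blast, blast)
  ultimately show ?thesis by (simp add: \<phi>_def)
qed

text \<open>Here n bounds the order. Degree e is detected precisely when 2 e is at most n, that is
  for e up to n div 2.\<close>

lemma filt_eq_dop:
  assumes "N \<ge> 3"
  shows "{p \<in> polys N. \<forall>D. dop N (qid N) (Suc n) D \<longrightarrow> lookup (D p) 0 = 0} = filt N (Suc (n div 2))"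
proof (intro equalityI subsetI)
  fix p :: "'a mpoly"
  assume "p \<in> {p \<in> polys N. \<forall>D. dop N (qid N) (Suc n) D \<longrightarrow> lookup (D p) 0 = 0}"
  then have p: "p \<in> polys N" "\<And>D. dop N (qid N) (Suc n) D \<Longrightarrow> lookup (D p) 0 = 0" by auto
  have "p \<in> filt N e" if "e \<le> Suc (n div 2)" for e
    using that
  proof (induction e)
    case 0
    then show ?case using p by (simp add: filt_0)
  next
    case (Suc e)
    show ?case
    proof (rule ccontr)
      assume "p \<notin> filt N (Suc e)"
      with exists_dop_nonzero[OF assms, of p e] Suc obtain D
        where D: "dop N (qid N) (2 * e + 1) D" "lookup (D p) 0 \<noteq> 0" by auto
      have "dop N (qid N) (Suc n) D" by (rule q.dop_mono[OF _ D(1)]) (use Suc.prems in presburger)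
      with p(2) D(2) show False by blast
    qed
  qed
  then show "p \<in> filt N (Suc (n div 2))" by simp
next
  fix p :: "'a mpoly"
  assume p: "p \<in> filt N (Suc (n div 2))"
  have "lookup (D p) 0 = 0" if "dop N (qid N) (Suc n) D" for D
    by (rule dop_kills_filt[OF assms that _ p]) presburger
  moreover have "p \<in> polys N" using p f.subset by blast
  ultimately show "p \<in> {p \<in> polys N. \<forall>D. dop N (qid N) (Suc n) D \<longrightarrow> lookup (D p) 0 = 0}" by blast
qed

section \<open>The quotient ring\<close>

lemma mpoly_ring_simps [simp]:
  "carrier (mpoly_ring N) = polys N" "monoid.mult (mpoly_ring N) = (*)" "one (mpoly_ring N) = 1"
  "ring.zero (mpoly_ring N) = 0" "add (mpoly_ring N) = (+)"
  by (simp_all add: mpoly_ring_def ring_of_type_algebra_def polys_def)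

lemma cring_mpoly_ring: "cring (mpoly_ring N)"
proof (rule cringI)
  have "\<exists>y\<in>polys N. y + p = 0" if "p \<in> polys N" for p :: "'a mpoly"
    using that by (intro bexI[of _ "- p"]) auto
  then show "abelian_group (mpoly_ring N :: 'a mpoly ring)"
    by (intro abelian_groupI) (auto simp: algebra_simps)
  show "comm_monoid (mpoly_ring N :: 'a mpoly ring)"
    by (intro comm_monoidI) (auto simp: algebra_simps)
qed (auto simp: algebra_simps)

lemma with_smult_simps [simp]:
  "carrier (with_smult A f) = carrier A" "monoid.mult (with_smult A f) = monoid.mult A"
  "one (with_smult A f) = one A" "ring.zero (with_smult A f) = ring.zero A"
  "add (with_smult A f) = add A" "module.smult (with_smult A f) = f"
  by (simp_all add: with_smult_def)

lemma cring_with_smult: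
  assumes "cring A" shows "cring (with_smult A f)"
proof -
  interpret A: cring A by fact
  have "\<exists>y\<in>carrier A. y \<oplus>\<^bsub>A\<^esub> x = \<zero>\<^bsub>A\<^esub>" if "x \<in> carrier A" for x
    using A.l_neg[OF that] A.a_inv_closed[OF that] by blast
  then show ?thesis
    by (intro cringI abelian_groupI comm_monoidI) (auto simp: A.ring_simprules intro: A.m_comm)
qed

text \<open>A ring presented as polynomials modulo \<open>W\<close>. It serves for R and for the
  record of R/I as an R-module, so coset arithmetic is translated into congruences once for
  both.\<close>

locale surj_hom = poly_ideal N W
  for N and W :: "'k::field_char_0 mpoly set" and S :: "('a, 'b) ring_scheme" (structure) and h +
  assumes cring_S: "cring S" and hom: "h \<in> ring_hom (mpoly_ring N) S"
    and surj: "h ` polys N = carrier S"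
    and ker: "\<And>p p'. p \<in> polys N \<Longrightarrow> p' \<in> polys N \<Longrightarrow> h p = h p' \<longleftrightarrow> p - p' \<in> W"
begin

interpretation H: ring_hom_cring "mpoly_ring N" S h
  by (intro ring_hom_cring.intro ring_hom_cring_axioms.intro cring_mpoly_ring cring_S hom)

lemma h_closed: "p \<in> polys N \<Longrightarrow> h p \<in> carrier S"
  using surj by blast

lemma h_add: "p \<in> polys N \<Longrightarrow> p' \<in> polys N \<Longrightarrow> h p \<oplus> h p' = h (p + p')"
  using H.hom_add[of p p'] by simp

lemma h_mult: "p \<in> polys N \<Longrightarrow> p' \<in> polys N \<Longrightarrow> h p \<otimes> h p' = h (p * p')"
  using H.hom_mult[of p p'] by simp

lemma h_zero: "\<zero> = h 0" and h_one: "\<one> = h 1"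
  using H.hom_zero H.hom_one by simp_all

lemma h_uminus: "p \<in> polys N \<Longrightarrow> \<ominus> h p = h (- p)"
  by (rule H.S.minus_equality) (simp_all add: h_add h_zero h_closed)

lemma h_diff: "p \<in> polys N \<Longrightarrow> p' \<in> polys N \<Longrightarrow> h p \<ominus> h p' = h (p - p')"
  by (simp add: a_minus_def h_uminus h_add)

lemma h_mem_image:
  assumes "poly_ideal N U" "W \<subseteq> U" "p \<in> polys N"
  shows "h p \<in> h ` U \<longleftrightarrow> p \<in> U"
proof -
  interpret U: poly_ideal N U by fact
  have "p \<in> U" if "p' \<in> U" "h p = h p'" for p'
  proof -
    have "p - p' \<in> U" using ker[of p p'] that assms U.subset by blast
    then show ?thesis using that(1) by (rule U.diff_mem)
  qed
  then show ?thesis by blast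
qed

lemma subgroup_image:
  assumes "poly_ideal N U"
  shows "subgroup (h ` U) (add_monoid S)"
proof -
  interpret U: poly_ideal N U by fact
  show ?thesis
  proof (intro subgroup.intro)
    show "h ` U \<subseteq> carrier (add_monoid S)" using U.subset surj by auto
    fix x y assume "x \<in> h ` U" "y \<in> h ` U"
    then obtain p p' where "p \<in> U" "p' \<in> U" "x = h p" "y = h p'" by blast
    moreover then have "p \<in> polys N" "p' \<in> polys N" using U.subset by auto
    ultimately show "x \<otimes>\<^bsub>add_monoid S\<^esub> y \<in> h ` U" by (simp add: h_add)
  next
    show "\<one>\<^bsub>add_monoid S\<^esub> \<in> h ` U" by (simp add: h_zero)
    fix x assume "x \<in> h ` U"
    then obtain p where "p \<in> U" "x = h p" by blast
    moreover then have "p \<in> polys N" using U.subset by auto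
    moreover have "inv\<^bsub>add_monoid S\<^esub> x = \<ominus> x" by (simp add: a_inv_def)
    ultimately show "inv\<^bsub>add_monoid S\<^esub> x \<in> h ` U" by (simp add: h_uminus)
  qed
qed

lemma ideal_image:
  assumes "poly_ideal N U"
  shows "ideal (h ` U) S"
proof -
  interpret U: poly_ideal N U by fact
  have mult: "h p \<otimes> x \<in> h ` U" if "p \<in> U" "x \<in> carrier S" for p x
  proof -
    from that surj obtain p' where "p' \<in> polys N" "x = h p'" by blast
    with that U.subset show ?thesis by (auto simp: h_mult subset_iff)
  qed
  show ?thesis
  proof (rule idealI)
    show "subgroup (h ` U) (add_monoid S)" by (rule subgroup_image) fact
    show "ring S" by (rule H.S.ring_axioms)
    fix a x assume a: "a \<in> h ` U" "x \<in> carrier S"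
    then have "a \<in> carrier S" using U.subset surj by blast
    with a show "x \<otimes> a \<in> h ` U" "a \<otimes> x \<in> h ` U" using mult H.S.m_comm[of x a] by auto
  qed
qed

text \<open>The hypotheses fit ideals of \<open>S\<close> as well as submodules of a quotient
  module.\<close>

lemma vimage_ideal:
  assumes V: "subgroup V (add_monoid S)" and m: "\<And>r x. r \<in> carrier S \<Longrightarrow> x \<in> V \<Longrightarrow> r \<otimes> x \<in> V"
  shows "poly_ideal N {p \<in> polys N. h p \<in> V}" and "W \<subseteq> {p \<in> polys N. h p \<in> V}"
    and "h ` {p \<in> polys N. h p \<in> V} = V"
proof -
  have z: "h 0 \<in> V" using subgroup.one_closed[OF V] by (simp add: h_zero)
  show "poly_ideal N {p \<in> polys N. h p \<in> V}"
  proof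
    fix p p' :: "'k mpoly" assume "p \<in> {p \<in> polys N. h p \<in> V}" "p' \<in> {p \<in> polys N. h p \<in> V}"
    then show "p + p' \<in> {p \<in> polys N. h p \<in> V}"
      using subgroup.m_closed[OF V, of "h p" "h p'"] by (simp add: h_add)
  next
    fix r p :: "'k mpoly" assume "r \<in> polys N" "p \<in> {p \<in> polys N. h p \<in> V}"
    then show "r * p \<in> {p \<in> polys N. h p \<in> V}"
      using m[of "h r" "h p"] by (simp add: h_mult h_closed)
  qed (use z in auto)
  have "h p \<in> V" if "p \<in> W" for p
  proof -
    have "h p = h 0" using ker[of p 0] that subset by auto
    then show ?thesis using z by simp
  qed
  then show "W \<subseteq> {p \<in> polys N. h p \<in> V}" using subset by blast
  have "V \<subseteq> h ` polys N" using subgroup.subset[OF V] surj by simp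
  then show "h ` {p \<in> polys N. h p \<in> V} = V" by blast
qed

end

text \<open>A quotient of a presented ring is again presented by polynomials. The parameter
  \<open>s\<close> covers the actions of both \<open>mpoly_quotient\<close> and
  \<open>quotient_module\<close>.\<close>

lemma (in ideal) surj_homI:
  fixes W :: "'k::field_char_0 mpoly set"
  assumes R: "cring R" and f: "surj_hom N W R f" and U: "poly_ideal N U" "W \<subseteq> U" and I: "I = f ` U"
  shows "surj_hom N U (with_smult (R Quot I) s) (\<lambda>p. I +> f p)"
proof -
  interpret f: surj_hom N W R f by fact
  interpret U: poly_ideal N U by fact
  show ?thesis
  proof (intro surj_hom.intro surj_hom_axioms.intro U(1))
    show "cring (with_smult (R Quot I) s)" by (intro cring_with_smult quotient_is_cring R)
    have "(+>) I \<circ> f \<in> ring_hom (mpoly_ring N) (R Quot I)"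
      by (rule ring_hom_trans[OF f.hom rcos_ring_hom])
    then show "(\<lambda>p. I +> f p) \<in> ring_hom (mpoly_ring N) (with_smult (R Quot I) s)"
      by (simp add: ring_hom_def comp_def)
    show "(\<lambda>p. I +> f p) ` polys N = carrier (with_smult (R Quot I) s)"
    proof -
      have "carrier (with_smult (R Quot I) s) = (\<lambda>a. I +> a) ` carrier R"
        by (auto simp: FactRing_simps)
      then show ?thesis by (simp add: f.surj[symmetric] image_image)
    qed
    fix p p' :: "'k mpoly" assume p: "p \<in> polys N" "p' \<in> polys N"
    have "I +> f p = I +> f p' \<longleftrightarrow> f p \<ominus> f p' \<in> I"
      using quotient_eq_iff_same_a_r_cos[OF is_ideal, of "f p" "f p'"] p f.h_closed by simp
    also have "\<dots> \<longleftrightarrow> p - p' \<in> U" using p U unfolding I by (simp add: f.h_diff f.h_mem_image)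
    finally show "I +> f p = I +> f p' \<longleftrightarrow> p - p' \<in> U" .
  qed
qed

lemma surj_hom_id: "surj_hom N {0} (mpoly_ring N) (\<lambda>p. p)"
  by (intro surj_hom.intro surj_hom_axioms.intro poly_ideal_null cring_mpoly_ring)
    (auto simp: ring_hom_def)

section \<open>The coordinate ring of the quadric and its maximal ideal\<close>

lemma quadric_ideal_eq: "quadric_ideal N = qid N"
  by (auto simp: quadric_ideal_def cgenideal_def qid_def quad_def)

definition cls :: "nat \<Rightarrow> 'k::field_char_0 mpoly \<Rightarrow> 'k mpoly set" where
  "cls N p = qid N +>\<^bsub>mpoly_ring N\<^esub> p"

definition qring :: "nat \<Rightarrow> ('k::field_char_0, 'k mpoly set) module" where
  "qring N = mpoly_quotient N (qid N)"

lemma surj_hom_cls: "surj_hom N (qid N) (qring N :: ('k::field_char_0, _) module) (cls N)"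
proof -
  interpret i: surj_hom N "{0 :: 'k::field_char_0 mpoly}" "mpoly_ring N" "\<lambda>p. p" by (rule surj_hom_id)
  have "ideal ((\<lambda>p. p) ` qid N) (mpoly_ring N :: 'k mpoly ring)"
    by (rule i.ideal_image) (rule q.poly_ideal_axioms)
  then interpret ideal "qid N" "mpoly_ring N :: 'k mpoly ring" by simp
  show ?thesis unfolding cls_def qring_def mpoly_quotient_def
    using surj_homI[OF cring_mpoly_ring surj_hom_id q.poly_ideal_axioms,
        where s = "\<lambda>c :: 'k. (\<otimes>\<^bsub>mpoly_ring N Quot qid N\<^esub>) (qid N +>\<^bsub>mpoly_ring N\<^esub> mpoly_const c)"]
    by simp
qed

interpretation c: surj_hom N "qid N" "qring N" "cls N" for N
  by (rule surj_hom_cls)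

lemma smult_qring: "a \<odot>\<^bsub>qring N\<^esub> u = cls N (mpoly_const a) \<otimes>\<^bsub>qring N\<^esub> u"
  by (simp add: qring_def mpoly_quotient_def cls_def)

lemma filt_1: "p \<in> polys N \<Longrightarrow> p \<in> filt N (Suc 0) \<longleftrightarrow> lookup p 0 = 0"
proof
  assume "p \<in> filt N (Suc 0)"
  then obtain u where u: "u \<in> order_ge (Suc 0)" "p - u \<in> qid N" by (rule filtE)
  from qid_lookup_0[OF u(2)] u(1) show "lookup p 0 = 0" by (simp add: lookup_minus order_ge_Suc_0)
qed (simp add: order_ge_filt order_ge_Suc_0)

text \<open>Every monomial of positive degree is a multiple of a variable.\<close>

lemma irrelevant_ideal_eq: "irrelevant_ideal N (qid N) = cls N ` filt N (Suc 0)"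
proof
  interpret R: cring "qring N :: ('a, _) module" by (rule c.cring_S)
  let ?G = "cls N ` (mpoly_var :: nat \<Rightarrow> 'a mpoly) ` {1..N}"
  have G: "?G \<subseteq> carrier (qring N)" by (auto intro!: c.h_closed polys_var)
  have irr: "irrelevant_ideal N (qid N) = Idl\<^bsub>qring N\<^esub> ?G"
    by (simp add: irrelevant_ideal_def qring_def cls_def image_image)
  have "mpoly_var i \<in> filt N (Suc 0)" if "i \<in> {1..N}" for i
    using that by (intro order_ge_filt polys_var order_ge_var)
  then show "irrelevant_ideal N (qid N) \<subseteq> cls N ` (filt N (Suc 0) :: 'a mpoly set)"
    unfolding irr by (intro R.genideal_minimal c.ideal_image f.poly_ideal_axioms) blast
  interpret J: ideal "Idl\<^bsub>qring N\<^esub> ?G" "qring N" by (rule R.genideal_ideal[OF G])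
  show "cls N ` (filt N (Suc 0) :: 'a mpoly set) \<subseteq> irrelevant_ideal N (qid N)"
  proof clarify
    fix p :: "'a mpoly" assume "p \<in> filt N (Suc 0)"
    then obtain u where u: "u \<in> order_ge (Suc 0)" "u \<in> polys N" "p - u \<in> qid N" and p: "p \<in> polys N"
      by (metis filtE f.subset subsetD)
    have "\<forall>m\<in>keys u. keys m \<subseteq> {1..N} \<and> Suc 0 \<le> mdeg m" using u by (auto simp: polys_def order_ge_def)
    then have "u \<in> polys N \<and> cls N u \<in> Idl\<^bsub>qring N\<^esub> ?G"
    proof (induction rule: mpoly_induct_keys)
      case (single m a)
      then have "m \<noteq> 0" by auto
      then obtain i where i: "i \<in> keys m" by (metis all_not_in_conv keys_eq_empty)
      with single have iN: "i \<in> {1..N}" by auto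
      have r: "single (m - Poly_Mapping.single i 1) a \<in> polys N"
        using single single_factor(3)[OF i] by (intro polys_single) auto
      have "cls N (mpoly_var i) \<in> Idl\<^bsub>qring N\<^esub> ?G"
        using R.genideal_self[OF G] iN by blast
      then have "cls N (mpoly_var i) \<otimes>\<^bsub>qring N\<^esub> cls N (single (m - Poly_Mapping.single i 1) a) \<in> Idl\<^bsub>qring N\<^esub> ?G"
        using r by (intro J.I_r_closed c.h_closed)
      then show ?case
        using r iN single polys_single[of m N] unfolding single_factor(1)[OF i, of a] by (simp add: c.h_mult)
    next
      case zero
      show ?case using J.zero_closed by (simp add: c.h_zero)
    next
      case (add p p')
      then show ?case using J.a_closed[of "cls N p" "cls N p'"] by (simp add: c.h_add)
    qed
    moreover have "cls N p = cls N u" using c.ker[OF p u(2)] u(3) by simp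
    ultimately show "cls N p \<in> irrelevant_ideal N (qid N)" unfolding irr by simp
  qed
qed

text \<open>\<open>D\<close> is any choice of representatives for the values of \<delta>. Nothing is
  asked outside the carriers, in keeping with \<open>module_Hom\<close>.\<close>

definition lifts :: "nat \<Rightarrow> ('k::field_char_0 mpoly set \<Rightarrow> 'k mpoly set) \<Rightarrow> ('k mpoly \<Rightarrow> 'k mpoly) \<Rightarrow> bool" where
  "lifts N \<delta> D \<longleftrightarrow> (\<forall>p\<in>polys N. D p \<in> polys N \<and> \<delta> (cls N p) = cls N (D p))"

lemma lifts_comm:
  assumes "lifts N \<delta> D" "r \<in> polys N"
  shows "lifts N (\<lambda>x. \<delta> (cls N r \<otimes>\<^bsub>qring N\<^esub> x) \<ominus>\<^bsub>qring N\<^esub> cls N r \<otimes>\<^bsub>qring N\<^esub> \<delta> x) (\<lambda>x. D (r * x) - r * D x)"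
  using assms by (simp add: lifts_def c.h_mult c.h_diff)

lemma carrier_qring: "carrier (qring N) = cls N ` polys N"
  by (rule c.surj[symmetric])

text \<open>Scalars appear as multiplication by constant classes, so the lemma serves for K-linear
  maps and for the R-linear maps of order 0.\<close>

lemma lifts_linear_linear_mod:
  fixes D :: "'k::field_char_0 mpoly \<Rightarrow> 'k mpoly"
  assumes l: "lifts N \<delta> D"
    and a: "\<And>p p'. p \<in> polys N \<Longrightarrow> p' \<in> polys N \<Longrightarrow> \<delta> (cls N p \<oplus>\<^bsub>qring N\<^esub> cls N p') = \<delta> (cls N p) \<oplus>\<^bsub>qring N\<^esub> \<delta> (cls N p')"
    and s: "\<And>a p. p \<in> polys N \<Longrightarrow> \<delta> (cls N (mpoly_const a) \<otimes>\<^bsub>qring N\<^esub> cls N p) = cls N (mpoly_const a) \<otimes>\<^bsub>qring N\<^esub> \<delta> (cls N p)"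
  shows "linear_mod N (qid N) D"
proof -
  have sc: "D (mpoly_const c * p) - mpoly_const c * D p \<in> qid N" if "p \<in> polys N" for c p
    using s[OF that, of c] l that unfolding lifts_def by (simp add: c.h_mult c.ker)
  have D0: "D 0 \<in> qid N" using sc[of 0 0] by simp
  show ?thesis unfolding linear_mod_def
  proof (intro conjI ballI allI sc)
    fix p p' :: "'k mpoly" assume "p \<in> polys N" "p' \<in> polys N"
    with a[OF this] l show "D (p + p') - (D p + D p') \<in> qid N"
      unfolding lifts_def by (simp add: c.h_add c.ker)
  next
    fix p :: "'k mpoly" assume "p \<in> qid N"
    then have "p \<in> polys N" "cls N p = cls N 0" using q.subset c.ker[of p N 0] by auto
    then have "D p - D 0 \<in> qid N" using l unfolding lifts_def by (metis c.ker polys_0)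
    then show "D p \<in> qid N" using D0 by (rule q.diff_mem)
  qed (use l in \<open>auto simp: lifts_def\<close>)
qed

lemma module_Hom_linear_mod:
  fixes D :: "'k::field_char_0 mpoly \<Rightarrow> 'k mpoly"
  assumes l: "lifts N \<delta> D"
  shows "\<delta> \<in> module_Hom ring_of_type_algebra (qring N) (qring N) \<longleftrightarrow> linear_mod N (qid N) D"
proof
  assume "\<delta> \<in> module_Hom ring_of_type_algebra (qring N) (qring N)"
  then show "linear_mod N (qid N) D"
    by (intro lifts_linear_linear_mod[OF l])
       (auto simp: module_Hom_def carrier_qring smult_qring ring_of_type_algebra_def)
next
  assume c: "linear_mod N (qid N) D"
  show "\<delta> \<in> module_Hom ring_of_type_algebra (qring N) (qring N)"
    unfolding module_Hom_def carrier_qring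
  proof (intro CollectI conjI ballI)
    show "\<delta> \<in> cls N ` polys N \<rightarrow> cls N ` polys N" using l by (auto simp: lifts_def)
    fix x y :: "'k mpoly set" assume "x \<in> cls N ` polys N" "y \<in> cls N ` polys N"
    then obtain p p' where p: "p \<in> polys N" "p' \<in> polys N" "x = cls N p" "y = cls N p'" by blast
    then show "\<delta> (x \<oplus>\<^bsub>qring N\<^esub> y) = \<delta> x \<oplus>\<^bsub>qring N\<^esub> \<delta> y"
      using l linear_mod_addD[OF c p(1,2)] unfolding lifts_def by (simp add: c.h_add c.ker)
  next
    fix a and x :: "'k mpoly set" assume "x \<in> cls N ` polys N"
    then obtain p where p: "p \<in> polys N" "x = cls N p" by blast
    then show "\<delta> (a \<odot>\<^bsub>qring N\<^esub> x) = a \<odot>\<^bsub>qring N\<^esub> \<delta> x"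
      using l linear_mod_constD[OF c p(1)] unfolding lifts_def by (simp add: smult_qring c.h_mult c.ker)
  qed
qed

lemma diff_ops_iff_dop:
  fixes D :: "'k::field_char_0 mpoly \<Rightarrow> 'k mpoly"
  \<comment> \<open>Index 0 of \<open>diff_ops\<close> is R-linearity, i.e. vanishing commutators,
    and that is index 1 of \<open>dop\<close>.\<close>
  shows "lifts N \<delta> D \<Longrightarrow> \<delta> \<in> diff_ops ring_of_type_algebra (qring N) n \<longleftrightarrow> dop N (qid N) (Suc n) D"
proof (induction n arbitrary: \<delta> D)
  case 0
  note l = 0[unfolded lifts_def, rule_format]
  show ?case
  proof
    assume \<delta>: "\<delta> \<in> diff_ops ring_of_type_algebra (qring N) 0"
    have c: "linear_mod N (qid N) D"
      using \<delta> by (intro lifts_linear_linear_mod[OF 0])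
        (auto simp: module_Hom_def regular_module_def carrier_qring)
    have "D (r * p) - r * D p \<in> qid N" if "r \<in> polys N" "p \<in> polys N" for r p
    proof -
      have "\<delta> (cls N r \<otimes>\<^bsub>qring N\<^esub> cls N p) = cls N r \<otimes>\<^bsub>qring N\<^esub> \<delta> (cls N p)"
        using \<delta> that by (auto simp: module_Hom_def regular_module_def carrier_qring)
      then show ?thesis using l that by (simp add: c.h_mult c.ker)
    qed
    then show "dop N (qid N) (Suc 0) D" using c by (simp add: q.linear_mod_comm)
  next
    assume d: "dop N (qid N) (Suc 0) D"
    note c = dop_linear_mod[OF d]
    show "\<delta> \<in> diff_ops ring_of_type_algebra (qring N) 0"
      unfolding diff_ops.simps module_Hom_def regular_module_def carrier_qring with_smult_simps
    proof (intro CollectI conjI ballI)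
      show "\<delta> \<in> cls N ` polys N \<rightarrow> cls N ` polys N" using l by auto
      fix x y :: "'k mpoly set" assume "x \<in> cls N ` polys N" "y \<in> cls N ` polys N"
      then obtain p p' where p: "p \<in> polys N" "p' \<in> polys N" "x = cls N p" "y = cls N p'" by blast
      then show "\<delta> (x \<oplus>\<^bsub>qring N\<^esub> y) = \<delta> x \<oplus>\<^bsub>qring N\<^esub> \<delta> y"
        using l linear_mod_addD[OF c p(1,2)] by (simp add: c.h_add c.ker)
      show "\<delta> (x \<otimes>\<^bsub>qring N\<^esub> y) = x \<otimes>\<^bsub>qring N\<^esub> \<delta> y"
        using l d p by (simp add: c.h_mult c.ker)
    qed
  qed
next
  case (Suc n)
  have "(\<forall>r\<in>carrier (qring N). (\<lambda>x. \<delta> (r \<otimes>\<^bsub>qring N\<^esub> x) \<ominus>\<^bsub>qring N\<^esub> r \<otimes>\<^bsub>qring N\<^esub> \<delta> x)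
           \<in> diff_ops ring_of_type_algebra (qring N) n)
      \<longleftrightarrow> (\<forall>r\<in>polys N. dop N (qid N) (Suc n) (\<lambda>x. D (r * x) - r * D x))"
    unfolding carrier_qring ball_simps
    using Suc.IH[OF lifts_comm[OF Suc.prems]] by blast
  then show ?case
    using module_Hom_linear_mod[OF Suc.prems] by (simp only: diff_ops.simps dop.simps(2)[of _ _ "Suc n"] mem_Collect_eq)
qed

lemma exists_lift:
  fixes \<delta> :: "'k::field_char_0 mpoly set \<Rightarrow> 'k mpoly set"
  assumes "\<delta> \<in> diff_ops ring_of_type_algebra (qring N) n"
  shows "\<exists>D. lifts N \<delta> D"
proof -
  have "\<delta> u \<in> carrier (qring N)" if "u \<in> carrier (qring N)" for u
    using assms that by (cases n) (auto simp: module_Hom_def regular_module_def)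
  then have "\<exists>d. d \<in> polys N \<and> \<delta> (cls N p) = cls N d" if "p \<in> polys N" for p
    using that unfolding carrier_qring by blast
  then show ?thesis unfolding lifts_def by metis
qed

text \<open>D preserves (q), so its values on congruent polynomials are congruent and do not depend
  on the chosen representative modulo (q).\<close>

lemma exists_lifted:
  fixes D :: "'k::field_char_0 mpoly \<Rightarrow> 'k mpoly"
  assumes c: "linear_mod N (qid N) D"
  shows "\<exists>\<delta>. lifts N \<delta> D"
proof -
  define \<delta> where "\<delta> u = cls N (D (SOME p. p \<in> polys N \<and> cls N p = u))" for u
  have "\<delta> (cls N p) = cls N (D p)" if p: "p \<in> polys N" for p
  proof -
    define p' where "p' = (SOME p'. p' \<in> polys N \<and> cls N p' = cls N p)"
    have p': "p' \<in> polys N \<and> cls N p' = cls N p" unfolding p'_def by (rule someI[of _ p]) (simp add: p)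
    then have "p' - p \<in> qid N" using p c.ker by blast
    then have "D (p + (p' - p)) - (D p + D (p' - p)) + D (p' - p) \<in> qid N"
      using p p' by (intro q.add linear_mod_addD[OF c] linear_mod_idealD[OF c]) auto
    then have "cls N (D p') = cls N (D p)" using linear_mod_polys[OF c] p p' by (simp add: c.ker)
    then show ?thesis by (simp add: \<delta>_def p'_def)
  qed
  then show ?thesis using linear_mod_polys[OF c] unfolding lifts_def by blast
qed

text \<open>The operators have order at most n - 1, hence the argument of \<open>div\<close>; for n
  >= 1 the resulting exponent is n/2 rounded up. By truncation, n = 0 gives the same as n =
  1.\<close>

lemma diff_power_eq:
  assumes "N \<ge> 3"
  shows "diff_power ring_of_type_algebra (qring N) (irrelevant_ideal N (qid N :: 'k::field_char_0 mpoly set)) n =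
    cls N ` filt N (Suc ((n - 1) div 2))"
proof -
  have m: "cls N d \<in> irrelevant_ideal N (qid N) \<longleftrightarrow> lookup d 0 = 0" if "d \<in> polys N" for d :: "'k mpoly"
    unfolding irrelevant_ideal_eq using that
    by (subst c.h_mem_image) (auto simp: f.poly_ideal_axioms filt_1)
  have "cls N p \<in> diff_power ring_of_type_algebra (qring N) (irrelevant_ideal N (qid N)) n \<longleftrightarrow>
      p \<in> filt N (Suc ((n - 1) div 2))" if p: "p \<in> polys N" for p :: "'k mpoly"
  proof -
    have "(\<forall>\<delta>\<in>diff_ops ring_of_type_algebra (qring N) (n - 1). \<delta> (cls N p) \<in> irrelevant_ideal N (qid N)) \<longleftrightarrow>
      (\<forall>D. dop N (qid N) (Suc (n - 1)) D \<longrightarrow> lookup (D p) 0 = 0)"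
    proof (intro iffI ballI allI impI)
      fix D :: "'k mpoly \<Rightarrow> 'k mpoly" assume *: "\<forall>\<delta>\<in>diff_ops ring_of_type_algebra (qring N) (n - 1). \<delta> (cls N p) \<in> irrelevant_ideal N (qid N)"
        and D: "dop N (qid N) (Suc (n - 1)) D"
      from exists_lifted[OF dop_linear_mod[OF D]] obtain \<delta> where \<delta>: "lifts N \<delta> D" ..
      with D diff_ops_iff_dop[OF \<delta>] * have "\<delta> (cls N p) \<in> irrelevant_ideal N (qid N)" by blast
      with \<delta> p m[of "D p"] show "lookup (D p) 0 = 0" by (simp add: lifts_def)
    next
      fix \<delta> :: "'k mpoly set \<Rightarrow> 'k mpoly set" assume *: "\<forall>D. dop N (qid N) (Suc (n - 1)) D \<longrightarrow> lookup (D p) 0 = 0"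
        and \<delta>: "\<delta> \<in> diff_ops ring_of_type_algebra (qring N) (n - 1)"
      from exists_lift[OF \<delta>] obtain D where D: "lifts N \<delta> D" ..
      with \<delta> diff_ops_iff_dop[OF D] * have "lookup (D p) 0 = 0" by blast
      with D p m[of "D p"] show "\<delta> (cls N p) \<in> irrelevant_ideal N (qid N)" by (simp add: lifts_def)
    qed
    then show ?thesis
      using p unfolding filt_eq_dop[OF assms, symmetric] diff_power_def by (auto simp: carrier_qring)
  qed
  moreover have "diff_power ring_of_type_algebra (qring N) (irrelevant_ideal N (qid N)) n \<subseteq> cls N ` polys N"
    by (auto simp: diff_power_def carrier_qring)
  ultimately show ?thesis using f.subset by blast
qed

section \<open>Chains of submodules and of primes as chains of polynomial ideals\<close>

lemma module_length_eq:
  fixes W :: "'k::field_char_0 mpoly set"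
  assumes "poly_ideal N W" "qid N \<subseteq> W"
  shows "module_length (qring N) (quotient_module (qring N) (cls N ` W)) =
    Sup {enat n | n. \<exists>U. (\<forall>i\<le>n. poly_ideal N (U i) \<and> W \<subseteq> U i) \<and> (\<forall>i<n. U i \<subset> U (Suc i))}"
proof -
  let ?M = "quotient_module (qring N) (cls N ` W)"
  interpret J: ideal "cls N ` W" "qring N" by (rule c.ideal_image[OF assms(1)])
  define h where "h p = cls N ` W +>\<^bsub>qring N\<^esub> cls N p" for p
  interpret h: surj_hom N W ?M h
    unfolding h_def quotient_module_def by (rule J.surj_homI[OF c.cring_S surj_hom_cls assms refl])
  have smult: "cls N p \<odot>\<^bsub>?M\<^esub> u = h p \<otimes>\<^bsub>?M\<^esub> u" for p u
    by (simp add: quotient_module_def h_def)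
  have sub: "submodule (h ` U) (qring N) ?M" if "poly_ideal N U" for U
  proof (intro submodule.intro submodule_axioms.intro h.subgroup_image that)
    fix a x assume "a \<in> carrier (qring N :: ('k, _) module)" "x \<in> h ` U"
    then obtain p p' where p: "p \<in> polys N" "a = cls N p" "p' \<in> U" "x = h p'" by (auto simp: carrier_qring)
    moreover then have "p' \<in> polys N" "p * p' \<in> U"
      using poly_ideal.subset[OF that] poly_ideal.mult[OF that] by auto
    ultimately show "a \<odot>\<^bsub>?M\<^esub> x \<in> h ` U" by (simp add: smult h.h_mult)
  qed
  have vim: "poly_ideal N {p \<in> polys N. h p \<in> V}" "W \<subseteq> {p \<in> polys N. h p \<in> V}"
      "h ` {p \<in> polys N. h p \<in> V} = V" if V: "submodule V (qring N) ?M" for V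
  proof -
    have "r \<otimes>\<^bsub>?M\<^esub> x \<in> V" if "r \<in> carrier ?M" "x \<in> V" for r x
    proof -
      from that h.surj obtain p where "p \<in> polys N" "r = h p" by blast
      then show ?thesis
        using submodule.smult_closed[OF V, of "cls N p" x] that by (simp add: smult c.h_closed)
    qed
    from h.vimage_ideal[OF submodule.axioms(1)[OF V] this]
    show "poly_ideal N {p \<in> polys N. h p \<in> V}" "W \<subseteq> {p \<in> polys N. h p \<in> V}"
      "h ` {p \<in> polys N. h p \<in> V} = V" by blast+
  qed
  have "(\<exists>V. (\<forall>i\<le>n. submodule (V i) (qring N) ?M) \<and> (\<forall>i<n. V i \<subset> V (Suc i))) \<longleftrightarrow>
      (\<exists>U. (\<forall>i\<le>n. poly_ideal N (U i) \<and> W \<subseteq> U i) \<and> (\<forall>i<n. U i \<subset> U (Suc i)))" for n :: nat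
  proof
    assume "\<exists>V. (\<forall>i\<le>n. submodule (V i) (qring N) ?M) \<and> (\<forall>i<n. V i \<subset> V (Suc i))"
    then obtain V where V: "\<And>i. i \<le> n \<Longrightarrow> submodule (V i) (qring N) ?M" "\<And>i. i < n \<Longrightarrow> V i \<subset> V (Suc i)" by blast
    have "{p \<in> polys N. h p \<in> V i} \<subset> {p \<in> polys N. h p \<in> V (Suc i)}" if "i < n" for i
    proof -
      \<comment> \<open>Equal preimages would have equal images under the surjection, so strictness
        survives.\<close>
      have "h ` {p \<in> polys N. h p \<in> V i} \<noteq> h ` {p \<in> polys N. h p \<in> V (Suc i)}"
        using vim(3)[OF V(1)[of i]] vim(3)[OF V(1)[of "Suc i"]] V(2)[OF that] that by simp
      then show ?thesis using V(2)[OF that] by blast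
    qed
    with vim(1,2)[OF V(1)]
    show "\<exists>U. (\<forall>i\<le>n. poly_ideal N (U i) \<and> W \<subseteq> U i) \<and> (\<forall>i<n. U i \<subset> U (Suc i))"
      by (intro exI[of _ "\<lambda>i. {p \<in> polys N. h p \<in> V i}"]) blast
  next
    assume "\<exists>U. (\<forall>i\<le>n. poly_ideal N (U i) \<and> W \<subseteq> U i) \<and> (\<forall>i<n. U i \<subset> U (Suc i))"
    then obtain U where U: "\<And>i. i \<le> n \<Longrightarrow> poly_ideal N (U i)" "\<And>i. i \<le> n \<Longrightarrow> W \<subseteq> U i"
      "\<And>i. i < n \<Longrightarrow> U i \<subset> U (Suc i)" by blast
    have "h ` U i \<subset> h ` U (Suc i)" if i: "i < n" for i
    proof -
      from U(3)[OF i] obtain p where p: "p \<in> U (Suc i)" "p \<notin> U i" by blast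
      moreover have "p \<in> polys N" using p(1) poly_ideal.subset[OF U(1)[of "Suc i"]] i by auto
      ultimately have "h p \<notin> h ` U i" using h.h_mem_image[OF U(1,2)] i by auto
      then show ?thesis using U(3)[OF i] p by blast
    qed
    then show "\<exists>V. (\<forall>i\<le>n. submodule (V i) (qring N) ?M) \<and> (\<forall>i<n. V i \<subset> V (Suc i))"
      using sub U(1) by (intro exI[of _ "\<lambda>i. h ` U i"]) blast
  qed
  then show ?thesis by (simp add: module_length_def)
qed

definition prime_poly_ideal :: "nat \<Rightarrow> 'k::field_char_0 mpoly set \<Rightarrow> bool" where
  "prime_poly_ideal N U \<longleftrightarrow> poly_ideal N U \<and> qid N \<subseteq> U \<and> 1 \<notin> U \<and>
     (\<forall>p\<in>polys N. \<forall>p'\<in>polys N. p * p' \<in> U \<longrightarrow> p \<in> U \<or> p' \<in> U)"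

lemma krull_dim_qring:
  "krull_dim (qring N :: ('k::field_char_0, _) module) =
     Sup {enat n | n. \<exists>U :: nat \<Rightarrow> 'k mpoly set. (\<forall>i\<le>n. prime_poly_ideal N (U i)) \<and> (\<forall>i<n. U i \<subset> U (Suc i))}"
proof -
  have img: "primeideal (cls N ` U) (qring N)" if U: "prime_poly_ideal N U" for U :: "'k mpoly set"
  proof (rule primeidealI)
    have UI: "poly_ideal N U" "qid N \<subseteq> U" using U by (auto simp: prime_poly_ideal_def)
    note mem = c.h_mem_image[OF UI]
    show "ideal (cls N ` U) (qring N)" by (rule c.ideal_image[OF UI(1)])
    show "cring (qring N :: ('k, _) module)" by (rule c.cring_S)
    show "carrier (qring N) \<noteq> cls N ` U"
    proof
      assume "carrier (qring N) = cls N ` U"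
      then have "cls N (1 :: 'k mpoly) \<in> cls N ` U" using c.h_closed[OF polys_1, of N] by blast
      with mem[of 1] U show False by (simp add: prime_poly_ideal_def)
    qed
    fix a b :: "'k mpoly set" assume ab: "a \<in> carrier (qring N)" "b \<in> carrier (qring N)" "a \<otimes>\<^bsub>qring N\<^esub> b \<in> cls N ` U"
    then obtain p p' where p: "p \<in> polys N" "p' \<in> polys N" "a = cls N p" "b = cls N p'"
      by (auto simp: carrier_qring)
    with ab(3) have "p * p' \<in> U" using mem[of "p * p'"] by (simp add: c.h_mult)
    with U p(1,2) have "p \<in> U \<or> p' \<in> U" unfolding prime_poly_ideal_def by blast
    then show "a \<in> cls N ` U \<or> b \<in> cls N ` U" using p(3,4) by blast
  qed
  have vim: "prime_poly_ideal N {p \<in> polys N. cls N p \<in> P}" "cls N ` {p \<in> polys N. cls N p \<in> P} = P"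
    if "primeideal P (qring N)" for P :: "'k mpoly set set"
  proof -
    interpret P: primeideal P "qring N" by fact
    have P: "subgroup P (add_monoid (qring N))" by (rule P.a_subgroup)
    note v = c.vimage_ideal[OF P P.I_l_closed]
    show "cls N ` {p \<in> polys N. cls N p \<in> P} = P" by (rule v(3))
    have "cls N 1 \<notin> P" using P.one_imp_carrier P.I_notcarr by (auto simp: c.h_one)
    moreover have "p \<in> {p \<in> polys N. cls N p \<in> P} \<or> p' \<in> {p \<in> polys N. cls N p \<in> P}"
      if "p \<in> polys N" "p' \<in> polys N" "p * p' \<in> {p \<in> polys N. cls N p \<in> P}" for p p'
      using P.I_prime[of "cls N p" "cls N p'"] that by (simp add: c.h_mult c.h_closed)
    ultimately show "prime_poly_ideal N {p \<in> polys N. cls N p \<in> P}"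
      unfolding prime_poly_ideal_def using v(1,2) by blast
  qed
  have "(\<exists>P :: nat \<Rightarrow> 'k mpoly set set. (\<forall>i\<le>n. primeideal (P i) (qring N)) \<and> (\<forall>i<n. P i \<subset> P (Suc i))) \<longleftrightarrow>
      (\<exists>U :: nat \<Rightarrow> 'k mpoly set. (\<forall>i\<le>n. prime_poly_ideal N (U i)) \<and> (\<forall>i<n. U i \<subset> U (Suc i)))" for n :: nat
  proof
    assume "\<exists>P :: nat \<Rightarrow> 'k mpoly set set. (\<forall>i\<le>n. primeideal (P i) (qring N)) \<and> (\<forall>i<n. P i \<subset> P (Suc i))"
    then obtain P :: "nat \<Rightarrow> 'k mpoly set set"
      where P: "\<And>i. i \<le> n \<Longrightarrow> primeideal (P i) (qring N)" "\<And>i. i < n \<Longrightarrow> P i \<subset> P (Suc i)" by blast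
    have "{p \<in> polys N. cls N p \<in> P i} \<subset> {p \<in> polys N. cls N p \<in> P (Suc i)}" if "i < n" for i
    proof -
      have "cls N ` {p \<in> polys N. cls N p \<in> P i} \<noteq> cls N ` {p \<in> polys N. cls N p \<in> P (Suc i)}"
        using vim(2)[OF P(1)[of i]] vim(2)[OF P(1)[of "Suc i"]] P(2)[OF that] that by simp
      then show ?thesis using P(2)[OF that] by blast
    qed
    with vim(1)[OF P(1)]
    show "\<exists>U :: nat \<Rightarrow> 'k mpoly set. (\<forall>i\<le>n. prime_poly_ideal N (U i)) \<and> (\<forall>i<n. U i \<subset> U (Suc i))"
      by (intro exI[of _ "\<lambda>i. {p \<in> polys N. cls N p \<in> P i}"]) blast
  next
    assume "\<exists>U :: nat \<Rightarrow> 'k mpoly set. (\<forall>i\<le>n. prime_poly_ideal N (U i)) \<and> (\<forall>i<n. U i \<subset> U (Suc i))"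
    then obtain U :: "nat \<Rightarrow> 'k mpoly set"
      where U: "\<And>i. i \<le> n \<Longrightarrow> prime_poly_ideal N (U i)" "\<And>i. i < n \<Longrightarrow> U i \<subset> U (Suc i)" by blast
    have "cls N ` U i \<subset> cls N ` U (Suc i)" if i: "i < n" for i
    proof -
      from U(2)[OF i] obtain p where p: "p \<in> U (Suc i)" "p \<notin> U i" by blast
      have "poly_ideal N (U (Suc i))" "poly_ideal N (U i)" "qid N \<subseteq> U i"
        using U(1)[of "Suc i"] U(1)[of i] i by (auto simp: prime_poly_ideal_def)
      with p have "cls N p \<notin> cls N ` U i" using c.h_mem_image[of N "U i" p] poly_ideal.subset by blast
      then show ?thesis using U(2)[OF i] p by blast
    qed
    then show "\<exists>P :: nat \<Rightarrow> 'k mpoly set set. (\<forall>i\<le>n. primeideal (P i) (qring N)) \<and> (\<forall>i<n. P i \<subset> P (Suc i))"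
      using img U(1) by (intro exI[of _ "\<lambda>i. cls N ` U i"]) blast
  qed
  then show ?thesis by (simp add: krull_dim_def)
qed

section \<open>Length\<close>

text \<open>Gives access to the bound on independent sets by spanning sets over K.\<close>

interpretation V: vector_space "\<lambda>(c::'k::field_char_0) (p::'k mpoly). mpoly_const c * p"
  by unfold_locales (simp_all add: mpoly_const_add mpoly_const_mult algebra_simps)

lemma keys_const_mult: "keys (mpoly_const c * p) \<subseteq> keys p"
  by (auto simp: in_keys_iff lookup_const_mult)

lemma span_single: "V.span ((\<lambda>m. single m (1 :: 'k::field_char_0)) ` A) = {p. keys p \<subseteq> A}"
proof
  have "V.subspace {p :: 'k mpoly. keys p \<subseteq> A}"
  proof (rule V.subspaceI)
    show "x + y \<in> {p. keys p \<subseteq> A}" if "x \<in> {p. keys p \<subseteq> A}" "y \<in> {p. keys p \<subseteq> A}" for x y :: "'k mpoly"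
      using Poly_Mapping.keys_add[of x y] that by blast
    show "mpoly_const c * x \<in> {p. keys p \<subseteq> A}" if "x \<in> {p. keys p \<subseteq> A}" for c and x :: "'k mpoly"
      using keys_const_mult[of c x] that by blast
  qed simp
  then show "V.span ((\<lambda>m. single m (1 :: 'k)) ` A) \<subseteq> {p. keys p \<subseteq> A}"
    by (intro V.span_minimal) auto
  show "{p. keys p \<subseteq> A} \<subseteq> V.span ((\<lambda>m. single m (1 :: 'k)) ` A)"
  proof
    fix p :: "'k mpoly" assume "p \<in> {p. keys p \<subseteq> A}"
    then have "\<forall>m\<in>keys p. m \<in> A" by auto
    then show "p \<in> V.span ((\<lambda>m. single m (1 :: 'k)) ` A)"
    proof (induction rule: mpoly_induct_keys)
      case (single m c)
      then have "mpoly_const c * single m 1 \<in> V.span ((\<lambda>m. single m (1 :: 'k)) ` A)"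
        by (intro V.span_scale V.span_base) auto
      then show ?case by (simp add: const_mult_single)
    qed (auto intro: V.span_zero V.span_add)
  qed
qed

lemma independent_card_le:
  assumes "finite A" "V.independent S" "\<And>p. p \<in> S \<Longrightarrow> keys p \<subseteq> A"
  shows "finite S \<and> card S \<le> card A"
proof -
  let ?X = "(\<lambda>m. single m (1 :: 'a)) ` A"
  have "finite S \<and> card S \<le> card ?X"
    using assms by (intro V.independent_span_bound) (auto simp: span_single)
  moreover have "card ?X \<le> card A" using assms(1) by (rule card_image_le)
  ultimately show ?thesis by auto
qed

section \<open>Counting monomials\<close>

definition monomials :: "nat set \<Rightarrow> nat \<Rightarrow> (nat \<Rightarrow>\<^sub>0 nat) set" where
  "monomials A t = {m. keys m \<subseteq> A \<and> mdeg m \<le> t}"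

lemma add_single_cancel: "k \<le> lookup m i \<Longrightarrow> m - single i k + single i k = (m :: nat \<Rightarrow>\<^sub>0 nat)"
  by (intro poly_mapping_eqI) (auto simp: lookup_add lookup_minus lookup_single when_def)

text \<open>The Pascal rule: a monomial either avoids x_a or is x_a times another one.\<close>

lemma monomials_insert_Suc:
  assumes "a \<notin> A"
  shows "monomials (insert a A) (Suc t) = monomials A (Suc t) \<union> (\<lambda>m. m + single a 1) ` monomials (insert a A) t"
    and "monomials A (Suc t) \<inter> (\<lambda>m. m + single a 1) ` monomials (insert a A) t = {}"
proof
  show "monomials (insert a A) (Suc t) \<subseteq> monomials A (Suc t) \<union> (\<lambda>m. m + single a 1) ` monomials (insert a A) t"
  proof
    fix m assume m: "m \<in> monomials (insert a A) (Suc t)"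
    show "m \<in> monomials A (Suc t) \<union> (\<lambda>m. m + single a 1) ` monomials (insert a A) t"
    proof (cases "a \<in> keys m")
      case True
      have "m - single a 1 \<in> monomials (insert a A) t"
        using m single_factor(2,3)[OF True] by (auto simp: monomials_def)
      moreover have "m = m - single a 1 + single a 1"
        using True by (subst add_single_cancel) (auto simp: in_keys_iff)
      ultimately show ?thesis by blast
    qed (use m in \<open>auto simp: monomials_def\<close>)
  qed
  show "monomials A (Suc t) \<union> (\<lambda>m. m + single a 1) ` monomials (insert a A) t \<subseteq> monomials (insert a A) (Suc t)"
    by (auto simp: monomials_def keys_add' mdeg_add)
  show "monomials A (Suc t) \<inter> (\<lambda>m. m + single a 1) ` monomials (insert a A) t = {}"
    using assms by (auto simp: monomials_def keys_add')
qed

lemma card_monomials: "finite A \<Longrightarrow> finite (monomials A t) \<and> card (monomials A t) = (t + card A) choose card A"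
proof (induction A arbitrary: t rule: finite_induct)
  case empty
  have "monomials {} t = {0}" by (auto simp: monomials_def)
  then show ?case by simp
next
  case (insert a A)
  show ?case
  proof (induction t)
    case 0
    have "monomials (insert a A) 0 = {0}" by (auto simp: monomials_def mdeg_eq_0)
    then show ?case by simp
  next
    case (Suc t)
    have inj: "inj_on (\<lambda>m. m + single a 1) (monomials (insert a A) t)" by (auto intro: inj_onI)
    have "card (monomials (insert a A) (Suc t)) = card (monomials A (Suc t)) + card (monomials (insert a A) t)"
      unfolding monomials_insert_Suc(1)[OF insert(2)]
      using insert.IH[of "Suc t"] Suc.IH monomials_insert_Suc(2)[OF insert(2)] card_image[OF inj]
      by (subst card_Un_disjoint) auto
    then show ?case
      using insert Suc.IH monomials_insert_Suc(1)[OF insert(2), of t] by simp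
  qed
qed

text \<open>The bound on the exponent of variable 1 makes these the standard monomials for q with
  leading monomial x_1^2.\<close>

definition basis :: "nat \<Rightarrow> nat \<Rightarrow> (nat \<Rightarrow>\<^sub>0 nat) set" where
  "basis N c = {m. keys m \<subseteq> {1..N} \<and> lookup m 1 \<le> 1 \<and> mdeg m < c}"

lemma card_basis:
  assumes "d \<ge> 1"
  shows "finite (basis (d + 1) (Suc k))"
    and "card (basis (d + 1) (Suc k)) = ((k + d) choose d) + ((k + d - 1) choose d)"
proof -
  define A where "A = {2..d + 1}"
  have cA: "finite A" "card A = d" and A1: "1 \<notin> A" "{1..d + 1} = insert 1 A"
    by (auto simp: A_def)
  \<comment> \<open>The monomials with exponent one of x_1. For k = 0 there are none, whereas
    \<open>k - 1\<close> would truncate to 0 and still admit one.\<close>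
  define B where "B = (if k = 0 then {} else (\<lambda>m. m + single (1::nat) (1::nat)) ` monomials A (k - 1))"
  have eq: "basis (d + 1) (Suc k) = monomials A k \<union> B"
  proof
    show "basis (d + 1) (Suc k) \<subseteq> monomials A k \<union> B"
    proof
      fix m assume m: "m \<in> basis (d + 1) (Suc k)"
      show "m \<in> monomials A k \<union> B"
      proof (cases "1 \<in> keys m")
        case True
        have 1: "lookup m 1 = 1" using True m by (auto simp: basis_def in_keys_iff)
        have d: "mdeg m = Suc (mdeg (m - single 1 1))" using single_factor[OF True] by auto
        then have k: "k \<noteq> 0" "mdeg (m - single 1 1) \<le> k - 1" using m by (auto simp: basis_def)
        have "1 \<notin> keys (m - single 1 1)" using 1 by (simp add: in_keys_iff lookup_minus)
        then have "m - single 1 1 \<in> monomials A (k - 1)"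
          using m k single_factor(3)[OF True] A1 by (auto simp: basis_def monomials_def)
        moreover have "m = m - single 1 1 + single 1 1"
          using 1 by (subst add_single_cancel) auto
        ultimately have "m \<in> B" using k unfolding B_def by auto
        then show ?thesis ..
      qed (use m A1 in \<open>auto simp: basis_def monomials_def\<close>)
    qed
    have "lookup m 1 = 0" if "keys m \<subseteq> A" for m :: "nat \<Rightarrow>\<^sub>0 nat"
      using that A1(1) by (meson in_keys_iff subsetD)
    then show "monomials A k \<union> B \<subseteq> basis (d + 1) (Suc k)"
      unfolding basis_def A1(2) B_def monomials_def
      by (auto simp: keys_add' mdeg_add lookup_add split: if_splits)
  qed
  have disj: "monomials A k \<inter> B = {}"
    using A1(1) by (auto simp: B_def monomials_def keys_add' split: if_splits)
  have inj: "inj_on (\<lambda>m. m + single (1::nat) (1::nat)) (monomials A (k - 1))" by (auto intro: inj_onI)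
  have cB: "finite B \<and> card B = (k + d - 1) choose d"
  proof (cases "k = 0")
    case True
    then show ?thesis using assms by (simp add: B_def)
  next
    case False
    then have "k - 1 + d = k + d - 1" by simp
    then show ?thesis using card_monomials[OF cA(1), of "k - 1"] False card_image[OF inj] cA(2)
      by (simp add: B_def)
  qed
  show "finite (basis (d + 1) (Suc k))"
    unfolding eq using cB card_monomials[OF cA(1)] by simp
  show "card (basis (d + 1) (Suc k)) = ((k + d) choose d) + ((k + d - 1) choose d)"
    unfolding eq using cB card_monomials[OF cA(1), of k] cA(2) disj by (subst card_Un_disjoint) auto
qed

text \<open>Rewriting x_1^2 as minus the sum of the other squares lowers the exponent of x_1 by two.
  It preserves the degree, which \<open>graded_poly_ideal\<close> relies on.\<close>

lemma monomial_reduce: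
  assumes N: "N \<ge> 1" and m: "keys m \<subseteq> {1..N}"
  shows "\<exists>b :: 'k::field_char_0 mpoly.
     (\<forall>m'\<in>keys b. keys m' \<subseteq> {1..N} \<and> lookup m' 1 \<le> 1 \<and> mdeg m' = mdeg m) \<and> single m 1 - b \<in> qid N"
  using m
proof (induction "lookup m 1" arbitrary: m rule: less_induct)
  case less
  show ?case
  proof (cases "lookup m 1 \<le> 1")
    case True
    then show ?thesis using less.prems by (intro exI[of _ "single m 1"]) auto
  next
    case False
    define m0 where "m0 = m - single 1 2"
    have m: "m = m0 + single 1 2" using False by (simp add: m0_def add_single_cancel)
    have m0: "keys m0 \<subseteq> {1..N}" using less.prems by (auto simp: m0_def in_keys_iff lookup_minus)
    let ?m = "\<lambda>i. m0 + single i 2"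
    have var: "mpoly_var i ^ 2 * single m0 1 = single (?m i) (1 :: 'k)" for i
    proof -
      have "single i (1::nat) + single i 1 = single i 2"
        by (simp add: single_add[symmetric] numeral_2_eq_2)
      then show ?thesis
        by (simp add: mpoly_var_def power2_eq_square mult_single add.commute)
    qed
    have "\<exists>b :: 'k mpoly. (\<forall>m'\<in>keys b. keys m' \<subseteq> {1..N} \<and> lookup m' 1 \<le> 1 \<and> mdeg m' = mdeg m) \<and>
        single (?m i) 1 - b \<in> qid N" if i: "i \<in> {2..N}" for i
    proof -
      have "lookup (?m i) 1 < lookup m 1" using i by (subst m) (simp add: lookup_add lookup_single)
      moreover have "keys (?m i) \<subseteq> {1..N}" using m0 i by (auto simp: keys_add')
      moreover have "mdeg (?m i) = mdeg m" by (subst m) (simp add: mdeg_add)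
      ultimately show ?thesis using less.hyps[of "?m i"] by simp
    qed
    then obtain b :: "nat \<Rightarrow> 'k mpoly" where
      b: "\<And>i m'. i \<in> {2..N} \<Longrightarrow> m' \<in> keys (b i) \<Longrightarrow> keys m' \<subseteq> {1..N} \<and> lookup m' 1 \<le> 1 \<and> mdeg m' = mdeg m"
      "\<And>i. i \<in> {2..N} \<Longrightarrow> single (?m i) 1 - b i \<in> qid N" by metis
    define b' where "b' = - (\<Sum>i=2..N. b i)"
    have "keys b' \<subseteq> (\<Union>i\<in>{2..N}. keys (b i))"
      using Poly_Mapping.keys_sum[of b "{2..N}"] by (simp add: b'_def)
    moreover have "single m 1 - b' \<in> qid N"
    proof -
      have I: "{1..N} = insert 1 {2..N}" using N by auto
      have "quad N * single m0 1 = (\<Sum>i=1..N. single (?m i) (1 :: 'k))"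
        by (simp only: quad_def sum_distrib_right var)
      also have "\<dots> = single m 1 + (\<Sum>i=2..N. single (?m i) 1)"
        unfolding I by (subst sum.insert) (auto simp: m)
      finally have "single m 1 - b' = quad N * single m0 1 - (\<Sum>i=2..N. single (?m i) 1 - b i)"
        by (simp add: b'_def sum_subtractf)
      also have "\<dots> \<in> qid N"
        by (rule q.diff[OF quad_mult_qid[OF polys_single[OF m0]] q.sum[OF b(2)]])
      finally show ?thesis .
    qed
    ultimately show ?thesis using b(1) by (intro exI[of _ b']) blast
  qed
qed

lemma reduce:
  fixes p :: "'k::field_char_0 mpoly"
  assumes N: "N \<ge> 1" and p: "\<forall>m\<in>keys p. keys m \<subseteq> {1..N} \<and> mdeg m < c"
  shows "\<exists>b. keys b \<subseteq> basis N c \<and> p - b \<in> qid N"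
  using p
proof (induction rule: mpoly_induct_keys)
  case (single m a)
  then obtain b :: "'k mpoly" where b: "\<forall>m'\<in>keys b. keys m' \<subseteq> {1..N} \<and> lookup m' 1 \<le> 1 \<and> mdeg m' = mdeg m"
    and r: "single m 1 - b \<in> qid N" using monomial_reduce[OF N, of m] by blast
  have "mpoly_const a * (single m 1 - b) \<in> qid N" using r by (rule q.mult[OF polys_const])
  then have "single m a - mpoly_const a * b \<in> qid N" by (simp add: right_diff_distrib const_mult_single)
  moreover have "keys (mpoly_const a * b) \<subseteq> basis N c"
    using keys_const_mult[of a b] b single by (auto simp: basis_def)
  ultimately show ?case by blast
next
  case zero
  show ?case by (intro exI[of _ 0]) simp
next
  case (add p p')
  then obtain b b' where "keys b \<subseteq> basis N c" "p - b \<in> qid N" "keys b' \<subseteq> basis N c" "p' - b' \<in> qid N" by blast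
  then have "keys (b + b') \<subseteq> basis N c" "(p - b) + (p' - b') \<in> qid N"
    using Poly_Mapping.keys_add[of b b'] by (blast, intro q.add)
  then show ?case by (intro exI[of _ "b + b'"]) (simp add: algebra_simps)
qed

lemma truncate:
  assumes "p \<in> polys N"
  obtains p' where "\<forall>m\<in>keys p'. keys m \<subseteq> {1..N} \<and> mdeg m < c" "p - p' \<in> order_ge c"
proof -
  define p1 where "p1 = (\<Sum>m\<in>{m\<in>keys p. mdeg m < c}. single m (lookup p m))"
  define p2 where "p2 = (\<Sum>m\<in>keys p - {m\<in>keys p. mdeg m < c}. single m (lookup p m))"
  have "(\<Sum>m\<in>keys p. single m (lookup p m)) = p2 + p1" unfolding p1_def p2_def
    by (rule sum.subset_diff) auto
  then have "p = p1 + p2" using mpoly_eq_sum[of p] by (simp add: add.commute)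
  moreover have "p2 \<in> order_ge c" unfolding p2_def by (intro order_ge_sum order_ge_single) auto
  moreover have "keys p1 \<subseteq> {m\<in>keys p. mdeg m < c}"
    unfolding p1_def by (rule order_trans[OF Poly_Mapping.keys_sum]) (auto split: if_splits)
  moreover from this have "\<forall>m\<in>keys p1. keys m \<subseteq> {1..N} \<and> mdeg m < c"
    using assms unfolding polys_def by blast
  ultimately show thesis using that[of p1] by simp
qed

lemma reduce_filt:
  assumes N: "N \<ge> 1" and p: "p \<in> polys N"
  shows "\<exists>b. keys b \<subseteq> basis N c \<and> p - b \<in> filt N c"
proof -
  obtain p' where p': "\<forall>m\<in>keys p'. keys m \<subseteq> {1..N} \<and> mdeg m < c" "p - p' \<in> order_ge c"
    using truncate[OF p] .
  obtain b where b: "keys b \<subseteq> basis N c" "p' - b \<in> qid N" using reduce[OF N p'(1)] by blast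
  have "p' \<in> polys N" using p' by (auto simp: polys_def)
  then have "(p - p') + (p' - b) \<in> filt N c" using p' p b by (intro f.add) auto
  then show ?thesis using b by auto
qed

lemma lookup_single_mult: "lookup (single a 1 * p) (a + m) = lookup (p :: 'k::comm_ring_1 mpoly) m"
proof (induction p rule: mpoly_induct)
  case (single m' c)
  show ?case by (auto simp: mult_single lookup_single when_def)
qed (simp add: distrib_left lookup_add)

lemma lookup_var_sq_mult:
  "lookup (mpoly_var i ^ 2 * p) m = (if 2 \<le> lookup m i then lookup (p :: 'k::comm_ring_1 mpoly) (m - single i 2) else 0)"
proof -
  have "single i (1::nat) + single i 1 = single i 2"
    by (simp add: single_add[symmetric] numeral_2_eq_2)
  then have v: "mpoly_var i ^ 2 = single (single i 2) (1 :: 'k)"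
    by (simp add: mpoly_var_def power2_eq_square mult_single)
  show ?thesis
  proof (cases "2 \<le> lookup m i")
    case True
    then have "m = single i 2 + (m - single i 2)" using add_single_cancel[of 2 m i] by (simp add: add.commute)
    then show ?thesis using True lookup_single_mult[of "single i 2" p "m - single i 2"] by (simp add: v)
  next
    case False
    have "m \<notin> keys (mpoly_var i ^ 2 * p)"
    proof
      assume "m \<in> keys (mpoly_var i ^ 2 * p)"
      then obtain a b where "a \<in> keys (mpoly_var i ^ 2 :: 'k mpoly)" "m = a + b" by (rule keys_mult_cases)
      then show False using False by (auto simp: v lookup_add lookup_single split: if_splits)
    qed
    then show ?thesis using False by (simp add: in_keys_iff)
  qed
qed

text \<open>In a multiple \<open>h q\<close>, the monomials of \<open>h\<close> with maximal exponent of \<open>x\<^sub>1\<close> contribute monomials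
  divisible by \<open>x\<^sub>1\<^sup>2\<close> that do not cancel.\<close>

lemma basis_independent:
  assumes N: "N \<ge> 1" and b: "keys b \<subseteq> basis N c" and f: "b \<in> filt N c"
  shows "b = (0 :: 'k::field_char_0 mpoly)"
proof -
  from f obtain u where u: "u \<in> order_ge c" "b - u \<in> qid N" by (rule filtE)
  then obtain h where h: "b - u = h * quad N" by (auto simp: qid_def)
  have "c \<le> mdeg m + 2" if "m \<in> keys h" for m
  proof (rule ccontr)
    assume "\<not> c \<le> mdeg m + 2"
    \<comment> \<open>Only monomials of h whose products with q stay below degree c are considered,
      because u has no monomials there.\<close>
    define A where "A = {m\<in>keys h. mdeg m + 2 < c}"
    have "finite A" "A \<noteq> {}" using that \<open>\<not> c \<le> mdeg m + 2\<close> by (auto simp: A_def)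
    then obtain m where m: "m \<in> A" "\<And>m'. m' \<in> A \<Longrightarrow> lookup m' 1 \<le> lookup m 1"
    proof -
      have "Max ((\<lambda>m. lookup m 1) ` A) \<in> (\<lambda>m. lookup m 1) ` A"
        using \<open>finite A\<close> \<open>A \<noteq> {}\<close> by (intro Max_in) auto
      then obtain m where "m \<in> A" "lookup m 1 = Max ((\<lambda>m. lookup m 1) ` A)" by auto
      then show ?thesis using that[of m] \<open>finite A\<close> by simp
    qed
    define M where "M = m + single 1 2"
    have M: "mdeg M < c" "lookup M 1 \<ge> 2" using m(1) by (auto simp: M_def A_def mdeg_add lookup_add)
    have "lookup (h * quad N) M = (\<Sum>i=1..N. lookup (mpoly_var i ^ 2 * h) M)"
      by (simp add: quad_def sum_distrib_left lookup_sum mult.commute)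
    also have "\<dots> = (\<Sum>i=1..N. if i = 1 then lookup h m else 0)"
    proof (rule sum.cong)
      fix i assume "i \<in> {1..N}"
      show "lookup (mpoly_var i ^ 2 * h) M = (if i = 1 then lookup h m else 0)"
      proof (cases "i = 1")
        case True
        then show ?thesis using M(2) by (simp add: lookup_var_sq_mult M_def)
      next
        case i: False
        have "lookup h (M - single i 2) = 0" if "2 \<le> lookup M i"
        proof (rule ccontr)
          assume "lookup h (M - single i 2) \<noteq> 0"
          moreover have "M = M - single i 2 + single i 2" using that by (simp add: add_single_cancel)
          then have "mdeg M = mdeg (M - single i 2) + 2" by (metis mdeg_add mdeg_single)
          ultimately have "M - single i 2 \<in> A" using M(1) by (auto simp: A_def in_keys_iff)
          from m(2)[OF this] show False using i by (simp add: M_def lookup_add lookup_minus lookup_single)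
        qed
        then show ?thesis using i by (simp add: lookup_var_sq_mult)
      qed
    qed simp
    also have "\<dots> = lookup h m" using N by simp
    finally have "lookup (b - u) M \<noteq> 0" using m(1) by (simp add: h A_def in_keys_iff)
    moreover have "M \<notin> keys u" using u(1) M(1) by (force simp: order_ge_def)
    then have "lookup u M = 0" by (simp add: in_keys_iff)
    moreover have "lookup b M = 0" using b M(2) by (auto simp: basis_def in_keys_iff)
    ultimately show False by (simp add: lookup_minus)
  qed
  then have "h \<in> order_ge (c - 2)" by (simp add: order_ge_def le_diff_conv)
  then have "h * quad N \<in> order_ge c"
    by (intro order_ge_anti[OF _ order_ge_mult[OF _ quad_order_ge]]) auto
  then have "b - u + u \<in> order_ge c" using u(1) unfolding h by (rule order_ge_add)
  then have "b \<in> order_ge c" by simp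
  with b have "keys b = {}" by (fastforce simp: basis_def order_ge_def)
  then show ?thesis by (metis keys_eq_empty)
qed

section \<open>Chains of ideals above a level of the filtration\<close>

lemma poly_ideal_subspace: "poly_ideal N U \<Longrightarrow> V.subspace U"
  by (rule V.subspaceI) (auto simp: poly_ideal.zero poly_ideal.add poly_ideal.mult)

text \<open>Each strict inclusion is witnessed by a combination of basis monomials in U_(i+1) but
  not in U_i. The earlier witnesses span a subspace of U_i, so all witnesses are linearly
  independent.\<close>

lemma chain_length_le:
  fixes U :: "nat \<Rightarrow> 'k::field_char_0 mpoly set"
  assumes N: "N \<ge> 1" and fin: "finite (basis N c)"
    and U: "\<And>i. i \<le> n \<Longrightarrow> poly_ideal N (U i)" "\<And>i. i \<le> n \<Longrightarrow> filt N c \<subseteq> U i"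
    and strict: "\<And>i. i < n \<Longrightarrow> U i \<subset> U (Suc i)"
  shows "n \<le> card (basis N c)"
proof -
  have "\<exists>b. keys b \<subseteq> basis N c \<and> b \<in> U (Suc i) \<and> b \<notin> U i" if i: "i < n" for i
  proof -
    interpret Ui: poly_ideal N "U i" using U(1)[of i] i by simp
    interpret Us: poly_ideal N "U (Suc i)" using U(1)[of "Suc i"] i by simp
    from strict[OF i] obtain p where p: "p \<in> U (Suc i)" "p \<notin> U i" by blast
    obtain b where b: "keys b \<subseteq> basis N c" "p - b \<in> filt N c"
      using reduce_filt[OF N] p(1) Us.subset by blast
    then have "p - b \<in> U (Suc i)" "p - b \<in> U i" using U(2)[of i] U(2)[of "Suc i"] i by auto
    then have "b \<in> U (Suc i)" "b \<notin> U i" using p Us.diff[of p "p - b"] Ui.diff_mem[of p b] by auto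
    with b(1) show ?thesis by blast
  qed
  then obtain b where b: "\<And>i. i < n \<Longrightarrow> keys (b i) \<subseteq> basis N c"
     "\<And>i. i < n \<Longrightarrow> b i \<in> U (Suc i)" "\<And>i. i < n \<Longrightarrow> b i \<notin> U i" by metis
  have "V.independent (b ` {..<k}) \<and> b ` {..<k} \<subseteq> U k \<and> card (b ` {..<k}) = k" if "k \<le> n" for k
    using that
  proof (induction k)
    case 0
    show ?case by (simp add: V.independent_empty)
  next
    case (Suc k)
    then have IH: "V.independent (b ` {..<k})" "b ` {..<k} \<subseteq> U k" "card (b ` {..<k}) = k" by auto
    have "V.span (b ` {..<k}) \<subseteq> U k"
      using IH(2) U(1)[of k] Suc.prems by (intro V.span_minimal poly_ideal_subspace) auto
    then have nin: "b k \<notin> V.span (b ` {..<k})" using b(3)[of k] Suc.prems by auto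
    then have "b k \<notin> b ` {..<k}" using V.span_base[of "b k" "b ` {..<k}"] by blast
    then show ?case
    proof (intro conjI)
      show "V.independent (b ` {..<Suc k})"
        using V.independent_insertI[OF nin IH(1)] by (simp add: lessThan_Suc)
      have "U k \<subset> U (Suc k)" "b k \<in> U (Suc k)" using strict[of k] b(2)[of k] Suc.prems by simp_all
      then show "b ` {..<Suc k} \<subseteq> U (Suc k)" using IH(2) unfolding lessThan_Suc by blast
      show "card (b ` {..<Suc k}) = Suc k" using \<open>b k \<notin> b ` {..<k}\<close> IH(3) by (simp add: lessThan_Suc)
    qed
  qed
  from this[of n] independent_card_le[OF fin, of "b ` {..<n}"] b(1) show ?thesis by auto
qed

text \<open>Sets of basis monomials that are closed under passing to higher degrees span submodules.\<close>

lemma exists_degree_filtration: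
  assumes "finite (B :: (nat \<Rightarrow>\<^sub>0 nat) set)"
  shows "\<exists>A. A 0 = {} \<and> A (card B) = B \<and> (\<forall>j<card B. A j \<subset> A (Suc j)) \<and>
     (\<forall>j\<le>card B. A j \<subseteq> B \<and> (\<forall>m\<in>A j. \<forall>m'\<in>B. mdeg m < mdeg m' \<longrightarrow> m' \<in> A j))"
  using assms
proof (induction "card B" arbitrary: B)
  case 0
  then show ?case by (intro exI[of _ "\<lambda>_. {}"]) auto
next
  case (Suc k)
  then have "B \<noteq> {}" by auto
  \<comment> \<open>A monomial of least degree joins last, since the closure condition never forces
    it into an earlier set.\<close>
  then obtain m where m: "m \<in> B" "\<And>m'. m' \<in> B \<Longrightarrow> mdeg m \<le> mdeg m'"
    using ex_has_least_nat[of "\<lambda>m. m \<in> B" _ mdeg] by blast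
  have k: "k = card (B - {m})" "card B = Suc k" using Suc.hyps(2) Suc.prems m(1) by auto
  obtain A where A: "A 0 = {}" "A k = B - {m}" "\<And>j. j < k \<Longrightarrow> A j \<subset> A (Suc j)"
     "\<And>j. j \<le> k \<Longrightarrow> A j \<subseteq> B - {m}"
     "\<And>j m1 m2. j \<le> k \<Longrightarrow> m1 \<in> A j \<Longrightarrow> m2 \<in> B - {m} \<Longrightarrow> mdeg m1 < mdeg m2 \<Longrightarrow> m2 \<in> A j"
    using Suc.hyps(1)[OF k(1)] Suc.prems unfolding k(1)[symmetric] by (metis finite_Diff)
  define A' where "A' j = (if j \<le> k then A j else B)" for j
  have 1: "A' j \<subset> A' (Suc j)" if "j < Suc k" for j
    using that A(2,3) m(1) by (cases "j = k") (auto simp: A'_def)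
  have 2: "A' j \<subseteq> B" for j using A(4)[of j] by (auto simp: A'_def)
  have 3: "m2 \<in> A' j" if "m1 \<in> A' j" "m2 \<in> B" "mdeg m1 < mdeg m2" for j m1 m2
  proof (cases "j \<le> k")
    case True
    then have "m1 \<in> A j" using that by (simp add: A'_def)
    moreover then have "m2 \<noteq> m" using m(2)[of m1] A(4)[OF True] that(3) by auto
    ultimately show ?thesis using A(5)[OF True] that True by (auto simp: A'_def)
  qed (use that in \<open>simp add: A'_def\<close>)
  show ?case unfolding k(2)
    by (intro exI[of _ A'] conjI allI impI ballI 1 2) (use A(1) 3 in \<open>auto simp: A'_def\<close>)
qed

text \<open>Multiplying by a nonconstant monomial raises the degree, and reduction keeps it. The
  product of such a monomial with one from A is therefore a combination of basis monomials of higher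
  degree, which lie in A by \<open>closed\<close>, or it falls into \<open>filt N c\<close>.\<close>

lemma graded_poly_ideal:
  fixes A :: "(nat \<Rightarrow>\<^sub>0 nat) set"
  assumes N: "N \<ge> 1" and A: "A \<subseteq> basis N c"
    and closed: "\<And>m m'. m \<in> A \<Longrightarrow> m' \<in> basis N c \<Longrightarrow> mdeg m < mdeg m' \<Longrightarrow> m' \<in> A"
  shows "poly_ideal N {p \<in> polys N. \<exists>b :: 'k::field_char_0 mpoly. keys b \<subseteq> A \<and> p - b \<in> filt N c}" (is "poly_ideal N ?U")
proof -
  have add: "p + p' \<in> ?U" if "p \<in> ?U" "p' \<in> ?U" for p p'
  proof -
    from that obtain b b' where "keys b \<subseteq> A" "keys b' \<subseteq> A" "p - b \<in> filt N c" "p' - b' \<in> filt N c" by blast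
    then have "keys (b + b') \<subseteq> A" "(p - b) + (p' - b') \<in> filt N c"
      using Poly_Mapping.keys_add[of b b'] by (blast, intro f.add)
    moreover have "(p - b) + (p' - b') = p + p' - (b + b')" by simp
    ultimately show ?thesis using that by auto
  qed
  have U0: "0 \<in> ?U" by (auto intro!: exI[of _ 0])
  have const: "mpoly_const a * p \<in> ?U" if p: "p \<in> ?U" for a p
  proof -
    from p obtain b where b: "keys b \<subseteq> A" "p - b \<in> filt N c" by blast
    then have "keys (mpoly_const a * b) \<subseteq> A" "mpoly_const a * (p - b) \<in> filt N c"
      using keys_const_mult[of a b] by (blast, intro f.mult polys_const)
    then show ?thesis using p by (auto simp: right_diff_distrib)
  qed
  have mono: "single (m + m') 1 \<in> ?U" if m: "keys m \<subseteq> {1..N}" "m' \<in> A" for m m'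
  proof (cases "m = 0")
    case True
    have "m' \<in> basis N c" using m A by blast
    then have "single m' 1 \<in> polys N" by (intro polys_single) (auto simp: basis_def)
    with True m show ?thesis by (auto intro!: exI[of _ "single m' 1"])
  next
    case False
    then have deg: "mdeg m' < mdeg (m + m')" by (simp add: mdeg_add mdeg_eq_0 zero_less_iff_neq_zero)
    have mm: "keys (m + m') \<subseteq> {1..N}" using that A by (auto simp: keys_add' basis_def)
    obtain b :: "'k mpoly" where b: "\<forall>m1\<in>keys b. keys m1 \<subseteq> {1..N} \<and> lookup m1 1 \<le> 1 \<and> mdeg m1 = mdeg (m + m')"
      and r: "single (m + m') 1 - b \<in> qid N" using monomial_reduce[OF N mm] by blast
    show ?thesis
    proof (cases "mdeg (m + m') < c")
      case True
      have "keys b \<subseteq> A"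
      proof
        fix m1 assume "m1 \<in> keys b"
        then have "m1 \<in> basis N c" "mdeg m' < mdeg m1" using b True deg by (auto simp: basis_def)
        then show "m1 \<in> A" using closed that by blast
      qed
      then show ?thesis using r mm by (auto intro!: polys_single)
    next
      case False
      then have "single (m + m') 1 \<in> filt N c" using mm by (intro order_ge_filt polys_single order_ge_single) auto
      then show ?thesis using mm by (auto intro!: polys_single exI[of _ 0])
    qed
  qed
  have mult_b: "single m 1 * b \<in> ?U" if m: "keys m \<subseteq> {1..N}" and b: "keys b \<subseteq> A" for m b
  proof -
    have "\<forall>m\<in>keys b. m \<in> A" using b by auto
    then show ?thesis
    proof (induction rule: mpoly_induct_keys)
      case (single m' a)
      have "mpoly_const a * single (m + m') 1 \<in> ?U" by (intro const mono m single)
      then show ?case by (simp add: const_mult_single mult_single)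
    next
      case zero
      show ?case using U0 by simp
    next
      case (add p p')
      then show ?case using \<open>\<And>p p'. p \<in> ?U \<Longrightarrow> p' \<in> ?U \<Longrightarrow> p + p' \<in> ?U\<close> by (simp only: distrib_left)
    qed
  qed
  have filt: "p \<in> ?U" if "p \<in> filt N c" for p
    using that f.subset by (auto intro!: exI[of _ 0])
  have mult_m: "single m 1 * p \<in> ?U" if m: "keys m \<subseteq> {1..N}" and p: "p \<in> ?U" for m p
  proof -
    from p obtain b where b: "keys b \<subseteq> A" "p - b \<in> filt N c" by blast
    have "single m 1 * (p - b) \<in> ?U" using b m by (intro filt f.mult polys_single)
    from add[OF this mult_b[OF m b(1)]] show ?thesis by (simp add: right_diff_distrib)
  qed
  have mult: "r * p \<in> ?U" if r: "r \<in> polys N" and p: "p \<in> ?U" for r p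
  proof -
    have "\<forall>m\<in>keys r. keys m \<subseteq> {1..N}" using r by (auto simp: polys_def)
    then show ?thesis
    proof (induction rule: mpoly_induct_keys)
      case (single m a)
      have "mpoly_const a * (single m 1 * p) \<in> ?U" by (intro const mult_m single p)
      then show ?case by (simp add: const_mult_single mult.assoc[symmetric])
    next
      case zero
      show ?case using U0 by simp
    next
      case (add r r')
      then show ?case using \<open>\<And>p p'. p \<in> ?U \<Longrightarrow> p' \<in> ?U \<Longrightarrow> p + p' \<in> ?U\<close> by (simp only: distrib_right)
    qed
  qed
  show ?thesis by (rule poly_ideal.intro) (use add mult U0 in blast)+
qed

lemma exists_chain:
  assumes N: "N \<ge> 1" and fin: "finite (basis N c)"
  shows "\<exists>U :: nat \<Rightarrow> 'k::field_char_0 mpoly set.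
    (\<forall>i\<le>card (basis N c). poly_ideal N (U i) \<and> filt N c \<subseteq> U i) \<and> (\<forall>i<card (basis N c). U i \<subset> U (Suc i))"
proof -
  obtain A where A: "\<And>j. j < card (basis N c) \<Longrightarrow> A j \<subset> A (Suc j)"
     "\<And>j. j \<le> card (basis N c) \<Longrightarrow> A j \<subseteq> basis N c"
     "\<And>j m m'. j \<le> card (basis N c) \<Longrightarrow> m \<in> A j \<Longrightarrow> m' \<in> basis N c \<Longrightarrow> mdeg m < mdeg m' \<Longrightarrow> m' \<in> A j"
    using exists_degree_filtration[OF fin] by metis
  define U where "U j = {p \<in> polys N. \<exists>b :: 'k mpoly. keys b \<subseteq> A j \<and> p - b \<in> filt N c}" for j
  have "filt N c \<subseteq> U j" for j using f.subset unfolding U_def by (auto intro!: exI[of _ 0])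
  moreover have "poly_ideal N (U j)" if "j \<le> card (basis N c)" for j
    unfolding U_def using A(2,3)[OF that] by (intro graded_poly_ideal N) blast+
  moreover have "U j \<subset> U (Suc j)" if j: "j < card (basis N c)" for j
  proof -
    from A(1)[OF j] obtain m where m: "m \<in> A (Suc j)" "m \<notin> A j" by blast
    have mB: "m \<in> basis N c" using A(2)[of "Suc j"] j m by auto
    have "single m 1 \<in> U (Suc j)" unfolding U_def
      using m(1) mB by (auto simp: basis_def intro!: polys_single exI[of _ "single m 1"])
    \<comment> \<open>By \<open>basis_independent\<close>, m is not congruent to a combination of
      the monomials in A j, as it is not one of them.\<close>
    moreover have "single m 1 \<notin> U j"
    proof
      assume "single m 1 \<in> U j"
      then obtain b where b: "keys b \<subseteq> A j" "single m (1 :: 'k) - b \<in> filt N c" by (auto simp: U_def)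
      have "keys (single m (1 :: 'k) - b) \<subseteq> basis N c"
        using keys_sub_mono[of "single m 1" b] b(1) A(2)[of j] j mB by auto
      from basis_independent[OF N this b(2)] have "b = single m 1" by simp
      with b(1) m(2) show False by simp
    qed
    moreover have "U j \<subseteq> U (Suc j)" unfolding U_def using A(1)[OF j] by blast
    ultimately show ?thesis by blast
  qed
  ultimately show ?thesis by (intro exI[of _ U]) blast
qed

lemma length_filt:
  assumes "d \<ge> 1"
  shows "module_length (qring (d + 1))
     (quotient_module (qring (d + 1)) (cls (d + 1) ` (filt (d + 1) (Suc k) :: 'k::field_char_0 mpoly set))) =
    enat (((k + d) choose d) + ((k + d - 1) choose d))"
proof -
  let ?B = "basis (d + 1) (Suc k)"
  have fin: "finite ?B" by (rule card_basis) fact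
  let ?P = "\<lambda>n. \<exists>U :: nat \<Rightarrow> 'k mpoly set. (\<forall>i\<le>n. poly_ideal (d + 1) (U i) \<and> filt (d + 1) (Suc k) \<subseteq> U i) \<and> (\<forall>i<n. U i \<subset> U (Suc i))"
  have le: "n \<le> card ?B" if "?P n" for n
  proof -
    from that obtain U :: "nat \<Rightarrow> 'k mpoly set" where
      "\<And>i. i \<le> n \<Longrightarrow> poly_ideal (d + 1) (U i)" "\<And>i. i \<le> n \<Longrightarrow> filt (d + 1) (Suc k) \<subseteq> U i"
      "\<And>i. i < n \<Longrightarrow> U i \<subset> U (Suc i)" by blast
    then show ?thesis by (intro chain_length_le[OF _ fin, of n U]) auto
  qed
  have ex: "?P (card ?B)" by (rule exists_chain[OF _ fin]) simp
  have "Sup {enat n | n. ?P n} = enat (card ?B)"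
  proof (rule antisym)
    show "Sup {enat n | n. ?P n} \<le> enat (card ?B)"
    proof (rule Sup_least)
      fix x assume "x \<in> {enat n | n. ?P n}"
      then obtain n where "x = enat n" "?P n" by blast
      with le[of n] show "x \<le> enat (card ?B)" by (simp only: enat_ord_simps)
    qed
    show "enat (card ?B) \<le> Sup {enat n | n. ?P n}" using ex by (intro Sup_upper) blast
  qed
  then show ?thesis
    unfolding card_basis(2)[OF assms] by (subst module_length_eq[OF f.poly_ideal_axioms]) auto
qed

section \<open>Krull dimension\<close>

definition mev :: "(nat \<Rightarrow> 'k::comm_ring_1 mpoly) \<Rightarrow> (nat \<Rightarrow>\<^sub>0 nat) \<Rightarrow> 'k mpoly" where
  "mev a m = (\<Prod>i\<in>keys m. a i ^ lookup m i)"

definition ev :: "(nat \<Rightarrow> 'k::comm_ring_1 mpoly) \<Rightarrow> 'k mpoly \<Rightarrow> 'k mpoly" where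
  "ev a = linext (mev a)"

lemma mev_superset: "finite A \<Longrightarrow> keys m \<subseteq> A \<Longrightarrow> mev a m = (\<Prod>i\<in>A. a i ^ lookup m i)"
  unfolding mev_def by (rule prod.mono_neutral_left) (auto simp: in_keys_iff)

lemma mev_add: "mev a (m + m') = mev a m * mev a m'"
  using mev_superset[of "keys m \<union> keys m'" "m + m'" a] mev_superset[of "keys m \<union> keys m'" m a]
    mev_superset[of "keys m \<union> keys m'" m' a]
  by (simp add: keys_add' lookup_add power_add prod.distrib)

lemma ev_add: "ev a (p + p') = ev a p + ev a p'"
  by (simp add: ev_def linext_add)

lemma ev_single: "ev a (single m c) = mpoly_const c * mev a m"
  by (simp add: ev_def linext_single)

lemma ev_const: "ev a (mpoly_const c) = mpoly_const c"
  by (simp add: mpoly_const_def ev_single mev_def)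

lemma ev_0 [simp]: "ev a 0 = 0" and ev_1 [simp]: "ev a 1 = 1"
  using ev_const[of a 0] ev_const[of a 1] by simp_all

lemma ev_mult: "ev a (p * p') = ev a p * ev a p'"
proof (induction p rule: mpoly_induct)
  case (single m c)
  show ?case
  proof (induction p' rule: mpoly_induct)
    case (single m' c')
    show ?case by (simp add: mult_single ev_single mev_add mpoly_const_mult mult_ac)
  qed (simp add: distrib_left ev_add)
qed (simp add: distrib_right ev_add)

lemma ev_var: "ev a (mpoly_var i) = a i"
  by (simp add: mpoly_var_def ev_single mev_def)

lemma ev_sum: "ev a (\<Sum>i\<in>A. f i) = (\<Sum>i\<in>A. ev a (f i))"
  by (rule sum_of_additive) (rule ev_add)

lemma ev_diff: "ev a (p - p') = ev a p - ev a p'"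
  using ev_add[of a "p - p'" p'] by simp

lemma ev_power: "ev a (p ^ k) = ev a p ^ k"
  by (induction k) (auto simp: ev_mult)

lemma ev_prod: "ev a (\<Prod>i\<in>A. f i) = (\<Prod>i\<in>A. ev a (f i))"
  by (induction A rule: infinite_finite_induct) (auto simp: ev_mult)

lemma ev_ev: "ev b (ev a p) = ev (\<lambda>i. ev b (a i)) p"
  by (induction p rule: mpoly_induct)
     (auto simp: ev_single ev_add ev_mult ev_const mev_def ev_prod ev_power)

lemma ev_quad: "ev a (quad N) = (\<Sum>i=1..N. a i ^ 2)"
  by (simp add: quad_def ev_sum ev_power ev_var)

section \<open>Lower bound for the dimension: primes from a parametrisation\<close>

lemma ev_kernel_prime:
  fixes a b :: "nat \<Rightarrow> 'k::field_char_0 mpoly"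
  assumes "ev a (quad N) = 0"
  shows "prime_poly_ideal N {p \<in> polys N. ev b (ev a p) = 0}"
  unfolding prime_poly_ideal_def
proof (intro conjI)
  show "poly_ideal N {p \<in> polys N. ev b (ev a p) = 0}"
    by unfold_locales (auto simp: ev_add ev_mult)
  show "qid N \<subseteq> {p \<in> polys N. ev b (ev a p) = 0}"
    using assms by (auto simp: qid_def ev_mult)
\<comment> \<open>Primality holds because the values are polynomials over a field, which have no
  zero divisors.\<close>
qed (auto simp: ev_mult)

text \<open>In the coordinates \<open>(x\<^sub>1 + \<iota> x\<^sub>2, x\<^sub>1 - \<iota> x\<^sub>2, x\<^sub>3, \<dots>)\<close>, where \<open>\<iota>\<^sup>2 = - 1\<close>, the quadric is parametrised
  by \<open>(s, w) \<mapsto> (s, - s r(w), s w)\<close> with \<open>r(w) = \<Sum> w\<^sub>k\<^sup>2\<close>; the variable with index 2 plays the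
  role of \<open>s\<close>.  Setting the parameters of high index to zero gives a descending chain of
  irreducible subvarieties.\<close>

definition cone :: "nat \<Rightarrow> 'k::field_char_0 \<Rightarrow> nat \<Rightarrow> 'k mpoly" where
  "cone N \<iota> i = (let s = mpoly_var 2; r = (\<Sum>k=3..N. mpoly_var k ^ 2) in
     if i = 1 then mpoly_const (1 / 2) * (s - s * r)
     else if i = 2 then mpoly_const (1 / (2 * \<iota>)) * (s + s * r)
     else s * mpoly_var i)"

definition restrict_vars :: "nat \<Rightarrow> nat \<Rightarrow> 'k::field_char_0 mpoly" where
  "restrict_vars M i = (if i \<le> M then mpoly_var i else 0)"

lemma mpoly_var_neq_0 [simp]: "mpoly_var i \<noteq> (0 :: 'k::field_char_0 mpoly)"
proof -
  have "lookup (mpoly_var i :: 'k mpoly) (single i 1) = 1" by (simp add: mpoly_var_def)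
  then show ?thesis by force
qed

lemma mpoly_const_eq_0 [simp]: "mpoly_const c = 0 \<longleftrightarrow> c = 0"
  by (metis lookup_single_eq lookup_zero mpoly_const_def mpoly_const_simps(1))

lemma cone_quad:
  fixes \<iota> :: "'k::field_char_0"
  assumes N: "N \<ge> 2" and \<iota>: "\<iota> ^ 2 = - 1"
  shows "ev (cone N \<iota>) (quad N) = 0"
proof -
  let ?s = "mpoly_var 2 :: 'k mpoly"
  let ?r = "(\<Sum>k=3..N. mpoly_var k ^ 2) :: 'k mpoly"
  have I: "{1..N} = insert 1 (insert 2 {3..N})" using N by auto
  have "ev (cone N \<iota>) (quad N) = cone N \<iota> 1 ^ 2 + (cone N \<iota> 2 ^ 2 + (\<Sum>i=3..N. cone N \<iota> i ^ 2))"
    unfolding ev_quad I by simp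
  also have "(\<Sum>i=3..N. cone N \<iota> i ^ 2) = ?s ^ 2 * ?r"
    by (simp add: cone_def sum_distrib_left power_mult_distrib)
  also have "cone N \<iota> 1 ^ 2 = mpoly_const (1 / 4) * (?s - ?s * ?r) ^ 2"
    by (simp add: cone_def Let_def power_mult_distrib power2_eq_square[of "mpoly_const _"] mpoly_const_mult[symmetric])
  also have "cone N \<iota> 2 ^ 2 = mpoly_const (- (1 / 4)) * (?s + ?s * ?r) ^ 2"
  proof -
    have "(1 / (2 * \<iota>)) * (1 / (2 * \<iota>)) = - (1 / 4)"
      using \<iota> by (simp add: power2_eq_square)
    then show ?thesis
      by (simp add: cone_def Let_def power_mult_distrib power2_eq_square[of "mpoly_const _"] mpoly_const_mult[symmetric])
  qed
  also have "mpoly_const (- (1 / 4)) = - mpoly_const (1 / 4 :: 'k)"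
    by (simp add: mpoly_const_def single_uminus)
  also have "mpoly_const (1 / 4) * (?s - ?s * ?r) ^ 2 + (- mpoly_const (1 / 4) * (?s + ?s * ?r) ^ 2 + ?s ^ 2 * ?r) =
      ?s ^ 2 * ?r * (1 - mpoly_const (1 / 4) * 4)"
    by (simp add: power2_eq_square algebra_simps)
  also have "mpoly_const (1 / 4) * 4 = (1 :: 'k mpoly)"
    using mpoly_const_mult[of "1 / 4 :: 'k" 4] mpoly_const_of_nat[of 4, where 'a='k] by simp
  finally show ?thesis by simp
qed

text \<open>Keeping the parameters of index at most M, for M = N, ..., 1, gives N primes. Index 1
  names no parameter, so at M = 1 everything is set to zero and the last prime is the maximal ideal
  at the origin.\<close>

lemma exists_prime_chain:
  fixes N :: nat
  assumes N: "N \<ge> 2"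
  shows "\<exists>U :: nat \<Rightarrow> 'k::{alg_closed_field, field_char_0} mpoly set.
    (\<forall>i\<le>N - 1. prime_poly_ideal N (U i)) \<and> (\<forall>i<N - 1. U i \<subset> U (Suc i))"
proof -
  obtain \<iota> :: 'k where \<iota>: "\<iota> ^ 2 = - 1" using nth_root_exists[of 2 "- 1 :: 'k"] by auto
  define W where "W M = {p \<in> polys N. ev (restrict_vars M) (ev (cone N \<iota>) p) = 0}" for M
  have prime: "prime_poly_ideal N (W M)" for M
    unfolding W_def by (rule ev_kernel_prime[OF cone_quad[OF N \<iota>]])
  have strict: "W (Suc M) \<subset> W M" if M: "1 \<le> M" "Suc M \<le> N" for M
  proof -
    have "ev (restrict_vars M) (restrict_vars (Suc M) i) = (restrict_vars M i :: 'k mpoly)" for i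
      by (simp add: restrict_vars_def ev_var)
    then have comp: "ev (restrict_vars M) p = ev (restrict_vars M) (ev (restrict_vars (Suc M)) p)" for p :: "'k mpoly"
      by (simp add: ev_ev)
    have "W (Suc M) \<subseteq> W M"
    proof
      fix p assume "p \<in> W (Suc M)"
      then show "p \<in> W M" using comp[of "ev (cone N \<iota>) p"] by (simp add: W_def)
    qed
    \<comment> \<open>Witnesses: for M = 1 the variable x_1, which becomes s / 2 once s is kept;
      otherwise x_(M+1), which becomes s times its parameter.\<close>
    moreover have "\<exists>p. p \<in> W M \<and> p \<notin> W (Suc M)"
    proof (cases "M = 1")
      case True
      have "(\<Sum>k=3..N. ev (restrict_vars (Suc (Suc 0))) (mpoly_var k) ^ 2) = (0 :: 'k mpoly)"
        by (rule sum.neutral) (auto simp: ev_var restrict_vars_def)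
      then show ?thesis using N True
        by (intro exI[of _ "mpoly_var 1"])
          (auto simp: W_def cone_def Let_def ev_var ev_mult ev_diff ev_const ev_sum ev_power restrict_vars_def)
    next
      case False
      then show ?thesis using M
        by (intro exI[of _ "mpoly_var (Suc M)"])
          (auto simp: W_def cone_def Let_def ev_var ev_mult restrict_vars_def)
    qed
    ultimately show ?thesis by blast
  qed
  have "W (N - i) \<subset> W (N - Suc i)" if "i < N - 1" for i
    using strict[of "N - Suc i"] that by (simp add: Suc_diff_Suc)
  then show ?thesis using prime by (intro exI[of _ "\<lambda>i. W (N - i)"]) blast
qed

section \<open>Upper bound for the dimension: independence along a chain of primes\<close>

lemma split_var:
  fixes P :: "'k::comm_ring_1 mpoly"
  obtains P0 P1 where "P = P0 + mpoly_var k * P1" "\<forall>m\<in>keys P0. m \<in> keys P \<and> k \<notin> keys m"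
    "\<forall>m\<in>keys P1. \<exists>m'\<in>keys P. keys m \<subseteq> keys m' \<and> mdeg m' = Suc (mdeg m)"
proof -
  define A where "A = {m \<in> keys P. k \<in> keys m}"
  define P0 where "P0 = (\<Sum>m\<in>keys P - A. single m (lookup P m))"
  define P1 where "P1 = (\<Sum>m\<in>A. single (m - single k 1) (lookup P m))"
  have "(\<Sum>m\<in>keys P. single m (lookup P m)) = P0 + (\<Sum>m\<in>A. single m (lookup P m))"
    unfolding P0_def by (rule sum.subset_diff) (auto simp: A_def)
  also have "(\<Sum>m\<in>A. single m (lookup P m)) = mpoly_var k * P1"
    unfolding P1_def sum_distrib_left
    by (rule sum.cong) (use single_factor(1)[of k] in \<open>auto simp: A_def\<close>)
  finally have "P = P0 + mpoly_var k * P1" using mpoly_eq_sum[of P] by simp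
  moreover have "keys P0 \<subseteq> keys P - A"
    unfolding P0_def by (rule order_trans[OF Poly_Mapping.keys_sum]) (auto split: if_splits)
  moreover have "keys P1 \<subseteq> (\<lambda>m. m - single k 1) ` A"
    unfolding P1_def by (rule order_trans[OF Poly_Mapping.keys_sum]) (auto split: if_splits)
  moreover have "\<exists>m'\<in>keys P. keys (m - single k 1) \<subseteq> keys m' \<and> mdeg m' = Suc (mdeg (m - single k 1))"
    if "m \<in> A" for m
    using that single_factor(2,3)[of k m] by (auto simp: A_def intro!: bexI[of _ m])
  ultimately show thesis by (intro that[of P0 P1]) (auto simp: A_def)
qed

lemma ev_polys:
  assumes "\<forall>m\<in>keys P. keys m \<subseteq> A" "\<And>i. i \<in> A \<Longrightarrow> f i \<in> polys N"
  shows "ev f P \<in> polys N"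
  unfolding ev_def linext_def mev_def using assms
  by (intro polys_sum polys_mult polys_prod polys_power polys_const) auto

text \<open>Downward induction on k, with P split as P0 + x_k P1. Modulo U_(k+1) the element f_k
  vanishes, so P0 = 0 by the outer induction; then f_k P1(f) lies in U_k, and primality strips off
  f_k. At k = n only constants remain, and U_n contains no unit.\<close>

lemma prime_chain_independent:
  fixes U :: "nat \<Rightarrow> 'k::field_char_0 mpoly set"
  assumes U: "\<And>i. i \<le> n \<Longrightarrow> prime_poly_ideal N (U i)" "\<And>i. i < n \<Longrightarrow> U i \<subset> U (Suc i)"
    and f: "\<And>i. i < n \<Longrightarrow> f i \<in> U (Suc i)" "\<And>i. i < n \<Longrightarrow> f i \<notin> U i"
    and "k \<le> n"
  shows "\<forall>m\<in>keys P. keys m \<subseteq> {k..<n} \<Longrightarrow> ev f P \<in> U k \<Longrightarrow> P = 0"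
  using \<open>k \<le> n\<close>
proof (induction k arbitrary: P rule: inc_induct)
  case base
  then have "keys P \<subseteq> {0}" by auto
  then have P: "P = mpoly_const (lookup P 0)"
    unfolding mpoly_const_def by (intro poly_mapping_eqI) (auto simp: lookup_single when_def in_keys_iff)
  interpret Un: poly_ideal N "U n" using U(1)[of n] by (simp add: prime_poly_ideal_def)
  show ?case
  proof (rule ccontr)
    assume "P \<noteq> 0"
    then have "lookup P 0 \<noteq> 0" using P by fastforce
    have "mpoly_const (lookup P 0) \<in> U n" using base P ev_const by metis
    then have "mpoly_const (1 / lookup P 0) * mpoly_const (lookup P 0) \<in> U n"
      by (rule Un.mult[OF polys_const])
    then show False
      using U(1)[of n] \<open>lookup P 0 \<noteq> 0\<close> by (simp add: prime_poly_ideal_def mpoly_const_mult[symmetric])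
  qed
next
  case (step k)
  interpret Uk: poly_ideal N "U k" using U(1)[of k] step.hyps by (simp add: prime_poly_ideal_def)
  interpret Us: poly_ideal N "U (Suc k)" using U(1)[of "Suc k"] step.hyps by (simp add: prime_poly_ideal_def)
  have fp: "f i \<in> polys N" if "i < n" for i
    using f(1)[OF that] U(1)[of "Suc i"] that poly_ideal.subset by (force simp: prime_poly_ideal_def)
  have "P = 0" if "\<forall>m\<in>keys P. mdeg m < t" "\<forall>m\<in>keys P. keys m \<subseteq> {k..<n}" "ev f P \<in> U k" for t P
    using that
  proof (induction t arbitrary: P)
    case 0
    then have "keys P = {}" by auto
    then show ?case by (metis keys_eq_empty)
  next
    case (Suc t)
    \<comment> \<open>\<open>P1\<close> may still contain x_k, but its degree is smaller, which the
      inner induction on t uses.\<close>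
    obtain P0 P1 where P: "P = P0 + mpoly_var k * P1" and P0: "\<forall>m\<in>keys P0. m \<in> keys P \<and> k \<notin> keys m"
      and P1: "\<forall>m\<in>keys P1. \<exists>m'\<in>keys P. keys m \<subseteq> keys m' \<and> mdeg m' = Suc (mdeg m)" by (rule split_var)
    have ev: "ev f P = ev f P0 + f k * ev f P1" by (simp add: P ev_add ev_mult ev_var)
    have k1: "\<forall>m\<in>keys P1. keys m \<subseteq> {k..<n}" using P1 Suc.prems(2) by blast
    have e1: "ev f P1 \<in> polys N" by (rule ev_polys[OF k1]) (use fp in auto)
    have "f k * ev f P1 \<in> U (Suc k)" using f(1)[of k] step.hyps e1 by auto
    moreover have "ev f P \<in> U (Suc k)" using Suc.prems(3) U(2)[of k] step.hyps by auto
    ultimately have "ev f P0 \<in> U (Suc k)" using Us.diff[of "ev f P" "f k * ev f P1"] ev by simp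
    moreover have "\<forall>m\<in>keys P0. keys m \<subseteq> {Suc k..<n}"
    proof
      fix m assume "m \<in> keys P0"
      then have "keys m \<subseteq> {k..<n} - {k}" using P0 Suc.prems(2) by blast
      also have "{k..<n} - {k} = {Suc k..<n}" by auto
      finally show "keys m \<subseteq> {Suc k..<n}" .
    qed
    ultimately have "P0 = 0" by (intro step.IH) auto
    then have "f k * ev f P1 \<in> U k" using ev Suc.prems(3) by simp
    then have "ev f P1 \<in> U k"
      using U(1)[of k] f(2)[of k] fp[of k] e1 step.hyps unfolding prime_poly_ideal_def by auto
    moreover have "\<forall>m\<in>keys P1. mdeg m < t" using P1 Suc.prems(1) by fastforce
    ultimately have "P1 = 0" using k1 by (intro Suc.IH) auto
    with \<open>P0 = 0\<close> P show ?case by simp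
  qed
  moreover have "\<forall>m\<in>keys P. mdeg m < Suc (Max (mdeg ` keys P))" by (auto simp: less_Suc_eq_le)
  ultimately show ?case using step.prems by blast
qed

lemma injective_card_le:
  fixes b :: "(nat \<Rightarrow>\<^sub>0 nat) \<Rightarrow> 'k::field_char_0 mpoly"
  assumes T: "finite T" and A: "finite A" and b: "\<And>m. m \<in> T \<Longrightarrow> keys (b m) \<subseteq> A"
    and inj: "\<And>u m. (\<Sum>m\<in>T. mpoly_const (u m) * b m) = 0 \<Longrightarrow> m \<in> T \<Longrightarrow> u m = 0"
  shows "card T \<le> card A"
proof -
  have inj_b: "inj_on b T"
  proof (rule inj_onI, rule ccontr)
    fix m m' assume m: "m \<in> T" "m' \<in> T" "b m = b m'" "m \<noteq> m'"
    \<comment> \<open>A repeated value would give a nontrivial relation with coefficients 1 and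
      -1.\<close>
    define u where "u x = (if x = m then 1 else if x = m' then - 1 else (0 :: 'k))" for x
    have "(\<Sum>x\<in>T. mpoly_const (u x) * b x) = (\<Sum>x\<in>{m, m'}. mpoly_const (u x) * b x)"
      by (rule sum.mono_neutral_right) (use T m in \<open>auto simp: u_def\<close>)
    also have "\<dots> = 0"
      using m by (simp add: u_def mpoly_const_def single_uminus)
    finally have "u m = 0" using m(1) by (rule inj)
    then show False by (simp add: u_def)
  qed
  have "V.independent (b ` T)"
    unfolding V.dependent_finite[OF finite_imageI[OF T]]
    using inj[of "\<lambda>m. _ (b m)"] by (force simp: sum.reindex[OF inj_b])
  then have "card (b ` T) \<le> card A" using independent_card_le[OF A, of "b ` T"] b by blast
  then show ?thesis by (simp add: card_image[OF inj_b])
qed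

definition degree_le :: "nat \<Rightarrow> 'k::comm_ring_1 mpoly set" where
  "degree_le t = {p. \<forall>m\<in>keys p. mdeg m \<le> t}"

lemma degree_le_mult: "p \<in> degree_le a \<Longrightarrow> p' \<in> degree_le b \<Longrightarrow> p * p' \<in> degree_le (a + b)"
  unfolding degree_le_def by (fastforce elim!: keys_mult_cases simp: mdeg_add intro: add_mono)

lemma degree_le_1: "1 \<in> degree_le a"
  by (simp add: degree_le_def)

lemma degree_le_power: "p \<in> degree_le a \<Longrightarrow> p ^ k \<in> degree_le (k * a)"
  by (induction k) (auto simp: degree_le_1 degree_le_mult)

lemma degree_le_prod: "(\<And>i. i \<in> A \<Longrightarrow> f i \<in> degree_le (g i)) \<Longrightarrow> prod f A \<in> degree_le (sum g A)"
  by (induction A rule: infinite_finite_induct) (auto simp: degree_le_1 degree_le_mult)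

lemma mev_degree_le:
  assumes "\<And>i. i \<in> keys m \<Longrightarrow> f i \<in> degree_le D"
  shows "mev f m \<in> degree_le (mdeg m * D)"
  unfolding mev_def mdeg_def sum_distrib_right
  by (intro degree_le_prod degree_le_power assms)

text \<open>Elements \<open>f\<^sub>i \<in> U\<^sub>i\<^sub>+\<^sub>1 - U\<^sub>i\<close> are algebraically independent modulo \<open>U\<^sub>0\<close>, so their monomials
  compete for the dimension of the space of classes of bounded degree.\<close>

lemma prime_chain_growth:
  fixes U :: "nat \<Rightarrow> 'k::field_char_0 mpoly set"
  assumes d: "d \<ge> 1" and U: "\<And>i. i \<le> n \<Longrightarrow> prime_poly_ideal (d + 1) (U i)" "\<And>i. i < n \<Longrightarrow> U i \<subset> U (Suc i)"
  shows "\<exists>D. \<forall>t. (t + n) choose n \<le> ((t * D + d) choose d) + ((t * D + d - 1) choose d)"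
proof -
  let ?N = "d + 1"
  have "\<exists>f. f \<in> U (Suc i) \<and> f \<notin> U i" if "i < n" for i using U(2)[OF that] by blast
  then obtain f where f: "\<And>i. i < n \<Longrightarrow> f i \<in> U (Suc i)" "\<And>i. i < n \<Longrightarrow> f i \<notin> U i" by metis
  have fp: "f i \<in> polys ?N" if "i < n" for i
    using f(1)[OF that] U(1)[of "Suc i"] that poly_ideal.subset by (force simp: prime_poly_ideal_def)
  \<comment> \<open>A crude common bound for the degrees of the f i, independent of t.\<close>
  define D where "D = (\<Sum>i<n. \<Sum>m\<in>keys (f i). mdeg m)"
  have fD: "f i \<in> degree_le D" if "i < n" for i
    unfolding degree_le_def
  proof (intro CollectI ballI)
    fix m assume "m \<in> keys (f i)"
    then have "mdeg m \<le> (\<Sum>m\<in>keys (f i). mdeg m)" by (intro member_le_sum) auto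
    also have "\<dots> \<le> D" unfolding D_def using that by (intro member_le_sum) auto
    finally show "mdeg m \<le> D" .
  qed
  have "(t + n) choose n \<le> ((t * D + d) choose d) + ((t * D + d - 1) choose d)" for t
  proof -
    define T where "T = monomials {..<n} t"
    define B where "B = basis ?N (Suc (t * D))"
    have T: "finite T" "card T = (t + n) choose n" using card_monomials[of "{..<n}" t] by (auto simp: T_def)
    have B: "finite B" "card B = ((t * D + d) choose d) + ((t * D + d - 1) choose d)"
      unfolding B_def by (intro card_basis d)+
    have "\<exists>b. keys b \<subseteq> B \<and> mev f m - b \<in> qid ?N" if "m \<in> T" for m
    proof -
      have m: "keys m \<subseteq> {..<n}" "mdeg m \<le> t" using that by (auto simp: T_def monomials_def)
      have "mev f m \<in> degree_le (mdeg m * D)" using m fD by (intro mev_degree_le) auto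
      moreover have "mdeg m * D \<le> t * D" using m by simp
      moreover have "mev f m \<in> polys ?N" using m fp unfolding mev_def by (intro polys_prod polys_power) auto
      ultimately have "\<forall>m'\<in>keys (mev f m). keys m' \<subseteq> {1..?N} \<and> mdeg m' < Suc (t * D)"
        unfolding degree_le_def polys_def less_Suc_eq_le by (blast intro: order_trans)
      then show ?thesis unfolding B_def by (intro reduce) auto
    qed
    then obtain b where b: "\<And>m. m \<in> T \<Longrightarrow> keys (b m) \<subseteq> B" "\<And>m. m \<in> T \<Longrightarrow> mev f m - b m \<in> qid ?N" by metis
    have "card T \<le> card B"
    proof (rule injective_card_le[OF T(1) B(1) b(1)])
      fix u m assume z: "(\<Sum>m\<in>T. mpoly_const (u m) * b m) = 0" and m: "m \<in> T"
      define P where "P = (\<Sum>m\<in>T. single m (u m))"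
      \<comment> \<open>A relation between the normal forms b m is a relation modulo q between the
        monomials in the f i.\<close>
      have "ev f P = (\<Sum>m\<in>T. mpoly_const (u m) * (mev f m - b m))"
        using z by (simp add: P_def ev_sum ev_single right_diff_distrib sum_subtractf)
      also have "\<dots> \<in> qid ?N" using b(2) by (intro q.sum q.mult polys_const)
      finally have "ev f P \<in> U 0" using U(1)[of 0] by (auto simp: prime_poly_ideal_def)
      moreover have "keys P \<subseteq> T"
        unfolding P_def by (rule order_trans[OF Poly_Mapping.keys_sum]) (auto split: if_splits)
      then have "\<forall>m\<in>keys P. keys m \<subseteq> {0..<n}" unfolding T_def monomials_def atLeast0LessThan by blast
      ultimately have "P = 0" 
        by (intro prime_chain_independent[where n = n and U = U and f = f and k = 0, OF U f]) auto
      moreover have "lookup P m = u m" using T(1) m by (simp add: P_def lookup_sum lookup_single when_def)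
      ultimately show "u m = 0" by simp
    qed
    then show ?thesis using T B by simp
  qed
  then show ?thesis by blast
qed

text \<open>In t, the left side grows like t^n and the right side at most like t^d. If n > d, the
  resulting bound t^n <= C t^d fails at t = C + 1.\<close>

lemma growth_bound:
  fixes d n D :: nat
  assumes "\<And>t. (t + n) choose n \<le> ((t * D + d) choose d) + ((t * D + d - 1) choose d)"
  shows "n \<le> d"
proof (rule ccontr)
  assume "\<not> n \<le> d"
  then have n: "d < n" by simp
  \<comment> \<open>n^n clears the denominator in ((t + n) / n)^n <= (t + n choose n), 2 accounts
    for the two binomials on the right, and (D + d)^d comes from t D + d <= (D + d) t.\<close>
  define C where "C = n ^ n * (2 * (D + d) ^ d)"
  have bound: "t ^ n \<le> C * t ^ d" if t: "t \<ge> 1" for t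
  proof -
    have "(real (t + n) / real n) ^ n \<le> real ((t + n) choose n)"
      using binomial_ge_n_over_k_pow_k[of n "t + n", where 'a=real] by simp
    then have "real (t + n) ^ n \<le> real n ^ n * real ((t + n) choose n)"
      using n by (simp add: power_divide divide_le_eq mult.commute)
    then have "(t + n) ^ n \<le> n ^ n * ((t + n) choose n)"
      unfolding of_nat_power[symmetric] of_nat_mult[symmetric] of_nat_le_iff .
    moreover have "t ^ n \<le> (t + n) ^ n" by (rule power_mono) auto
    ultimately have 1: "t ^ n \<le> n ^ n * ((t + n) choose n)" by simp
    have "(t * D + d - 1) choose d \<le> (t * D + d) choose d" by (rule binomial_right_mono) auto
    then have "(t + n) choose n \<le> 2 * ((t * D + d) choose d)" using assms[of t] by simp
    also have "(t * D + d) choose d \<le> (t * D + d) ^ d" by (rule binomial_le_pow) auto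
    also have "\<dots> \<le> ((D + d) * t) ^ d"
      using t by (intro power_mono) (auto simp: algebra_simps)
    finally have "(t + n) choose n \<le> 2 * ((D + d) ^ d * t ^ d)" by (simp add: power_mult_distrib)
    then have "n ^ n * ((t + n) choose n) \<le> n ^ n * (2 * ((D + d) ^ d * t ^ d))" by (rule mult_left_mono) auto
    with 1 have "t ^ n \<le> n ^ n * (2 * ((D + d) ^ d * t ^ d))" by (rule le_trans)
    then show ?thesis by (simp only: C_def mult.assoc)
  qed
  define t where "t = C + 1"
  have "t ^ (n - d) * t ^ d = t ^ n" using n by (simp flip: power_add)
  also have "\<dots> \<le> C * t ^ d" by (rule bound) (simp add: t_def)
  finally have "t ^ (n - d) \<le> C" by (rule mult_right_le_imp_le) (simp add: t_def)
  moreover have "t \<le> t ^ (n - d)" using n by (intro self_le_power) (auto simp: t_def)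
  ultimately show False by (simp add: t_def)
qed

lemma krull_dim_quadric:
  assumes "d \<ge> 1"
  shows "krull_dim (qring (d + 1) :: ('k::{alg_closed_field, field_char_0}, _) module) = enat d"
proof -
  let ?P = "\<lambda>n. \<exists>U :: nat \<Rightarrow> 'k mpoly set. (\<forall>i\<le>n. prime_poly_ideal (d + 1) (U i)) \<and> (\<forall>i<n. U i \<subset> U (Suc i))"
  have le: "n \<le> d" if P: "?P n" for n
  proof -
    from P obtain U :: "nat \<Rightarrow> 'k mpoly set" where
      "\<And>i. i \<le> n \<Longrightarrow> prime_poly_ideal (d + 1) (U i)" "\<And>i. i < n \<Longrightarrow> U i \<subset> U (Suc i)" by blast
    then have "\<exists>D. \<forall>t. (t + n) choose n \<le> ((t * D + d) choose d) + ((t * D + d - 1) choose d)"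
      by (intro prime_chain_growth[OF assms, of n U])
    then show ?thesis using growth_bound by blast
  qed
  have ex: "?P d" using exists_prime_chain[of "d + 1", where 'k='k] assms by simp
  show ?thesis unfolding krull_dim_qring
  proof (rule antisym)
    show "Sup {enat n | n. ?P n} \<le> enat d"
    proof (rule Sup_least)
      fix x assume "x \<in> {enat n | n. ?P n}"
      then obtain n where "x = enat n" "?P n" by blast
      with le[of n] show "x \<le> enat d" by (simp only: enat_ord_simps)
    qed
    show "enat d \<le> Sup {enat n | n. ?P n}" using ex by (intro Sup_upper) blast
  qed
qed

section \<open>The limit\<close>

text \<open>The Pochhammer symbol has d factors, each equal to n/2 up to a bounded error.\<close>

lemma pochhammer_quotient_tendsto:
  "(\<lambda>n. pochhammer (real ((n - 1) div 2) + c) d / real n ^ d) \<longlonglongrightarrow> (1 / 2) ^ d"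
proof -
  have k: "(\<lambda>n. (real ((n - 1) div 2) + a) / real n) \<longlonglongrightarrow> 1 / 2" for a :: real
  proof (rule tendsto_sandwich)
    have b: "real n / 2 - 1 \<le> real ((n - 1) div 2)" "real ((n - 1) div 2) \<le> real n / 2" for n :: nat
      by linarith+
    show "\<forall>\<^sub>F n in sequentially. (real n / 2 - 1 + a) / real n \<le> (real ((n - 1) div 2) + a) / real n"
      "\<forall>\<^sub>F n in sequentially. (real ((n - 1) div 2) + a) / real n \<le> (real n / 2 + a) / real n"
      using b by (auto intro!: always_eventually divide_right_mono)
    show "(\<lambda>n. (real n / 2 - 1 + a) / real n) \<longlonglongrightarrow> 1 / 2" by real_asymp
    show "(\<lambda>n. (real n / 2 + a) / real n) \<longlonglongrightarrow> 1 / 2" by real_asymp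
  qed
  have "(\<lambda>n. \<Prod>i=0..<d. (real ((n - 1) div 2) + (c + real i)) / real n) \<longlonglongrightarrow> (\<Prod>i=0..<d. 1 / 2)"
    by (intro tendsto_prod k)
  then show ?thesis by (simp add: pochhammer_prod prod_dividef add.assoc)
qed

text \<open>Both binomials are Pochhammer symbols over d!, starting at k + 1 and at k. Each
  contributes (1/2)^d.\<close>

lemma length_quotient_tendsto:
  assumes "d \<ge> 1"
  shows "(\<lambda>n. let k = (n - 1) div 2 in
      real (((k + d) choose d) + ((k + d - 1) choose d)) / (real n ^ d / fact d)) \<longlonglongrightarrow> (1 / 2) ^ (d - 1)"
proof -
  have 1: "real ((k + d) choose d) = pochhammer (real k + 1) d / fact d" for k
    by (simp add: binomial_gbinomial gbinomial_pochhammer')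
  have 2: "real ((k + d - 1) choose d) = pochhammer (real k + 0) d / fact d" for k
    using assms by (simp add: binomial_gbinomial gbinomial_pochhammer' of_nat_diff)
  have "(\<lambda>n. pochhammer (real ((n - 1) div 2) + 1) d / real n ^ d +
      pochhammer (real ((n - 1) div 2) + 0) d / real n ^ d) \<longlonglongrightarrow> (1 / 2) ^ d + (1 / 2) ^ d"
    by (intro tendsto_add pochhammer_quotient_tendsto)
  moreover have "(1 / 2) ^ d + (1 / 2) ^ d = (1 / 2 :: real) ^ (d - 1)"
    using assms by (cases d) auto
  moreover have "pochhammer x d / real n ^ d + pochhammer y d / real n ^ d =
      (pochhammer x d / fact d + pochhammer y d / fact d) / (real n ^ d / fact d)" for x y n
    by (simp add: add_divide_distrib[symmetric])
  ultimately show ?thesis unfolding Let_def of_nat_add 1 2 by simp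
qed

theorem theorem7p17:
  fixes d :: nat
  assumes "d \<ge> 2"
  shows "diff_signature
           (ring_of_type_algebra :: 'k :: {alg_closed_field, field_char_0} ring)
           (mpoly_quotient (d + 1) (quadric_ideal (d + 1)))
           (irrelevant_ideal (d + 1) (quadric_ideal (d + 1)))
         = ereal ((1 / 2) ^ (d - 1))"
proof -
  let ?R = "qring (d + 1) :: ('k, _) module" and ?N = "d + 1"
  let ?len = "\<lambda>n. let k = (n - 1) div 2 in ((k + d) choose d) + ((k + d - 1) choose d)"
  have d: "d \<ge> 1" "?N \<ge> 3" using assms by simp_all
  have len: "module_length ?R (quotient_module ?R (diff_power ring_of_type_algebra ?R
      (irrelevant_ideal ?N (qid ?N)) n)) = enat (?len n)" for n
    unfolding diff_power_eq[OF d(2)] length_filt[OF d(1)] Let_def ..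
  have "(\<lambda>n. ereal (real (?len n) / (real n ^ d / fact d))) \<longlonglongrightarrow> ereal ((1 / 2) ^ (d - 1))"
    using length_quotient_tendsto[OF d(1)] by (simp add: Let_def)
  then have "limsup (\<lambda>n. ereal (real (?len n) / (real n ^ d / fact d))) = ereal ((1 / 2) ^ (d - 1))"
    by (intro lim_imp_Limsup) auto
  \<comment> \<open>At n = 0 the divisor is 0, where extended real division gives infinity and real
    division gives 0. The sequences agree for n > 0, which is enough for the limit superior.\<close>
  moreover have "limsup (\<lambda>n. ereal_of_enat (enat (?len n)) / ereal (real n ^ d / fact d)) =
      limsup (\<lambda>n. ereal (real (?len n) / (real n ^ d / fact d)))"
    by (rule Limsup_eq) (auto intro!: eventually_mono[OF eventually_gt_at_top[of 0]] simp: Let_def)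
  ultimately show ?thesis
    unfolding quadric_ideal_eq qring_def[symmetric] diff_signature_def krull_dim_quadric[OF d(1)] len
    by (simp add: Let_def)
qed

end
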